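(* Let $L>0$, let $a$ satisfy (H_a), $g\in L^2(0,L)$, and let $\phi$ satisfy (H_φ), $\phi(0)=+\infty$, (H_int), (H_bdd), and be non-increasing on $[0,+\infty)$ (i.e. $\phi(s)\ge\phi(t)$ whenever $0\le s\le t$). Assume that for every $\eta\in(0,L)$ there is $M_\eta>0$ with $g(x)\ge -M_\eta$ for a.e. $x\in[0,L-\eta]$. Assume that problem (P) has at least one weak solution. Then there exist a number $$c^*\le \frac{1}{\sqrt L}\Big(\frac{\beta}{\alpha}+1\Big)\|g\|_{L^2(0,L)}-\inf_{s\in\mathbb{R}}\phi(s)$$ and a map $U:(-\infty,c^*]\to H^1_0(0,L)$, continuous for the weak topology of $H^1_0(0,L)$, such that: for every $c\le c^*$, $U(c)$ is a weak solution of (P) satisfying $a\,\frac{dU(c)}{dx}=\phi(U(c))+g+c$ in $\mathcal D'(0,L)$; $U(c)\ge0$; if $c_1<c_2\le c^*$ then $U(c_1)(x)<U(c_2)(x)$ for every $x\in(0,L)$; $U(c)\to0$ weakly in $H^1_0(0,L)$ and uniformly on $[0,L]$ as $c\to-\infty$; and every weak solution $u$ of (P) equals $U(c)$ for some $c\in(-\infty,c^*]$.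
   Context: (H_a): $a\in L^\infty(0,L)$ and there are constants $0<\alpha<\beta$ with $\alpha\le a(x)\le\beta$ for a.e. $x\in(0,L)$. (H_φ): $\phi:\mathbb{R}\to\mathbb{R}\cup\{+\infty\}$ is continuous when $\mathbb{R}\cup\{+\infty\}$ carries its usual topology, and $\phi(s)<+\infty$ for every $s\neq0$. (H_int): $\int_0^\delta\phi(t)\,dt<+\infty$ and $\int_{-\delta}^0\phi(t)\,dt<+\infty$ for every $\delta\in(0,1)$ (i.e. $\phi$ is integrable near $0$). (H_bdd): for every $\delta>0$, $\phi$ is bounded (and continuous) on $\mathbb{R}\setminus(-\delta,\delta)$. A weak solution of problem (P) with data $(a,g,\phi)$ is a function $u$ with $u\in H^1_0(0,L)$, $\phi(u)\in L^2(0,L)$, and $-\frac{d}{dx}(a\frac{du}{dx})=-\frac{d\phi(u)}{dx}-\frac{dg}{dx}$ in $\mathcal D'(0,L)$. *)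

theory Defs
  imports "HOL-Analysis.Analysis"
begin

text \<open>Functions on the interval (0,L) are represented as total functions real => real;
only their values on [0,L] (resp. a.e. on (0,L)) matter.\<close>

definition L2 :: "real \<Rightarrow> (real \<Rightarrow> real) \<Rightarrow> bool" where
  "L2 L f \<longleftrightarrow> set_borel_measurable lebesgue {0<..<L} f \<and>
                 set_integrable lebesgue {0<..<L} (\<lambda>x. (f x)\<^sup>2)"

definition L2_norm :: "real \<Rightarrow> (real \<Rightarrow> real) \<Rightarrow> real" where
  "L2_norm L f = sqrt (LINT x:{0<..<L}|lebesgue. (f x)\<^sup>2)"

definition test_fn :: "real \<Rightarrow> (real \<Rightarrow> real) \<Rightarrow> bool" where
  "test_fn L \<psi> \<longleftrightarrow> (\<forall>n x. ((deriv ^^ n) \<psi>) differentiable (at x)) \<and>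
     (\<exists>K. compact K \<and> K \<subseteq> {0<..<L} \<and> (\<forall>x. x \<notin> K \<longrightarrow> \<psi> x = 0))"

definition weak_deriv :: "real \<Rightarrow> (real \<Rightarrow> real) \<Rightarrow> (real \<Rightarrow> real) \<Rightarrow> bool" where
  "weak_deriv L u v \<longleftrightarrow> (\<forall>\<psi>. test_fn L \<psi> \<longrightarrow>
     (LINT x:{0<..<L}|lebesgue. u x * deriv \<psi> x) = - (LINT x:{0<..<L}|lebesgue. v x * \<psi> x))"

text \<open>H^1_0(0,L): u in L^2 with weak derivative in L^2, where u is taken to be the continuous
  representative on [0,L], and this representative vanishes at 0 and L (zero trace).\<close>
definition H10 :: "real \<Rightarrow> (real \<Rightarrow> real) \<Rightarrow> bool" where
  "H10 L u \<longleftrightarrow> L2 L u \<and> (\<exists>v. L2 L v \<and> weak_deriv L u v) \<and>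
     continuous_on {0..L} u \<and> u 0 = 0 \<and> u L = 0"

definition H1_deriv :: "real \<Rightarrow> (real \<Rightarrow> real) \<Rightarrow> (real \<Rightarrow> real)" where
  "H1_deriv L u = (SOME v. L2 L v \<and> weak_deriv L u v)"

definition H1_inner :: "real \<Rightarrow> (real \<Rightarrow> real) \<Rightarrow> (real \<Rightarrow> real) \<Rightarrow> real" where
  "H1_inner L u w = (LINT x:{0<..<L}|lebesgue. u x * w x)
                  + (LINT x:{0<..<L}|lebesgue. H1_deriv L u x * H1_deriv L w x)"

text \<open>The real-valued function phi(s), used where phi(s) is finite.\<close>
definition phr :: "(real \<Rightarrow> ereal) \<Rightarrow> real \<Rightarrow> real" where
  "phr \<phi> s = real_of_ereal (\<phi> s)"

definition weak_sol :: "real \<Rightarrow> (real \<Rightarrow> real) \<Rightarrow> (real \<Rightarrow> real) \<Rightarrow> (real \<Rightarrow> ereal)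
                          \<Rightarrow> (real \<Rightarrow> real) \<Rightarrow> bool" where
  "weak_sol L a g \<phi> u \<longleftrightarrow> H10 L u \<and>
     (AE x in lebesgue. x \<in> {0<..<L} \<longrightarrow> \<phi> (u x) \<noteq> \<infinity>) \<and>
     L2 L (\<lambda>x. phr \<phi> (u x)) \<and>
     (\<forall>\<psi>. test_fn L \<psi> \<longrightarrow>
        (LINT x:{0<..<L}|lebesgue. a x * H1_deriv L u x * deriv \<psi> x)
      = (LINT x:{0<..<L}|lebesgue. (phr \<phi> (u x) + g x) * deriv \<psi> x))"

end

theory Submission
  imports Defs
begin

text \<open>
  A weak solution satisfies \<open>a u' = \<phi>(u) + g + c\<close> almost everywhere for some constant \<open>c\<close>. Near a zero of
  \<open>u\<close> in \<open>[0,L)\<close> the term \<open>\<phi>(u)\<close> dominates, because \<open>g\<close> is bounded below there, so \<open>u\<close> increases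
  through every such zero; hence \<open>u > 0\<close> on \<open>(0,L)\<close>, and only the non-increasing branch of \<open>\<phi>\<close> on
  \<open>(0,\<infinity>)\<close> matters. On that branch the right-hand side is non-increasing in \<open>u\<close>, so the solution with
  \<open>u(0) = 0\<close> is unique and depends strictly monotonically and Lipschitz continuously on \<open>c\<close>.

  Let \<open>c\<^sub>0\<close> be solvable and \<open>c < c\<^sub>0\<close>. Replacing \<open>\<phi>\<close> by its Lipschitz inf-convolutions from below gives an
  increasing sequence of solutions of initial value problems, whose limit lies strictly between \<open>0\<close> and
  the solution for \<open>c\<^sub>0\<close> and therefore vanishes at \<open>L\<close> as well. With a primitive \<open>\<Phi>\<close> of \<open>\<phi>\<close>, which is finite
  at \<open>0\<close>, the identity \<open>\<integral> \<phi>(u) u' = [\<Phi>(u)]\<close> bounds \<open>\<phi>(u)\<close> in \<open>L\<^sup>2\<close>. So the solvable parameters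
  form a half-line, which is closed by dominated convergence.

  Since \<open>\<integral> \<phi>(u) u' = \<integral> u' = 0\<close>, testing the equation with \<open>u'\<close> bounds \<open>u'\<close> in \<open>L\<^sup>2\<close> uniformly in \<open>c\<close>; this
  compactness yields the convergence to \<open>0\<close> as \<open>c \<rightarrow> -\<infinity>\<close>.
\<close>

section \<open>Test functions and the du Bois-Reymond lemma\<close>

text \<open>\<open>\<phi>\<close> is only integrable at 0, so no Lipschitz theory applies at the
  starting point \<open>u 0 = 0\<close>. Comparison uses one-sided monotonicity instead: where one
  solution exceeds another, the antimonotone nonlinearity cannot drive them further apart.
  Inf-convolutions suit this because they are Lipschitz, increase to the nonlinearity and stay
  antimonotone. A lower bound \<open>u t \<ge> kap * t\<close>, uniform along the approximation,
  turns integrability of the nonlinearity \<open>p\<close> into the majorant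
  \<open>p (kap * t)\<close>. Since \<open>g\<close> may be unbounded below near \<open>L\<close>,
  \<open>kap\<close> is found only on \<open>[0,x0]\<close> with \<open>x0 < L\<close>. The endpoint
  \<open>L\<close> is reached by squeezing below a known solution and by the energy identity, which
  sees only the values of \<open>u\<close> at the ends. The factor \<open>\<beta> / \<alpha>\<close>
  in the bound on the parameter comes from integrating \<open>u'\<close> over \<open>[0,L]\<close>,
  with \<open>1 / \<beta>\<close> as lower bound of \<open>1 / a\<close> on the constant part,
  \<open>1 / \<alpha>\<close> as upper bound on the \<open>g\<close> part, and Cauchy-Schwarz. Weak
  derivatives are defined by smooth test functions, so a supply of these has to be built first, rich
  enough to recover integrals over intervals.\<close>

definition flat_exp :: "nat \<Rightarrow> real \<Rightarrow> real" where
  "flat_exp k x = (if x > 0 then exp (- (1 / x)) / x ^ k else 0)"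

lemma abs_flat_exp_le: "\<bar>flat_exp k x\<bar> \<le> fact (k + 2) * x\<^sup>2"
proof (cases "x > 0")
  case True
  define y where "y = 1 / x"
  have y: "y > 0" and x: "x = 1 / y"
    using True by (auto simp: y_def)
  have "y ^ m \<le> fact m * exp y" for m
  proof -
    have "(\<Sum>n\<in>{m}. y ^ n /\<^sub>R fact n) \<le> suminf (\<lambda>n. y ^ n /\<^sub>R fact n)"
      using y by (intro sum_le_suminf summable_exp_generic) auto
    then show ?thesis
      by (simp add: exp_def field_simps)
  qed
  from this[of "k + 2"] have "y ^ (k + 2) * exp (- y) \<le> fact (k + 2) * exp y * exp (- y)"
    by (rule mult_right_mono) simp
  then have "y ^ (k + 2) * exp (- y) \<le> fact (k + 2)"
    by (simp only: mult.assoc exp_minus_inverse mult_1_right)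
  moreover have "flat_exp k x = y ^ (k + 2) * exp (- y) * x\<^sup>2"
    using True by (simp add: flat_exp_def y_def field_simps power_add power2_eq_square)
  moreover have "flat_exp k x \<ge> 0"
    using True by (simp add: flat_exp_def)
  ultimately show ?thesis
    by (simp add: mult_right_mono)
qed (simp add: flat_exp_def)

lemma flat_exp_has_derivative:
  "(flat_exp k has_real_derivative (flat_exp (k + 2) x - real k * flat_exp (k + 1) x)) (at x)"
proof -
  consider "x > 0" | "x < 0" | "x = 0" by linarith
  then show ?thesis
  proof cases
    case 1
    have pow: "real k * x ^ (k - Suc 0) = real k * x ^ k / x"
      using 1 by (cases k) auto
    have "((\<lambda>x. exp (- (1 / x)) / x ^ k) has_real_derivative
        exp (- (1 / x)) / x ^ (k + 2) - real k * (exp (- (1 / x)) / x ^ (k + 1))) (at x)"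
      using 1 by (auto intro!: derivative_eq_intros simp: pow)
        (simp add: field_simps power2_eq_square power_add)
    then have "(flat_exp k has_real_derivative
        exp (- (1 / x)) / x ^ (k + 2) - real k * (exp (- (1 / x)) / x ^ (k + 1))) (at x)"
      by (rule has_field_derivative_transform_within_open[where S = "{0<..}"])
        (use 1 in \<open>auto simp: flat_exp_def\<close>)
    then show ?thesis
      using 1 by (simp add: flat_exp_def)
  next
    case 2
    have "(flat_exp k has_real_derivative 0) (at x)"
      by (rule has_field_derivative_transform_within_open[where S = "{..<0}" and f = "\<lambda>_. 0"])
        (use 2 in \<open>auto simp: flat_exp_def\<close>)
    then show ?thesis
      using 2 by (simp add: flat_exp_def)
  next
    case 3
    have "((\<lambda>h. (flat_exp k (0 + h) - flat_exp k 0) / h) \<longlongrightarrow> 0) (at 0)"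
    proof (rule Lim_null_comparison)
      show "\<forall>\<^sub>F h in at 0. norm ((flat_exp k (0 + h) - flat_exp k 0) / h) \<le> fact (k + 2) * \<bar>h\<bar>"
      proof (rule always_eventually, rule allI)
        fix h :: real
        show "norm ((flat_exp k (0 + h) - flat_exp k 0) / h) \<le> fact (k + 2) * \<bar>h\<bar>"
        proof (cases "h = 0")
          case False
          then show ?thesis
            using abs_flat_exp_le[of k h]
            by (simp add: flat_exp_def[of k 0] divide_le_eq mult.assoc power2_eq_square flip: abs_mult)
        qed simp
      qed
      have "((\<lambda>h. fact (k + 2) * \<bar>h::real\<bar>) \<longlongrightarrow> fact (k + 2) * \<bar>0\<bar>) (at 0)"
        by (intro tendsto_intros)
      then show "((\<lambda>h. fact (k + 2) * \<bar>h::real\<bar>) \<longlongrightarrow> 0) (at 0)"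
        by simp
    qed
    then show ?thesis
      using 3 by (simp add: DERIV_def flat_exp_def)
  qed
qed

text \<open>\<open>test_fn\<close> asks for differentiability of every iterated
  \<open>deriv\<close>. This class contains the cut-offs used below and is closed under
  differentiation, so one derivative per generator yields all orders.\<close>

inductive flat_algebra :: "(real \<Rightarrow> real) \<Rightarrow> bool" where
  base: "flat_algebra (\<lambda>x. flat_exp k (c * x + d))"
| scale: "flat_algebra f \<Longrightarrow> flat_algebra (\<lambda>x. r * f x)"
| add: "flat_algebra f \<Longrightarrow> flat_algebra g \<Longrightarrow> flat_algebra (\<lambda>x. f x + g x)"
| mult: "flat_algebra f \<Longrightarrow> flat_algebra g \<Longrightarrow> flat_algebra (\<lambda>x. f x * g x)"

lemma flat_algebra_derivative:
  assumes "flat_algebra f"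
  shows "\<exists>g. flat_algebra g \<and> (\<forall>x. (f has_real_derivative g x) (at x))"
  using assms
proof induction
  case (base k c d)
  have "flat_algebra (\<lambda>x. c * (flat_exp (k + 2) (c * x + d) + (- real k) * flat_exp (k + 1) (c * x + d)))"
    by (intro flat_algebra.intros)
  moreover have "((\<lambda>x. flat_exp k (c * x + d)) has_real_derivative
     c * (flat_exp (k + 2) (c * x + d) + (- real k) * flat_exp (k + 1) (c * x + d))) (at x)" for x
    by (rule DERIV_cong, rule DERIV_chain2[OF flat_exp_has_derivative])
      (auto intro!: derivative_eq_intros simp: algebra_simps)
  ultimately show ?case by blast
next
  case (scale f r)
  then obtain g where "flat_algebra g" "\<And>x. (f has_real_derivative g x) (at x)" by blast
  then show ?case
    by (intro exI[of _ "\<lambda>x. r * g x"]) (auto intro!: flat_algebra.intros derivative_eq_intros)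
next
  case (add f1 f2)
  then obtain g1 g2 where "flat_algebra g1" "\<And>x. (f1 has_real_derivative g1 x) (at x)"
     "flat_algebra g2" "\<And>x. (f2 has_real_derivative g2 x) (at x)" by blast
  then show ?case
    by (intro exI[of _ "\<lambda>x. g1 x + g2 x"]) (auto intro!: flat_algebra.intros derivative_eq_intros)
next
  case (mult f1 f2)
  then obtain g1 g2 where "flat_algebra g1" "\<And>x. (f1 has_real_derivative g1 x) (at x)"
     "flat_algebra g2" "\<And>x. (f2 has_real_derivative g2 x) (at x)" by blast
  with mult.hyps show ?case
    by (intro exI[of _ "\<lambda>x. g1 x * f2 x + g2 x * f1 x"])
      (auto intro!: flat_algebra.intros derivative_eq_intros)
qed

lemma flat_algebra_funpow_deriv: "flat_algebra f \<Longrightarrow> flat_algebra ((deriv ^^ n) f)"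
proof (induction n)
  case (Suc n)
  then obtain g where g: "flat_algebra g" "\<And>x. ((deriv ^^ n) f has_real_derivative g x) (at x)"
    using flat_algebra_derivative by blast
  then have "(deriv ^^ Suc n) f = g"
    by (auto simp: fun_eq_iff intro!: DERIV_imp_deriv)
  with g show ?case by simp
qed simp

lemma flat_algebra_smooth:
  assumes "flat_algebra f"
  shows "((deriv ^^ n) f) differentiable (at x)"
proof -
  obtain g where "\<And>x. ((deriv ^^ n) f has_real_derivative g x) (at x)"
    using flat_algebra_derivative flat_algebra_funpow_deriv assms by blast
  then show ?thesis
    using real_differentiable_def by blast
qed

lemma flat_algebra_continuous: "flat_algebra f \<Longrightarrow> continuous_on S f"
  using flat_algebra_derivative DERIV_isCont continuous_at_imp_continuous_on by metis

text \<open>Smooth bumps supported in \<open>[0,h]\<close> with values in \<open>[0,1]\<close> that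
  tend pointwise to the indicator of \<open>(0,h)\<close>: \<open>flat_exp 0 (n * x)\<close> is
  \<open>exp (- 1 / (n * x))\<close> for \<open>x > 0\<close>.\<close>

definition plateau :: "real \<Rightarrow> nat \<Rightarrow> real \<Rightarrow> real" where
  "plateau h n x = flat_exp 0 (real (Suc n) * x) * flat_exp 0 (real (Suc n) * (h - x))"

lemma flat_algebra_plateau: "flat_algebra (\<lambda>x. plateau h n (x - p))"
proof -
  have "(\<lambda>x. plateau h n (x - p)) = (\<lambda>x. flat_exp 0 (real (Suc n) * x + (- real (Suc n) * p)) *
      flat_exp 0 ((- real (Suc n)) * x + real (Suc n) * (h + p)))"
    by (auto simp: plateau_def algebra_simps simp del: of_nat_Suc)
  then show ?thesis
    by (simp only:) (rule flat_algebra.mult flat_algebra.base)+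
qed

lemma plateau_eq_0: "x \<notin> {0<..<h} \<Longrightarrow> plateau h n x = 0"
  by (auto simp: plateau_def flat_exp_def zero_less_mult_iff simp del: of_nat_Suc)

lemma abs_plateau_le_1: "\<bar>plateau h n x\<bar> \<le> 1"
proof -
  have "0 \<le> flat_exp 0 y \<and> flat_exp 0 y \<le> 1" for y
    by (auto simp: flat_exp_def)
  then have "0 \<le> flat_exp 0 y * flat_exp 0 z \<and> flat_exp 0 y * flat_exp 0 z \<le> 1" for y z
    by (simp add: mult_le_one)
  then show ?thesis
    unfolding plateau_def by (metis abs_of_nonneg)
qed

lemma plateau_tendsto: "(\<lambda>n. plateau h n x) \<longlonglongrightarrow> (if x \<in> {0<..<h} then 1 else 0)"
proof (cases "x \<in> {0<..<h}")
  case True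
  have *: "(\<lambda>n. flat_exp 0 (real (Suc n) * y)) \<longlonglongrightarrow> 1" if "y > 0" for y
  proof -
    have "(\<lambda>n. inverse (real (Suc n))) \<longlonglongrightarrow> 0"
      by (rule LIMSEQ_inverse_real_of_nat)
    then have "(\<lambda>n. exp (- (inverse (real (Suc n)) * (1 / y)))) \<longlonglongrightarrow> exp (- (0 * (1 / y)))"
      by (intro tendsto_intros)
    then show ?thesis
      using that by (simp add: flat_exp_def zero_less_mult_iff field_simps del: of_nat_Suc)
  qed
  have "(\<lambda>n. plateau h n x) \<longlonglongrightarrow> 1 * 1"
    unfolding plateau_def using True by (intro tendsto_mult *) auto
  with True show ?thesis by simp
qed (auto simp: plateau_eq_0)

lemma test_fn_plateau:
  assumes "0 < p" "p + h < L"
  shows "test_fn L (\<lambda>x. plateau h n (x - p))"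
  unfolding test_fn_def
proof (intro conjI allI exI[of _ "{p..p+h}"])
  show "((deriv ^^ k) (\<lambda>x. plateau h n (x - p))) differentiable (at x)" for k x
    by (rule flat_algebra_smooth[OF flat_algebra_plateau])
qed (use assms in \<open>auto intro!: plateau_eq_0\<close>)

text \<open>Two translates of one plateau have the same integral, so the primitive of their
  difference vanishes outside the hull of both supports and is itself a test function.\<close>

lemma test_fn_plateau_primitive:
  assumes "0 < p" "p + h < L" "0 < q" "q + h < L" "0 < h"
  obtains \<psi> where "test_fn L \<psi>" "deriv \<psi> = (\<lambda>x. plateau h n (x - p) - plateau h n (x - q))"
proof -
  have cont: "isCont (plateau h n) x" for x
    using flat_algebra_plateau[of h n 0] flat_algebra_continuous[of "plateau h n" UNIV]
    by (simp add: continuous_on_eq_continuous_at)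
  obtain X where X': "\<And>x. (X has_vector_derivative plateau h n x) (at x)"
    using einterval_antiderivative[of "-\<infinity>" "\<infinity>" "plateau h n"] cont by auto
  then have X: "(X has_real_derivative plateau h n x) (at x)" for x
    by (simp add: has_real_derivative_iff_has_vector_derivative)
  have contX: "continuous_on S X" for S
    using X DERIV_isCont continuous_at_imp_continuous_on by blast
  have left: "X x = X 0" if "x \<le> 0" for x
  proof (cases "x < 0")
    case True
    show ?thesis
    proof (rule DERIV_isconst2[OF True, symmetric])
      show "DERIV X y :> 0" if "x < y" "y < 0" for y
        using X[of y] that plateau_eq_0[of y h n] by simp
    qed (use True contX in auto)
  qed (use that in simp)
  have right: "X x = X h" if "x \<ge> h" for x
  proof (cases "h < x")
    case True
    show ?thesis
    proof (rule DERIV_isconst2[OF True])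
      show "DERIV X y :> 0" if "h < y" "y < x" for y
        using X[of y] that plateau_eq_0[of y h n] by simp
    qed (use True contX in auto)
  qed (use that in simp)
  define \<psi> where "\<psi> = (\<lambda>x. X (x - p) - X (x - q))"
  have shift: "((\<lambda>x. X (x - r)) has_real_derivative plateau h n (x - r)) (at x)" for r x
    by (rule DERIV_cong, rule DERIV_chain2[OF X]) (auto intro!: derivative_eq_intros)
  have D: "(\<psi> has_real_derivative plateau h n (x - p) - plateau h n (x - q)) (at x)" for x
    unfolding \<psi>_def by (intro DERIV_diff shift)
  then have deriv: "deriv \<psi> = (\<lambda>x. plateau h n (x - p) - plateau h n (x - q))"
    by (auto simp: fun_eq_iff intro!: DERIV_imp_deriv)
  have alg: "flat_algebra (\<lambda>x. plateau h n (x - p) - plateau h n (x - q))"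
    using flat_algebra.add[OF flat_algebra_plateau[of h n p]
        flat_algebra.scale[OF flat_algebra_plateau[of h n q], of "-1"]] by simp
  have "test_fn L \<psi>"
    unfolding test_fn_def
  proof (intro conjI allI exI[of _ "{min p q..max p q + h}"])
    show "((deriv ^^ k) \<psi>) differentiable (at x)" for k x
    \<comment> \<open>The primitive itself is not known to lie in \<open>flat_algebra\<close>; only
      its derivative is, so order 0 is treated apart.\<close>
    proof (cases k)
      case 0
      then show ?thesis using D real_differentiable_def by auto
    next
      case (Suc j)
      then show ?thesis
        using flat_algebra_smooth[OF alg, of j x] by (simp add: funpow_swap1 deriv)
    qed
    show "x \<notin> {min p q..max p q + h} \<longrightarrow> \<psi> x = 0" for x
      using left[of "x - p"] left[of "x - q"] right[of "x - p"] right[of "x - q"]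
      by (auto simp: \<psi>_def)
  qed (use assms in auto)
  with deriv show ?thesis using that by blast
qed

section \<open>Recovering a function from its integrals against test functions\<close>

lemma integral_plateau_tendsto:
  fixes f :: "real \<Rightarrow> real"
  assumes f: "f absolutely_integrable_on {0..L}" and p: "0 < p" "0 < h" "p + h < L"
  shows "(\<lambda>n. integral {0..L} (\<lambda>x. f x * plateau h n (x - p))) \<longlonglongrightarrow> integral {p..p+h} f"
    and "(\<lambda>x. f x * plateau h n (x - p)) absolutely_integrable_on {0..L}"
proof -
  have int: "(\<lambda>x. f x * plateau h n (x - p)) absolutely_integrable_on {0..L}" for n
  proof -
    have "(\<lambda>x. plateau h n (x - p) * f x) absolutely_integrable_on {0..L}"
    proof (rule absolutely_integrable_bounded_measurable_product_real)
      show "(\<lambda>x. plateau h n (x - p)) \<in> borel_measurable (lebesgue_on {0..L})"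
        by (intro continuous_imp_measurable_on_sets_lebesgue flat_algebra_continuous
            flat_algebra_plateau) auto
      show "bounded ((\<lambda>x. plateau h n (x - p)) ` {0..L})"
        using abs_plateau_le_1 by (auto simp: bounded_iff)
    qed (use f in auto)
    then show ?thesis by (simp add: mult.commute)
  qed
  then show "(\<lambda>x. f x * plateau h n (x - p)) absolutely_integrable_on {0..L}" .
  have "(\<lambda>n. integral {0..L} (\<lambda>x. f x * plateau h n (x - p))) \<longlonglongrightarrow>
      integral {0..L} (\<lambda>x. f x * (if x - p \<in> {0<..<h} then 1 else 0))"
  proof (rule dominated_convergence(2))
    show "(\<lambda>x. f x * plateau h n (x - p)) integrable_on {0..L}" for n
      using int absolutely_integrable_on_def by blast
    show "(\<lambda>x. norm (f x)) integrable_on {0..L}"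
      using f absolutely_integrable_on_def by blast
    show "norm (f x * plateau h n (x - p)) \<le> norm (f x)" for n x
      using abs_plateau_le_1[of h n "x - p"] by (simp add: abs_mult mult_left_le)
    show "(\<lambda>n. f x * plateau h n (x - p)) \<longlonglongrightarrow> f x * (if x - p \<in> {0<..<h} then 1 else 0)" for x
      by (intro tendsto_intros plateau_tendsto)
  qed
  also have "integral {0..L} (\<lambda>x. f x * (if x - p \<in> {0<..<h} then 1 else 0)) =
      integral {0..L} (\<lambda>x. if x \<in> {p<..<p+h} then f x else 0)"
    by (intro integral_cong) (auto)
  also have "\<dots> = integral {p<..<p+h} f"
    using p by (subst integral_restrict_Int) (auto intro!: arg_cong2[where f = integral])
  also have "\<dots> = integral {p..p+h} f"
    by (simp add: integral_open_interval_real)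
  finally show "(\<lambda>n. integral {0..L} (\<lambda>x. f x * plateau h n (x - p))) \<longlonglongrightarrow> integral {p..p+h} f" .
qed

text \<open>Right-sided averages are the form needed, because the plateaus yield integrals over
  \<open>[p,p+h]\<close>. Extension by 0 reduces the claim to Lebesgue differentiation on the whole
  line.\<close>

lemma Lebesgue_differentiation_Icc:
  fixes f :: "real \<Rightarrow> real"
  assumes f: "f integrable_on {0..L}"
  obtains N where "negligible N"
    "\<And>x. x \<in> {0<..<L} - N \<Longrightarrow> ((\<lambda>h. integral {x..x+h} f / h) \<longlongrightarrow> f x) (at_right 0)"
proof -
  define F where "F = (\<lambda>x. if x \<in> {0..L} then f x else 0)"
  have "F integrable_on UNIV"
    unfolding F_def using f by (rule iffD2[OF integrable_restrict_UNIV])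
  then have "F integrable_on cbox a b" for a b
    using integrable_on_subcbox by blast
  then obtain N where N: "negligible N"
    "\<And>x e. \<lbrakk>x \<notin> N; 0 < e\<rbrakk> \<Longrightarrow> \<exists>d>0. \<forall>h. 0 < h \<and> h < d \<longrightarrow>
        norm (integral (cbox x (x + h *\<^sub>R One)) F /\<^sub>R h ^ DIM(real) - F x) < e"
    using integrable_ccontinuous_explicit[of F] by blast
  show ?thesis
  proof (rule that[OF N(1)])
    fix x assume x: "x \<in> {0<..<L} - N"
    show "((\<lambda>h. integral {x..x+h} f / h) \<longlongrightarrow> f x) (at_right 0)"
    proof (rule tendstoI)
      fix e :: real assume "e > 0"
      with N(2)[of x e] x obtain d where d: "d > 0" "\<And>h. 0 < h \<Longrightarrow> h < d \<Longrightarrow>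
          norm (integral {x..x+h} F / h - F x) < e"
        by (auto simp: field_simps)
      have *: "integral {x..x+h} F = integral {x..x+h} f" if "h < L - x" for h
        using x that by (intro integral_cong) (auto simp: F_def)
      have "dist (integral {x..x+h} f / h) (f x) < e" if "h > 0" "h < min d (L - x)" for h
        using d(2)[of h] that *[of h] x by (simp add: dist_real_def F_def)
      then show "\<forall>\<^sub>F h in at_right 0. dist (integral {x..x+h} f / h) (f x) < e"
        using d(1) x unfolding eventually_at_right_field
        by (intro exI[of _ "min d (L - x)"]) auto
    qed
  qed
qed

text \<open>Testing with plateaus makes the integral of \<open>f\<close> over every interior
  interval 0; Lebesgue differentiation then gives \<open>f = 0\<close> almost everywhere.\<close>

lemma fundamental_lemma_variations:
  fixes f :: "real \<Rightarrow> real"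
  assumes f: "f absolutely_integrable_on {0..L}"
    and orth: "\<And>\<psi>. test_fn L \<psi> \<Longrightarrow> integral {0..L} (\<lambda>x. f x * \<psi> x) = 0"
  obtains N where "negligible N" "\<And>x. x \<in> {0<..<L} - N \<Longrightarrow> f x = 0"
proof -
  obtain N where N: "negligible N"
    "\<And>x. x \<in> {0<..<L} - N \<Longrightarrow> ((\<lambda>h. integral {x..x+h} f / h) \<longlongrightarrow> f x) (at_right 0)"
    using Lebesgue_differentiation_Icc[of f L] f absolutely_integrable_on_def by blast
  have zero: "integral {x..x+h} f = 0" if "0 < x" "0 < h" "x + h < L" for x h
    using integral_plateau_tendsto(1)[OF f that] orth[OF test_fn_plateau, of x h] that
    by (simp add: LIMSEQ_const_iff)
  show ?thesis
  proof (rule that[OF N(1)])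
    fix x assume x: "x \<in> {0<..<L} - N"
    have "\<forall>\<^sub>F h in at_right 0. integral {x..x+h} f / h = 0"
      using x unfolding eventually_at_right_field by (intro exI[of _ "L - x"]) (auto simp: zero)
    with N(2)[OF x] have "((\<lambda>h. 0) \<longlongrightarrow> f x) (at_right (0::real))"
      by (rule Lim_transform_eventually)
    then show "f x = 0"
      using tendsto_const_iff[of "at_right (0::real)" "0::real" "f x"] by simp
  qed
qed

text \<open>Derivatives of test functions include differences of two translated plateaus. Hence
  integrals of \<open>f\<close> over interior intervals of equal length agree, and so do the values
  of \<open>f\<close> at any two points where the right averages converge to it.\<close>

lemma du_Bois_Reymond:
  fixes f :: "real \<Rightarrow> real"
  assumes f: "f absolutely_integrable_on {0..L}" and L: "0 < L"
    and orth: "\<And>\<psi>. test_fn L \<psi> \<Longrightarrow> integral {0..L} (\<lambda>x. f x * deriv \<psi> x) = 0"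
  obtains N k where "negligible N" "\<And>x. x \<in> {0<..<L} - N \<Longrightarrow> f x = k"
proof -
  obtain N where N: "negligible N"
    "\<And>x. x \<in> {0<..<L} - N \<Longrightarrow> ((\<lambda>h. integral {x..x+h} f / h) \<longlongrightarrow> f x) (at_right 0)"
    using Lebesgue_differentiation_Icc[of f L] f absolutely_integrable_on_def by blast
  have eq: "integral {p..p+h} f = integral {q..q+h} f"
    if h: "0 < h" "0 < p" "p + h < L" "0 < q" "q + h < L" for p q h
  proof -
    have "integral {0..L} (\<lambda>x. f x * plateau h n (x - p)) - integral {0..L} (\<lambda>x. f x * plateau h n (x - q)) = 0" for n
    proof -
      obtain \<psi> where \<psi>: "test_fn L \<psi>" "deriv \<psi> = (\<lambda>x. plateau h n (x - p) - plateau h n (x - q))"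
        using test_fn_plateau_primitive[of p h L q n] h by auto
      have "integral {0..L} (\<lambda>x. f x * plateau h n (x - p)) - integral {0..L} (\<lambda>x. f x * plateau h n (x - q)) =
        integral {0..L} (\<lambda>x. f x * plateau h n (x - p) - f x * plateau h n (x - q))"
        using h f by (intro integral_diff[symmetric])
          (auto intro!: set_lebesgue_integral_eq_integral(1) integral_plateau_tendsto(2))
      also have "\<dots> = 0"
        using orth[OF \<psi>(1)] by (simp add: \<psi>(2) right_diff_distrib)
      finally show ?thesis .
    qed
    moreover have "(\<lambda>n. integral {0..L} (\<lambda>x. f x * plateau h n (x - p)) - integral {0..L} (\<lambda>x. f x * plateau h n (x - q)))
       \<longlonglongrightarrow> integral {p..p+h} f - integral {q..q+h} f"
      using h f by (intro tendsto_diff integral_plateau_tendsto(1)) auto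
    ultimately show ?thesis
      by (simp add: LIMSEQ_const_iff)
  qed
  have const: "f p = f q" if p: "p \<in> {0<..<L} - N" and q: "q \<in> {0<..<L} - N" for p q
  proof -
    have "integral {p..p+h} f / h = integral {q..q+h} f / h" if "0 < h" "h < min (L - p) (L - q)" for h
      using p q that eq[of h p q] by simp
    then have "\<forall>\<^sub>F h in at_right 0. integral {p..p+h} f / h = integral {q..q+h} f / h"
      using p q unfolding eventually_at_right_field
      by (intro exI[of _ "min (L - p) (L - q)"]) auto
    with N(2)[OF p] have "((\<lambda>h. integral {q..q+h} f / h) \<longlongrightarrow> f p) (at_right 0)"
      by (rule Lim_transform_eventually)
    with N(2)[OF q] show ?thesis
      using tendsto_unique trivial_limit_at_right_real by blast
  qed
  \<comment> \<open>If \<open>{0<..<L} - N\<close> were empty, the choice would be arbitrary and the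
    claim vacuous.\<close>
  define k where "k = f (SOME x. x \<in> {0<..<L} - N)"
  show ?thesis
    by (rule that[OF N(1), of k]) (metis const k_def someI_ex)
qed

section \<open>Indefinite integrals\<close>

lemma integral_mono_except_negligible:
  fixes f g :: "real \<Rightarrow> real"
  assumes "f integrable_on S" "g integrable_on S" "negligible N"
    and le: "\<And>x. x \<in> S - N \<Longrightarrow> f x \<le> g x"
  shows "integral S f \<le> integral S g"
proof -
  define f' where "f' = (\<lambda>x. if x \<in> N then g x else f x)"
  have "integral S f = integral S f'"
    by (rule integral_spike[OF assms(3)]) (auto simp: f'_def)
  also have "\<dots> \<le> integral S g"
  proof (rule integral_le)
    show "f' integrable_on S"
      by (rule integrable_spike[OF assms(1,3)]) (auto simp: f'_def)
  qed (use assms le in \<open>auto simp: f'_def\<close>)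
  finally show ?thesis .
qed

lemma continuous_imp_borel_measurable_Icc:
  fixes f :: "real \<Rightarrow> real"
  shows "continuous_on {a..b} f \<Longrightarrow> f \<in> borel_measurable (lebesgue_on {a..b})"
  by (intro continuous_imp_measurable_on_sets_lebesgue) auto

lemma absolutely_integrable_continuous_mult:
  fixes f h :: "real \<Rightarrow> real"
  assumes "continuous_on {a..b} f" "h absolutely_integrable_on {a..b}"
  shows "(\<lambda>x. f x * h x) absolutely_integrable_on {a..b}"
  using assms compact_continuous_image[OF assms(1)]
  by (intro absolutely_integrable_bounded_measurable_product_real continuous_imp_borel_measurable_Icc
      compact_imp_bounded) auto

text \<open>Absolute continuity with almost everywhere derivative \<open>h\<close>, phrased through integrals.\<close>

definition primitive_on :: "real \<Rightarrow> real \<Rightarrow> (real \<Rightarrow> real) \<Rightarrow> (real \<Rightarrow> real) \<Rightarrow> bool" where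
  "primitive_on a b u h \<longleftrightarrow> h absolutely_integrable_on {a..b} \<and>
     (\<forall>x y. a \<le> x \<longrightarrow> x \<le> y \<longrightarrow> y \<le> b \<longrightarrow> u y - u x = integral {x..y} h)"

lemma primitive_onD:
  assumes "primitive_on a b u h"
  shows "h absolutely_integrable_on {a..b}" "h integrable_on {a..b}"
    and "a \<le> x \<Longrightarrow> x \<le> y \<Longrightarrow> y \<le> b \<Longrightarrow> u y - u x = integral {x..y} h"
  using assms absolutely_integrable_on_def[where f = h] by (auto simp: primitive_on_def)

lemma primitive_onI:
  assumes h: "h absolutely_integrable_on {a..b}"
    and eq: "\<And>x. x \<in> {a..b} \<Longrightarrow> u x = u a + integral {a..x} h"
  shows "primitive_on a b u h"
  unfolding primitive_on_def
proof (intro conjI allI impI)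
  fix x y assume xy: "a \<le> x" "x \<le> y" "y \<le> b"
  have "h integrable_on {a..y}"
    using h xy by (meson absolutely_integrable_on_def integrable_on_subinterval atLeastatMost_subset_iff order_refl)
  then have "integral {a..x} h + integral {x..y} h = integral {a..y} h"
    using xy by (intro Henstock_Kurzweil_Integration.integral_combine) auto
  then show "u y - u x = integral {x..y} h"
    using eq[of x] eq[of y] xy by simp
qed (rule h)

lemma primitive_on_subset:
  assumes "primitive_on a b u h" "a \<le> c" "d \<le> b"
  shows "primitive_on c d u h"
  using assms absolutely_integrable_on_subinterval[where f = h and S = "{a..b}" and a = c and b = d]
  by (auto simp: primitive_on_def)

lemma primitive_on_continuous:
  assumes "primitive_on a b u h"
  shows "continuous_on {a..b} u"
proof -
  have "continuous_on {a..b} (\<lambda>x. u a + integral {a..x} h)"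
    by (intro continuous_intros indefinite_integral_continuous_1 primitive_onD[OF assms])
  moreover have "u a + integral {a..x} h = u x" if "x \<in> {a..b}" for x
    using primitive_onD(3)[OF assms, of a x] that by auto
  ultimately show ?thesis
    using continuous_on_cong by (metis (no_types, lifting))
qed

lemma primitive_on_diff:
  assumes u: "primitive_on a b u h" and w: "primitive_on a b w k"
  shows "primitive_on a b (\<lambda>x. u x - w x) (\<lambda>x. h x - k x)"
  unfolding primitive_on_def
proof (intro conjI allI impI)
  show "(\<lambda>x. h x - k x) absolutely_integrable_on {a..b}"
    using primitive_onD(1)[OF u] primitive_onD(1)[OF w] by (rule set_integral_diff)
  fix x y assume xy: "a \<le> x" "x \<le> y" "y \<le> b"
  then have "integral {x..y} (\<lambda>x. h x - k x) = integral {x..y} h - integral {x..y} k"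
    by (intro integral_diff integrable_on_subinterval[OF primitive_onD(2)[OF u]]
        integrable_on_subinterval[OF primitive_onD(2)[OF w]]) auto
  then show "u y - w y - (u x - w x) = integral {x..y} (\<lambda>x. h x - k x)"
    using primitive_onD(3)[OF u xy] primitive_onD(3)[OF w xy] by simp
qed

lemma primitive_on_scale:
  assumes u: "primitive_on a b u h"
  shows "primitive_on a b (\<lambda>x. c * u x) (\<lambda>x. c * h x)"
  unfolding primitive_on_def
proof (intro conjI allI impI)
  show "(\<lambda>x. c * h x) absolutely_integrable_on {a..b}"
    using primitive_onD(1)[OF u] by (intro set_integrable_mult_right) auto
  fix x y assume xy: "a \<le> x" "x \<le> y" "y \<le> b"
  then show "c * u y - c * u x = integral {x..y} (\<lambda>x. c * h x)"
    using primitive_onD(3)[OF u xy] by (simp flip: right_diff_distrib)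
qed

lemma primitive_on_add:
  assumes u: "primitive_on a b u h" and w: "primitive_on a b w k"
  shows "primitive_on a b (\<lambda>x. u x + w x) (\<lambda>x. h x + k x)"
  using primitive_on_diff[OF u primitive_on_scale[OF w, of "-1"]] by simp

lemma primitive_on_C1:
  assumes "\<And>x. x \<in> {a..b} \<Longrightarrow> (u has_real_derivative h x) (at x within {a..b})"
    and "continuous_on {a..b} h"
  shows "primitive_on a b u h"
  unfolding primitive_on_def
proof (intro conjI allI impI)
  show "h absolutely_integrable_on {a..b}"
    by (rule absolutely_integrable_continuous_real[OF assms(2)])
  fix x y assume xy: "a \<le> x" "x \<le> y" "y \<le> b"
  have "(h has_integral (u y - u x)) {x..y}"
  proof (rule fundamental_theorem_of_calculus[OF xy(2)])
    fix z assume "z \<in> {x..y}"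
    then have "(u has_real_derivative h z) (at z within {x..y})"
      using xy by (intro DERIV_subset[OF assms(1)]) auto
    then show "(u has_vector_derivative h z) (at z within {x..y})"
      by (simp add: has_real_derivative_iff_has_vector_derivative)
  qed
  then show "u y - u x = integral {x..y} h"
    by (simp add: integral_unique)
qed

lemma primitive_on_cong_negligible:
  assumes u: "primitive_on a b u h" and N: "negligible N" "\<And>x. x \<in> {a..b} - N \<Longrightarrow> k x = h x"
  shows "primitive_on a b u k"
  unfolding primitive_on_def
proof (intro conjI allI impI)
  show "k absolutely_integrable_on {a..b}"
    by (rule absolutely_integrable_spike[OF primitive_onD(1)[OF u] N])
  fix x y assume xy: "a \<le> x" "x \<le> y" "y \<le> b"
  have "integral {x..y} h = integral {x..y} k"
    by (rule integral_spike[OF N(1)]) (use N(2) xy in auto)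
  with primitive_onD(3)[OF u xy] show "u y - u x = integral {x..y} k" by simp
qed

text \<open>The right-hand side need only be nonpositive while \<open>w\<close> is small and positive: at the
  last point where \<open>w \<le> 0\<close>, \<open>w\<close> is continuous and cannot start to increase.\<close>

lemma primitive_on_nonpos:
  assumes w: "primitive_on a b w h" and "w a \<le> 0" "eps > 0" "negligible N"
    and le: "\<And>t. t \<in> {a..b} - N \<Longrightarrow> 0 < w t \<Longrightarrow> w t < eps \<Longrightarrow> h t \<le> 0"
    and x: "x \<in> {a..b}"
  shows "w x \<le> 0"
proof (rule ccontr)
  assume "\<not> w x \<le> 0"
  define Z where "Z = {t \<in> {a..x}. w t \<le> 0}"
  define z where "z = Sup Z"
  have cont: "continuous_on {a..x} w"
    using primitive_on_continuous[OF w] x by (auto intro: continuous_on_subset)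
  have aZ: "a \<in> Z"
    using assms by (auto simp: Z_def)
  have "closed Z"
    using continuous_closed_preimage[OF cont, of "{..0}"] by (simp add: Z_def vimage_def Int_def)
  then have "z \<in> Z"
    unfolding z_def using aZ by (intro closed_contains_Sup) (auto simp: Z_def)
  then have z: "z \<in> {a..x}" "w z \<le> 0" "z < x"
    using \<open>\<not> w x \<le> 0\<close> by (auto simp: Z_def order_le_less)
  have pos: "w t > 0" if "z < t" "t \<le> x" for t
  proof (rule ccontr)
    assume "\<not> w t > 0"
    then have "t \<in> Z" using that z by (auto simp: Z_def)
    then have "t \<le> z" unfolding z_def by (intro cSup_upper) (auto simp: Z_def)
    with that show False by simp
  qed
  obtain d where d: "d > 0" "\<And>t. t \<in> {a..x} \<Longrightarrow> dist t z < d \<Longrightarrow> dist (w t) (w z) < eps"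
    using cont z(1) \<open>eps > 0\<close> unfolding continuous_on_iff by meson
  define y where "y = min x (z + d / 2)"
  have y: "z < y" "y \<le> x"
    using d z by (auto simp: y_def)
  have "w y - w z = integral {z..y} h"
    using primitive_onD(3)[OF w, of z y] y z x by auto
  also have "\<dots> \<le> integral {z..y} (\<lambda>_. 0)"
  proof (rule integral_mono_except_negligible)
    show "h integrable_on {z..y}"
      by (rule integrable_on_subinterval[OF primitive_onD(2)[OF w]]) (use y z x in auto)
    show "negligible (insert z N)" using assms by simp
    show "h t \<le> 0" if "t \<in> {z..y} - insert z N" for t
      using that pos[of t] d(2)[of t] y z x le[of t] by (auto simp: y_def dist_real_def)
  qed auto
  finally show False
    using pos[OF y] z by simp
qed

text \<open>Chain rule for an absolutely continuous inner and a continuously differentiable outer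
  function. The defect on an interval is at most \<open>e\<close> times the integral of
  \<open>\<bar>h\<bar>\<close>; this is shown on small intervals, passed on to large ones by
  bisection, and then \<open>e\<close> is arbitrary.\<close>

lemma primitive_on_compose:
  assumes v: "primitive_on a b v h"
    and range: "\<And>x. x \<in> {a..b} \<Longrightarrow> v x \<in> {m..M}"
    and F: "\<And>s. s \<in> {m..M} \<Longrightarrow> (F has_real_derivative f s) (at s within {m..M})"
    and f: "continuous_on {m..M} f"
  shows "primitive_on a b (\<lambda>x. F (v x)) (\<lambda>x. f (v x) * h x)"
proof -
  have contv: "continuous_on {a..b} v"
    by (rule primitive_on_continuous[OF v])
  have "continuous_on {a..b} (\<lambda>x. f (v x))"
    by (rule continuous_on_compose2[OF f contv]) (use range in auto)
  then have int: "(\<lambda>x. f (v x) * h x) absolutely_integrable_on {a..b}"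
    by (rule absolutely_integrable_continuous_mult[OF _ primitive_onD(1)[OF v]])
  then have int': "(\<lambda>x. f (v x) * h x) integrable_on {a..b}"
    using absolutely_integrable_on_def by blast
  have inth: "(\<lambda>x. \<bar>h x\<bar>) integrable_on {a..b}"
    using primitive_onD(1)[OF v] unfolding absolutely_integrable_on_def by simp
  note sub = integrable_on_subinterval[OF int'] integrable_on_subinterval[OF inth]
    integrable_on_subinterval[OF primitive_onD(2)[OF v]]
  show ?thesis
    unfolding primitive_on_def
  proof (intro conjI allI impI int)
    fix x y assume xy: "a \<le> x" "x \<le> y" "y \<le> b"
    have bound: "\<bar>F (v y) - F (v x) - integral {x..y} (\<lambda>x. f (v x) * h x)\<bar>
        \<le> e * integral {x..y} (\<lambda>x. \<bar>h x\<bar>)" if "e > 0" for e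
    proof -
      \<comment> \<open>Both sides of this estimate add up over adjacent intervals, which is the
        first premise of \<open>Bolzano\<close>; the second is the local estimate around
        \<open>z\<close>.\<close>
      define P where "P = (\<lambda>x y. a \<le> x \<longrightarrow> y \<le> b \<longrightarrow>
          \<bar>F (v y) - F (v x) - integral {x..y} (\<lambda>x. f (v x) * h x)\<bar>
            \<le> e * integral {x..y} (\<lambda>x. \<bar>h x\<bar>))"
      have "P x y"
      proof (induction rule: Bolzano[OF xy(2)])
        case (1 p q r)
        show ?case
          unfolding P_def
        proof (intro impI)
          assume pr: "a \<le> p" "r \<le> b"
          have "integral {p..r} (\<lambda>x. f (v x) * h x) =
              integral {p..q} (\<lambda>x. f (v x) * h x) + integral {q..r} (\<lambda>x. f (v x) * h x)"
            "integral {p..r} (\<lambda>x. \<bar>h x\<bar>) = integral {p..q} (\<lambda>x. \<bar>h x\<bar>) + integral {q..r} (\<lambda>x. \<bar>h x\<bar>)"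
            using 1(3,4) pr
            by (auto intro!: Henstock_Kurzweil_Integration.integral_combine[symmetric] sub)
          moreover have "a \<le> q" "q \<le> b" using 1(3,4) pr by auto
          ultimately show "\<bar>F (v r) - F (v p) - integral {p..r} (\<lambda>x. f (v x) * h x)\<bar>
            \<le> e * integral {p..r} (\<lambda>x. \<bar>h x\<bar>)"
            using 1(1,2) pr by (simp add: P_def distrib_left)
        qed
      next
        case (2 z)
        then have z: "z \<in> {a..b}" using xy by auto
        obtain d1 where d1: "d1 > 0"
          "\<And>s. s \<in> {m..M} \<Longrightarrow> dist s (v z) < d1 \<Longrightarrow> dist (f s) (f (v z)) < e / 2"
          using f range[OF z] half_gt_zero[OF \<open>e > 0\<close>] unfolding continuous_on_iff by blast
        obtain d where d: "d > 0"
          "\<And>t. t \<in> {a..b} \<Longrightarrow> dist t z < d \<Longrightarrow> dist (v t) (v z) < d1"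
          using contv z \<open>d1 > 0\<close> unfolding continuous_on_iff by meson
        show ?case
        proof (intro exI[of _ d] conjI allI impI d(1))
          fix p q assume pq: "p \<le> z \<and> z \<le> q \<and> q - p < d"
          show "P p q"
            unfolding P_def
          proof (intro impI)
            assume ab: "a \<le> p" "q \<le> b"
            have near: "dist (v t) (v z) < d1" "v t \<in> {m..M}" if "t \<in> {p..q}" for t
              using d(2)[of t] range[of t] that pq ab by (auto simp: dist_real_def)
            define T where "T = {m..M} \<inter> ball (v z) d1"
            \<comment> \<open>Half of the error budget: after subtracting the tangent slope at
              \<open>v z\<close>, the derivative of \<open>F\<close> is at most \<open>e / 2\<close>
              on \<open>T\<close>. The other half pays for replacing \<open>f (v t)\<close> by
              \<open>f (v z)\<close> under the integral.\<close>
            have "norm ((F (v q) - f (v z) * v q) - (F (v p) - f (v z) * v p)) \<le> e / 2 * norm (v q - v p)"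
            proof (rule field_differentiable_bound[where S = T])
              show "convex T" by (auto simp: T_def intro!: convex_Int)
              show "((\<lambda>s. F s - f (v z) * s) has_field_derivative f s - f (v z)) (at s within T)" if "s \<in> T" for s
              proof -
                have "(F has_field_derivative f s) (at s within T)"
                  using that by (intro DERIV_subset[OF F]) (auto simp: T_def)
                then show ?thesis
                  by (rule DERIV_diff[OF _ DERIV_cmult_Id])
              qed
              show "norm (f s - f (v z)) \<le> e / 2" if "s \<in> T" for s
                using d1(2)[of s] that by (simp add: T_def dist_real_def abs_minus_commute)
              show "v q \<in> T" "v p \<in> T"
                using near[of p] near[of q] pq by (auto simp: T_def dist_commute)
            qed
            then have A: "\<bar>F (v q) - F (v p) - f (v z) * (v q - v p)\<bar> \<le> e / 2 * \<bar>v q - v p\<bar>"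
              by (simp add: algebra_simps)
            have vpq: "v q - v p = integral {p..q} h"
              using primitive_onD(3)[OF v, of p q] pq ab by auto
            have "\<bar>integral {p..q} h\<bar> \<le> integral {p..q} (\<lambda>x. \<bar>h x\<bar>)"
              using integral_norm_bound_integral[of h "{p..q}" "\<lambda>x. \<bar>h x\<bar>"] pq ab sub(2,3)[of p q] by auto
            then have B: "e / 2 * \<bar>integral {p..q} h\<bar> \<le> e / 2 * integral {p..q} (\<lambda>x. \<bar>h x\<bar>)"
              using \<open>e > 0\<close> by (intro mult_left_mono) auto
            have "\<bar>F (v q) - F (v p) - f (v z) * (v q - v p)\<bar> \<le> e / 2 * integral {p..q} (\<lambda>x. \<bar>h x\<bar>)"
              using A B unfolding vpq by (rule order_trans)
            moreover have "\<bar>integral {p..q} (\<lambda>x. f (v x) * h x) - f (v z) * (v q - v p)\<bar>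
                \<le> e / 2 * integral {p..q} (\<lambda>x. \<bar>h x\<bar>)"
            proof -
              have "integral {p..q} (\<lambda>x. f (v x) * h x) - f (v z) * (v q - v p) =
                 integral {p..q} (\<lambda>x. f (v x) * h x - f (v z) * h x)"
                unfolding vpq using pq ab sub(1,3)[of p q]
                by (subst integral_diff) (auto intro: integrable_on_mult_right)
              also have "\<bar>\<dots>\<bar> \<le> integral {p..q} (\<lambda>x. e / 2 * \<bar>h x\<bar>)"
              proof (rule integral_norm_bound_integral[where 'a = real, unfolded real_norm_def])
                show "(\<lambda>x. f (v x) * h x - f (v z) * h x) integrable_on {p..q}"
                  using pq ab sub(1,3)[of p q]
                  by (intro integrable_diff integrable_on_mult_right) auto
                show "(\<lambda>x. e / 2 * \<bar>h x\<bar>) integrable_on {p..q}"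
                  using pq ab sub(2)[of p q] by (intro integrable_on_mult_right) auto
                show "\<bar>f (v t) * h t - f (v z) * h t\<bar> \<le> e / 2 * \<bar>h t\<bar>" if "t \<in> {p..q}" for t
                proof -
                  have "\<bar>f (v t) - f (v z)\<bar> * \<bar>h t\<bar> \<le> e / 2 * \<bar>h t\<bar>"
                    using d1(2)[OF near(2,1)[OF that]] by (intro mult_right_mono) (auto simp: dist_real_def)
                  then show ?thesis
                    by (simp add: left_diff_distrib flip: abs_mult)
                qed
              qed
              finally show ?thesis by simp
            qed
            ultimately show "\<bar>F (v q) - F (v p) - integral {p..q} (\<lambda>x. f (v x) * h x)\<bar>
              \<le> e * integral {p..q} (\<lambda>x. \<bar>h x\<bar>)"
              by linarith
          qed
        qed
      qed
      then show ?thesis using xy by (simp add: P_def)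
    qed
    show "F (v y) - F (v x) = integral {x..y} (\<lambda>x. f (v x) * h x)"
    proof (rule ccontr)
      define I where "I = integral {x..y} (\<lambda>x. \<bar>h x\<bar>)"
      define D where "D = \<bar>F (v y) - F (v x) - integral {x..y} (\<lambda>x. f (v x) * h x)\<bar>"
      assume "F (v y) - F (v x) \<noteq> integral {x..y} (\<lambda>x. f (v x) * h x)"
      then have "D > 0" by (simp add: D_def)
      have "I \<ge> 0" unfolding I_def by (rule integral_nonneg) (use sub(2) xy in auto)
      \<comment> \<open>With this value of \<open>e\<close> the bound falls strictly below
        \<open>D\<close>; the summand 1 keeps the denominator positive when
        \<open>I = 0\<close>.\<close>
      have "D \<le> D / (2 * (I + 1)) * I"
        using bound[of "D / (2 * (I + 1))"] \<open>D > 0\<close> \<open>I \<ge> 0\<close> by (simp add: D_def I_def)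
      also have "\<dots> < D" using \<open>D > 0\<close> \<open>I \<ge> 0\<close> by (simp add: field_simps add_nonneg_pos)
      finally show False by simp
    qed
  qed
qed

lemma primitive_on_square:
  assumes v: "primitive_on a b v h"
  shows "primitive_on a b (\<lambda>x. (v x)\<^sup>2) (\<lambda>x. 2 * v x * h x)"
proof -
  have "compact (v ` {a..b})"
    by (intro compact_continuous_image primitive_on_continuous[OF v]) simp
  then obtain B where B: "\<And>x. x \<in> {a..b} \<Longrightarrow> \<bar>v x\<bar> \<le> B"
    using compact_imp_bounded by (force simp: bounded_iff)
  then have "v x \<in> {-B..B}" if "x \<in> {a..b}" for x
    using that by (auto simp: abs_le_iff minus_le_iff)
  then show ?thesis
    by (rule primitive_on_compose[OF v, of "-B" B "\<lambda>s. s\<^sup>2" "\<lambda>s. 2 * s"])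
      (auto intro!: derivative_eq_intros continuous_intros)
qed

text \<open>Polarization \<open>u w = ((u + w)^2 - u^2 - w^2) / 2\<close> reduces the product rule
  to the chain rule for the square. The product rule is integration by parts for absolutely
  continuous functions.\<close>

lemma primitive_on_mult:
  assumes u: "primitive_on a b u h" and w: "primitive_on a b w k"
  shows "primitive_on a b (\<lambda>x. u x * w x) (\<lambda>x. h x * w x + u x * k x)"
proof -
  have "primitive_on a b (\<lambda>x. 1/2 * ((u x + w x)\<^sup>2 - ((u x)\<^sup>2 + (w x)\<^sup>2)))
     (\<lambda>x. 1/2 * (2 * (u x + w x) * (h x + k x) - (2 * u x * h x + 2 * w x * k x)))"
    by (intro primitive_on_scale primitive_on_diff primitive_on_add primitive_on_square u w)
  then show ?thesis
    by (simp add: power2_eq_square algebra_simps)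
qed

section \<open>Square-integrable functions\<close>

text \<open>Working form of \<open>L2\<close> on a closed interval with the gauge integral;
  \<open>L2_iff_sq_integrable\<close> identifies the two, the endpoints being negligible.\<close>

definition sq_integrable :: "real \<Rightarrow> real \<Rightarrow> (real \<Rightarrow> real) \<Rightarrow> bool" where
  "sq_integrable a b f \<longleftrightarrow> f \<in> borel_measurable (lebesgue_on {a..b}) \<and> (\<lambda>x. (f x)\<^sup>2) integrable_on {a..b}"

lemma sq_integrable_measurable: "sq_integrable a b f \<Longrightarrow> f \<in> borel_measurable (lebesgue_on {a..b})"
  by (simp add: sq_integrable_def)

lemma sq_integrable_mult:
  assumes "sq_integrable a b f" "sq_integrable a b g"
  shows "(\<lambda>x. f x * g x) absolutely_integrable_on {a..b}"
proof (rule measurable_bounded_by_integrable_imp_absolutely_integrable)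
  show "(\<lambda>x. f x * g x) \<in> borel_measurable (lebesgue_on {a..b})"
    using assms unfolding sq_integrable_def by (intro borel_measurable_times) auto
  show "(\<lambda>x. (f x)\<^sup>2 + (g x)\<^sup>2) integrable_on {a..b}"
    using assms unfolding sq_integrable_def by (intro integrable_add) auto
  show "norm (f x * g x) \<le> (f x)\<^sup>2 + (g x)\<^sup>2" for x
  proof -
    have "2 * (\<bar>f x\<bar> * \<bar>g x\<bar>) \<le> (f x)\<^sup>2 + (g x)\<^sup>2"
      using sum_squares_bound[of "\<bar>f x\<bar>" "\<bar>g x\<bar>"] by simp
    moreover have "0 \<le> \<bar>f x\<bar> * \<bar>g x\<bar>" by simp
    ultimately show ?thesis
      unfolding real_norm_def abs_mult by linarith
  qed
qed simp

lemma sq_integrable_mult_on: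
  "sq_integrable a b f \<Longrightarrow> sq_integrable a b g \<Longrightarrow> (\<lambda>x. f x * g x) integrable_on {a..b}"
  by (intro set_lebesgue_integral_eq_integral(1) sq_integrable_mult)

lemma sq_integrable_bound:
  assumes "f \<in> borel_measurable (lebesgue_on {a..b})" "sq_integrable a b g"
    and "\<And>x. x \<in> {a..b} \<Longrightarrow> \<bar>f x\<bar> \<le> \<bar>g x\<bar>"
  shows "sq_integrable a b f"
  unfolding sq_integrable_def
proof
  have "(\<lambda>x. (f x)\<^sup>2) absolutely_integrable_on {a..b}"
  proof (rule measurable_bounded_by_integrable_imp_absolutely_integrable)
    show "(\<lambda>x. (f x)\<^sup>2) \<in> borel_measurable (lebesgue_on {a..b})"
      by (intro borel_measurable_power assms)
    show "(\<lambda>x. (g x)\<^sup>2) integrable_on {a..b}" using assms by (simp add: sq_integrable_def)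
    show "norm ((f x)\<^sup>2) \<le> (g x)\<^sup>2" if "x \<in> {a..b}" for x
      using assms(3)[OF that] by (simp add: abs_le_square_iff)
  qed simp
  then show "(\<lambda>x. (f x)\<^sup>2) integrable_on {a..b}"
    using absolutely_integrable_on_def by blast
qed (rule assms)

lemma sq_integrable_continuous: "continuous_on {a..b} f \<Longrightarrow> sq_integrable a b f"
  unfolding sq_integrable_def
  by (intro conjI continuous_imp_borel_measurable_Icc integrable_continuous_real continuous_intros)

lemma sq_integrable_const: "sq_integrable a b (\<lambda>_. c)"
  by (intro sq_integrable_continuous continuous_intros)

lemma sq_integrable_abs_integrable:
  "sq_integrable a b f \<Longrightarrow> f absolutely_integrable_on {a..b}"
  using sq_integrable_mult[OF _ sq_integrable_const[where c = 1]] by simp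

lemma sq_integrable_add:
  assumes "sq_integrable a b f" "sq_integrable a b g"
  shows "sq_integrable a b (\<lambda>x. f x + g x)"
  unfolding sq_integrable_def
proof
  show "(\<lambda>x. f x + g x) \<in> borel_measurable (lebesgue_on {a..b})"
    using assms unfolding sq_integrable_def by (intro borel_measurable_add) auto
  have "(\<lambda>x. (f x)\<^sup>2 + (g x)\<^sup>2 + 2 * (f x * g x)) integrable_on {a..b}"
    using assms sq_integrable_mult[OF assms] absolutely_integrable_on_def[where f = "\<lambda>x. f x * g x"]
    unfolding sq_integrable_def by (intro integrable_add) auto
  then show "(\<lambda>x. (f x + g x)\<^sup>2) integrable_on {a..b}"
    by (simp add: power2_sum mult.assoc)
qed

lemma sq_integrable_bounded_mult:
  assumes A: "A \<in> borel_measurable (lebesgue_on {a..b})" "\<And>x. \<bar>A x\<bar> \<le> K" and f: "sq_integrable a b f"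
  shows "sq_integrable a b (\<lambda>x. A x * f x)"
proof (rule sq_integrable_bound)
  show "(\<lambda>x. A x * f x) \<in> borel_measurable (lebesgue_on {a..b})"
    using assms unfolding sq_integrable_def by (intro borel_measurable_times) auto
  show "sq_integrable a b (\<lambda>x. K * f x)"
    using f unfolding sq_integrable_def power_mult_distrib
    by (intro conjI borel_measurable_times integrable_on_mult_right) auto
  have "0 \<le> K" using A(2)[of 0] by linarith
  then show "\<bar>A x * f x\<bar> \<le> \<bar>K * f x\<bar>" for x
    using A(2)[of x] by (simp add: abs_mult mult_right_mono)
qed

lemma sq_integrable_scale: "sq_integrable a b f \<Longrightarrow> sq_integrable a b (\<lambda>x. c * f x)"
  by (rule sq_integrable_bounded_mult[where K = "\<bar>c\<bar>"]) auto

lemma sq_integrable_abs: "sq_integrable a b f \<Longrightarrow> sq_integrable a b (\<lambda>x. \<bar>f x\<bar>)"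
  by (auto simp: sq_integrable_def)

lemma sq_integrable_diff:
  "sq_integrable a b f \<Longrightarrow> sq_integrable a b g \<Longrightarrow> sq_integrable a b (\<lambda>x. f x - g x)"
  using sq_integrable_add[OF _ sq_integrable_scale[of a b g "-1"]] by simp

lemma sq_integrable_subinterval:
  assumes "sq_integrable a b f" "a \<le> c" "d \<le> b"
  shows "sq_integrable c d f"
proof -
  have "f \<in> borel_measurable (lebesgue_on {a..b})"
    using assms by (simp add: sq_integrable_def)
  then have "f \<in> borel_measurable (lebesgue_on {c..d})"
    by (rule measurable_restrict_mono) (use assms in auto)
  then show ?thesis
    using assms integrable_on_subinterval[of "\<lambda>x. (f x)\<^sup>2" "{a..b}" c d]
    by (auto simp: sq_integrable_def)
qed

text \<open>Integrated Young inequality, from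
  \<open>(e * \<bar>f x\<bar> - \<bar>g x\<bar>)^2 / e \<ge> 0\<close>. It stands in for
  Cauchy-Schwarz; the free weight \<open>e\<close> is tuned at each use.\<close>

lemma integral_abs_mult_le:
  assumes "sq_integrable a b f" "sq_integrable a b g" "e > 0"
  shows "\<bar>integral {a..b} (\<lambda>x. f x * g x)\<bar> \<le>
    (e * integral {a..b} (\<lambda>x. (f x)\<^sup>2) + integral {a..b} (\<lambda>x. (g x)\<^sup>2) / e) / 2"
proof -
  have "\<bar>integral {a..b} (\<lambda>x. f x * g x)\<bar> \<le> integral {a..b} (\<lambda>x. (e * (f x)\<^sup>2 + (g x)\<^sup>2 / e) / 2)"
  proof (rule integral_norm_bound_integral[where 'a = real, unfolded real_norm_def])
    show "(\<lambda>x. f x * g x) integrable_on {a..b}"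
      by (rule sq_integrable_mult_on[OF assms(1,2)])
    show "(\<lambda>x. (e * (f x)\<^sup>2 + (g x)\<^sup>2 / e) / 2) integrable_on {a..b}"
      using assms unfolding sq_integrable_def
      by (intro integrable_on_divide integrable_add integrable_on_mult_right) auto
    fix x
    define F G where "F = \<bar>f x\<bar>" and "G = \<bar>g x\<bar>"
    have "0 \<le> (e * F - G)\<^sup>2 / e" using \<open>e > 0\<close> by simp
    also have "(e * F - G)\<^sup>2 / e = e * F\<^sup>2 + G\<^sup>2 / e - 2 * (F * G)"
      using \<open>e > 0\<close> by (simp add: power2_eq_square field_simps)
    finally show "\<bar>f x * g x\<bar> \<le> (e * (f x)\<^sup>2 + (g x)\<^sup>2 / e) / 2"
      by (simp add: abs_mult F_def G_def)
  qed
  also have "\<dots> = integral {a..b} (\<lambda>x. e * (f x)\<^sup>2 + (g x)\<^sup>2 / e) / 2"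
    by (rule integral_divide)
  also have "integral {a..b} (\<lambda>x. e * (f x)\<^sup>2 + (g x)\<^sup>2 / e) =
      integral {a..b} (\<lambda>x. e * (f x)\<^sup>2) + integral {a..b} (\<lambda>x. (g x)\<^sup>2 / e)"
    using assms unfolding sq_integrable_def
    by (intro integral_add integrable_on_mult_right integrable_on_divide) auto
  finally show ?thesis by simp
qed

section \<open>The singular initial value problem\<close>

text \<open>Apply \<open>primitive_on_nonpos\<close> to \<open>kap * t - u t\<close>. Its
  restriction to small positive values becomes \<open>- \<delta> < u t\<close>, so the slope has to
  be controlled only while \<open>u\<close> is slightly negative or below the line. This matters for
  weak solutions, whose sign is not yet known and where \<open>\<phi>\<close> is large only near
  0.\<close>

lemma linear_lower_bound:
  assumes u: "primitive_on 0 X u h" and "0 \<le> u 0" "0 < \<delta>" "negligible N"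
    and le: "\<And>t. t \<in> {0..X} - N \<Longrightarrow> - \<delta> < u t \<Longrightarrow> u t < kap * t \<Longrightarrow> kap \<le> h t"
    and "0 \<le> kap" and x: "x \<in> {0..X}"
  shows "kap * x \<le> u x"
proof -
  have "primitive_on 0 X (\<lambda>t. kap * t - u t) (\<lambda>t. kap - h t)"
    by (rule primitive_on_diff[OF primitive_on_C1 u])
      (auto intro!: derivative_eq_intros continuous_intros)
  then have "kap * x - u x \<le> 0"
  proof (rule primitive_on_nonpos[OF _ _ \<open>0 < \<delta>\<close> \<open>negligible N\<close> _ x])
    show "kap - h t \<le> 0" if "t \<in> {0..X} - N" "0 < kap * t - u t" "kap * t - u t < \<delta>" for t
    proof -
      have "0 \<le> kap * t" using that assms by auto
      then show ?thesis using le[of t] that by auto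
    qed
  qed (use assms in auto)
  then show ?thesis by simp
qed

text \<open>\<open>A\<close> stands for \<open>1/a\<close>, and \<open>p\<close> for \<open>\<phi>\<close> on \<open>(0,\<infinity>)\<close>. The values of \<open>p\<close> elsewhere are
  irrelevant; fixing them to the lower bound \<open>m\<close> makes \<open>p\<close> Borel measurable and bounded below.\<close>

locale singular_problem =
  fixes L \<alpha> \<beta> m :: real and A g p :: "real \<Rightarrow> real"
  assumes L_pos: "0 < L" and \<alpha>_pos: "0 < \<alpha>" and \<alpha>_less_\<beta>: "\<alpha> < \<beta>"
    and A_meas: "A \<in> borel_measurable lebesgue"
    and A_lower: "1 / \<beta> \<le> A x" and A_upper: "A x \<le> 1 / \<alpha>"
    and g_sq: "sq_integrable 0 L g"
    and p_cont: "continuous_on {0<..} p"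
    and p_antimono: "0 < s \<Longrightarrow> s \<le> t \<Longrightarrow> p t \<le> p s"
    and p_lower: "m \<le> p s"
    and p_nonpos: "s \<le> 0 \<Longrightarrow> p s = m"
    and p_unbounded: "\<exists>s>0. K \<le> p s"
    and p_int: "p absolutely_integrable_on {0..1/2}"
    and g_lower: "0 < \<eta> \<Longrightarrow> \<eta> < L \<Longrightarrow> \<exists>M N. negligible N \<and> (\<forall>x\<in>{0..L-\<eta>} - N. - M \<le> g x)"
begin

lemma \<beta>_pos: "0 < \<beta>"
  using \<alpha>_pos \<alpha>_less_\<beta> by simp

lemma A_pos: "0 < A x"
  using \<beta>_pos by (intro order_less_le_trans[OF _ A_lower]) simp

lemma A_meas_on: "A \<in> borel_measurable (lebesgue_on {a..b})"
  using A_meas by (rule measurable_restrict_space1)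

lemma abs_A_le: "\<bar>A x\<bar> \<le> 1 / \<alpha>"
  using A_pos[of x] A_upper[of x] by simp

lemma mult_A_le: "0 \<le> y \<Longrightarrow> y * A x \<le> y / \<alpha>"
  using mult_left_mono[OF A_upper, of y x] by simp

lemma le_mult_A: "0 \<le> y \<Longrightarrow> y / \<beta> \<le> y * A x"
  using mult_left_mono[OF A_lower, of y x] by simp

definition slope :: "real \<Rightarrow> (real \<Rightarrow> real) \<Rightarrow> real \<Rightarrow> real" where
  "slope c u t = (p (u t) + g t + c) * A t"

definition sol :: "real \<Rightarrow> (real \<Rightarrow> real) \<Rightarrow> bool" where
  "sol c u \<longleftrightarrow> (\<forall>x\<in>{0<..<L}. 0 < u x) \<and> u 0 = 0 \<and> u L = 0 \<and>
     sq_integrable 0 L (\<lambda>x. p (u x)) \<and> primitive_on 0 L u (slope c u)"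

lemma solD:
  assumes "sol c u"
  shows "0 < x \<Longrightarrow> x < L \<Longrightarrow> 0 < u x" "u 0 = 0" "u L = 0"
    "sq_integrable 0 L (\<lambda>x. p (u x))" "primitive_on 0 L u (slope c u)"
    "continuous_on {0..L} u"
  using assms primitive_on_continuous by (auto simp: sol_def)

lemma sol_nonneg: "sol c u \<Longrightarrow> x \<in> {0..L} \<Longrightarrow> 0 \<le> u x"
  using solD(1)[of c u x] solD(2,3)[of c u] by (cases "x = 0 \<or> x = L") auto

lemma sq_integrable_slope:
  assumes "sq_integrable 0 L (\<lambda>x. p (u x))"
  shows "sq_integrable 0 L (slope c u)"
proof -
  have "sq_integrable 0 L (\<lambda>x. A x * (p (u x) + g x + c))"
    by (intro sq_integrable_bounded_mult[OF A_meas_on abs_A_le] sq_integrable_add g_sq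
        sq_integrable_const assms)
  then show ?thesis
    by (simp add: slope_def[abs_def] mult.commute)
qed

section \<open>Comparison of solutions: uniqueness and dependence on the parameter\<close>

lemma negligible_endpoints: "negligible {0, L}"
  by (simp add: negligible_finite)

text \<open>Where \<open>u1 > u2 > 0\<close>, antimonotonicity gives
  \<open>p (u1 t) \<le> p (u2 t)\<close>, so the difference cannot grow. The endpoints are set aside
  as a null set because \<open>p\<close> at 0 is a mere default.\<close>

lemma sol_mono:
  assumes u1: "sol c1 u1" and u2: "sol c2 u2" and c: "c1 \<le> c2" and x: "x \<in> {0..L}"
  shows "u1 x \<le> u2 x"
proof -
  have "u1 x - u2 x \<le> 0"
  proof (rule primitive_on_nonpos[OF primitive_on_diff[OF solD(5)[OF u1] solD(5)[OF u2]] _ zero_less_one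
        negligible_endpoints _ x])
    fix t assume t: "t \<in> {0..L} - {0, L}" "0 < u1 t - u2 t"
    then have "p (u1 t) \<le> p (u2 t)"
      using solD(1)[OF u2, of t] by (intro p_antimono) auto
    then have "p (u1 t) + g t + c1 \<le> p (u2 t) + g t + c2" using c by simp
    then show "slope c1 u1 t - slope c2 u2 t \<le> 0"
      using A_pos[of t] by (simp add: slope_def mult_right_mono)
  qed (use solD[OF u1] solD[OF u2] in auto)
  then show ?thesis by simp
qed

lemma sol_unique: "sol c u1 \<Longrightarrow> sol c u2 \<Longrightarrow> x \<in> {0..L} \<Longrightarrow> u1 x = u2 x"
  using sol_mono[of c u1 c u2 x] sol_mono[of c u2 c u1 x] by simp

text \<open>The barrier is linear with slope \<open>(c2 - c1) / \<alpha>\<close>, the most that the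
  change of parameter can add to the derivative; above it, \<open>p\<close> acts downwards as in
  \<open>sol_mono\<close>.\<close>

lemma sol_Lipschitz:
  assumes u1: "sol c1 u1" and u2: "sol c2 u2" and c: "c1 \<le> c2" and x: "x \<in> {0..L}"
  shows "u2 x - u1 x \<le> (c2 - c1) / \<alpha> * x"
proof -
  have lin: "primitive_on 0 L (\<lambda>t. (c2 - c1) / \<alpha> * t) (\<lambda>_. (c2 - c1) / \<alpha>)"
    using \<alpha>_pos by (intro primitive_on_C1) (auto intro!: derivative_eq_intros)
  have "u2 x - u1 x - (c2 - c1) / \<alpha> * x \<le> 0"
  proof (rule primitive_on_nonpos[OF primitive_on_diff[OF primitive_on_diff[OF solD(5)[OF u2] solD(5)[OF u1]] lin] _ zero_less_one
        negligible_endpoints _ x])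
    fix t assume t: "t \<in> {0..L} - {0, L}" "0 < u2 t - u1 t - (c2 - c1) / \<alpha> * t"
    have "0 \<le> (c2 - c1) / \<alpha> * t"
      using t c \<alpha>_pos by simp
    then have "p (u2 t) \<le> p (u1 t)"
      using solD(1)[OF u1, of t] t by (intro p_antimono) auto
    then have "(p (u2 t) - p (u1 t) + (c2 - c1)) * A t \<le> (c2 - c1) * A t"
      using A_pos[of t] by (intro mult_right_mono) auto
    also have "\<dots> \<le> (c2 - c1) / \<alpha>"
      using c by (intro mult_A_le) simp
    finally show "slope c2 u2 t - slope c1 u1 t - (c2 - c1) / \<alpha> \<le> 0"
      by (simp add: slope_def algebra_simps)
  qed (use solD[OF u1] solD[OF u2] in auto)
  then show ?thesis by simp
qed

text \<open>If the solutions touched at \<open>x\<close>, then \<open>p (u2 t) - p (u1 t)\<close>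
  would be small near \<open>x\<close>, so \<open>u2 - u1\<close> would increase at rate at least
  \<open>(c2 - c1) / (2 \<beta>)\<close> up to the value 0 at \<open>x\<close>. It would be negative
  just before, against \<open>sol_mono\<close>.\<close>

lemma sol_strict_mono:
  assumes u1: "sol c1 u1" and u2: "sol c2 u2" and c: "c1 < c2" and x: "x \<in> {0<..<L}"
  shows "u1 x < u2 x"
proof (rule ccontr)
  assume "\<not> u1 x < u2 x"
  with sol_mono[OF u1 u2, of x] c x have eq: "u1 x = u2 x" by simp
  define D where "D = (\<lambda>t. p (u2 t) - p (u1 t))"
  have "continuous_on {0<..<L} D"
    unfolding D_def
    by (intro continuous_intros continuous_on_compose2[OF p_cont]
        continuous_on_subset[OF solD(6)[OF u1]] continuous_on_subset[OF solD(6)[OF u2]])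
      (auto intro: solD(1)[OF u1] solD(1)[OF u2])
  then obtain d where d: "d > 0" "\<And>t. t \<in> {0<..<L} \<Longrightarrow> dist t x < d \<Longrightarrow> dist (D t) (D x) < (c2 - c1) / 2"
    using x c unfolding continuous_on_iff by (metis diff_gt_0_iff_gt half_gt_zero)
  \<comment> \<open>The maximum with \<open>x / 2\<close> keeps \<open>[y,x]\<close> inside
    \<open>(0,L)\<close>, where \<open>D\<close> is continuous; the other term keeps it within
    distance \<open>d\<close> of \<open>x\<close>.\<close>
  define y where "y = max (x / 2) (x - d / 2)"
  have y: "0 < y" "y < x" using x d(1) by (auto simp: y_def)
  have prim: "primitive_on 0 L (\<lambda>t. u2 t - u1 t) (\<lambda>t. slope c2 u2 t - slope c1 u1 t)"
    by (rule primitive_on_diff[OF solD(5)[OF u2] solD(5)[OF u1]])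
  have "(x - y) * ((c2 - c1) / 2 / \<beta>) = integral {y..x} (\<lambda>_. (c2 - c1) / 2 / \<beta>)"
    using y by simp
  also have "\<dots> \<le> integral {y..x} (\<lambda>t. slope c2 u2 t - slope c1 u1 t)"
  proof (rule integral_le)
    show "(\<lambda>t. slope c2 u2 t - slope c1 u1 t) integrable_on {y..x}"
      by (rule integrable_on_subinterval[OF primitive_onD(2)[OF prim]]) (use x y in auto)
    fix t assume t: "t \<in> {y..x}"
    have "dist (D t) 0 < (c2 - c1) / 2"
      using d(2)[of t] t x y eq d(1) by (simp add: D_def dist_real_def y_def)
    then have D: "(c2 - c1) / 2 \<le> D t + (c2 - c1)"
      by (simp add: dist_real_def abs_if split: if_splits)
    have "(c2 - c1) / 2 / \<beta> \<le> (c2 - c1) / 2 * A t"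
      using c by (intro le_mult_A) simp
    also have "\<dots> \<le> (D t + (c2 - c1)) * A t"
      using A_pos[of t] D by (intro mult_right_mono) auto
    also have "\<dots> = slope c2 u2 t - slope c1 u1 t"
      by (simp add: slope_def D_def algebra_simps)
    finally show "(c2 - c1) / 2 / \<beta> \<le> slope c2 u2 t - slope c1 u1 t" .
  qed auto
  also have "\<dots> = u2 x - u1 x - (u2 y - u1 y)"
    using primitive_onD(3)[OF prim, of y x] x y by simp
  finally have "(x - y) * ((c2 - c1) / 2 / \<beta>) \<le> u1 y - u2 y" using eq by simp
  moreover have "u1 y \<le> u2 y"
    using sol_mono[OF u1 u2, of y] c x y by simp
  moreover have "0 < (x - y) * ((c2 - c1) / 2 / \<beta>)"
    using y c \<beta>_pos by simp
  ultimately show False by linarith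
qed

section \<open>Energy identities\<close>

definition potential :: "real \<Rightarrow> real" where
  "potential s = integral {0..s} p"

lemma p_absolutely_integrable: "p absolutely_integrable_on {0..M}"
proof (cases "M \<le> 1/2")
  case True
  then show ?thesis
    using absolutely_integrable_on_subinterval[OF p_int] by auto
next
  case False
  have "p absolutely_integrable_on {1/2..M}"
    by (intro absolutely_integrable_continuous_real continuous_on_subset[OF p_cont]) auto
  with p_int show ?thesis
    by (rule absolutely_integrable_on_combine) (use False in auto)
qed

lemma p_integrable: "p integrable_on {0..M}"
  using p_absolutely_integrable absolutely_integrable_on_def by blast

lemma continuous_on_potential: "continuous_on {0..M} potential"
  unfolding potential_def by (rule indefinite_integral_continuous_1[OF p_integrable])

text \<open>Restricted to \<open>[m0,M]\<close> with \<open>m0 > 0\<close> because \<open>p\<close>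
  need not be continuous at 0.\<close>

lemma potential_derivative:
  assumes "0 < m0" "s \<in> {m0..M}"
  shows "(potential has_real_derivative p s) (at s within {m0..M})"
proof -
  have "((\<lambda>x. integral {0..m0} p + integral {m0..x} p) has_real_derivative 0 + p s) (at s within {m0..M})"
    using assms
    by (intro DERIV_add DERIV_const integral_has_real_derivative continuous_on_subset[OF p_cont]) auto
  then have "((\<lambda>x. integral {0..m0} p + integral {m0..x} p) has_real_derivative p s) (at s within {m0..M})"
    by simp
  then show ?thesis
  proof (rule has_field_derivative_transform_within[OF _ zero_less_one assms(2)])
    show "integral {0..m0} p + integral {m0..x} p = potential x" if "x \<in> {m0..M}" for x
      unfolding potential_def using that assms
      by (intro Henstock_Kurzweil_Integration.integral_combine p_integrable) auto
  qed
qed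

lemma energy_interval:
  assumes u: "primitive_on x y u h" and pos: "\<And>t. t \<in> {x..y} \<Longrightarrow> 0 < u t" and xy: "x \<le> y"
  shows "integral {x..y} (\<lambda>t. p (u t) * h t) = potential (u y) - potential (u x)"
    and "(\<lambda>t. p (u t) * h t) integrable_on {x..y}"
proof -
  have cpt: "compact (u ` {x..y})"
    by (intro compact_continuous_image primitive_on_continuous[OF u]) simp
  have ne: "u ` {x..y} \<noteq> {}" using xy by auto
  obtain m0 where m0: "m0 \<in> u ` {x..y}" "\<And>t. t \<in> {x..y} \<Longrightarrow> m0 \<le> u t"
    using compact_attains_inf[OF cpt ne] by blast
  obtain M0 where M0: "\<And>t. t \<in> {x..y} \<Longrightarrow> u t \<le> M0"
    using compact_attains_sup[OF cpt ne] by blast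
  have "0 < m0" using m0(1) pos by auto
  have "primitive_on x y (\<lambda>t. potential (u t)) (\<lambda>t. p (u t) * h t)"
    by (rule primitive_on_compose[OF u, of m0 M0])
      (use m0 M0 \<open>0 < m0\<close> in \<open>auto intro!: potential_derivative continuous_on_subset[OF p_cont]\<close>)
  then show "integral {x..y} (\<lambda>t. p (u t) * h t) = potential (u y) - potential (u x)"
    "(\<lambda>t. p (u t) * h t) integrable_on {x..y}"
    using primitive_onD(2) primitive_onD(3)[of x y "\<lambda>t. potential (u t)" _ x y] xy by auto
qed

text \<open>The chain rule for \<open>potential (u x)\<close> holds only where \<open>u > 0\<close>.
  It makes \<open>F x - potential (u x)\<close> constant on \<open>(0,L)\<close>; both terms are
  continuous on \<open>[0,L]\<close>, so the constant extends to the endpoints, where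
  \<open>u\<close> has the same value.\<close>

lemma sol_energy_p:
  assumes u: "sol c u"
  shows "integral {0..L} (\<lambda>t. p (u t) * slope c u t) = 0"
proof -
  define F where "F = (\<lambda>x. integral {0..x} (\<lambda>t. p (u t) * slope c u t))"
  have int: "(\<lambda>t. p (u t) * slope c u t) integrable_on {0..L}"
    by (rule sq_integrable_mult_on[OF solD(4)[OF u] sq_integrable_slope[OF solD(4)[OF u]]])
  obtain M where M: "\<And>x. x \<in> {0..L} \<Longrightarrow> u x \<le> M"
    using compact_attains_sup[OF compact_continuous_image[OF solD(6)[OF u] compact_Icc]] L_pos
    by (metis atLeastAtMost_iff image_eqI image_is_empty atLeastatMost_empty_iff less_imp_le order.asym)
  have contF: "continuous_on {0..L} F"
    unfolding F_def by (rule indefinite_integral_continuous_1[OF int])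
  have contE: "continuous_on {0..L} (\<lambda>x. potential (u x))"
    by (rule continuous_on_compose2[OF continuous_on_potential[of M] solD(6)[OF u]])
      (use M sol_nonneg[OF u] in auto)
  have const: "F y - potential (u y) = F x - potential (u x)" if "0 < x" "x \<le> y" "y < L" for x y
  proof -
    have "F x + integral {x..y} (\<lambda>t. p (u t) * slope c u t) = F y"
      unfolding F_def using that
      by (intro Henstock_Kurzweil_Integration.integral_combine integrable_on_subinterval[OF int]) auto
    moreover have "integral {x..y} (\<lambda>t. p (u t) * slope c u t) = potential (u y) - potential (u x)"
      by (rule energy_interval(1)[OF primitive_on_subset[OF solD(5)[OF u]]])
        (use that in \<open>auto intro: solD(1)[OF u]\<close>)
    ultimately show ?thesis by simp
  qed
  define k where "k = F (L/2) - potential (u (L/2))"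
  have k: "F x - potential (u x) = k" if "x \<in> {0<..<L}" for x
    using const[of x "L/2"] const[of "L/2" x] that L_pos by (cases "x \<le> L/2") (auto simp: k_def)
  have "F x - potential (u x) = k" if "x \<in> {0..L}" for x
  proof (rule continuous_constant_on_closure[where S = "{0<..<L}" and f = "\<lambda>x. F x - potential (u x)"])
    show "continuous_on (closure {0<..<L}) (\<lambda>x. F x - potential (u x))"
      using L_pos by (simp add: continuous_on_diff contF contE)
    show "x \<in> closure {0<..<L}" using that L_pos by simp
  qed (rule k)
  from this[of 0] this[of L] show ?thesis
    using L_pos solD(2,3)[OF u] by (simp add: F_def)
qed

definition energy_bound :: real where
  "energy_bound = integral {0..L} (\<lambda>x. (g x)\<^sup>2) / \<alpha>\<^sup>2"

lemma energy_bound_nonneg: "0 \<le> energy_bound"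
  using g_sq \<alpha>_pos unfolding energy_bound_def sq_integrable_def
  by (intro divide_nonneg_pos integral_nonneg) auto

lemma sol_energy_bound:
  assumes u: "sol c u"
  shows "integral {0..L} (\<lambda>t. (slope c u t)\<^sup>2) \<le> energy_bound"
proof -
  define h where "h = slope c u"
  have sq: "sq_integrable 0 L h"
    unfolding h_def by (rule sq_integrable_slope[OF solD(4)[OF u]])
  have int: "(\<lambda>t. p (u t) * h t) integrable_on {0..L}" "(\<lambda>t. h t * g t) integrable_on {0..L}"
      "(\<lambda>t. c * h t) integrable_on {0..L}" "(\<lambda>t. (h t)\<^sup>2) integrable_on {0..L}"
    using sq_integrable_mult[OF solD(4)[OF u] sq] sq_integrable_mult[OF sq g_sq]
      sq_integrable_mult[OF sq_integrable_const[of _ _ c] sq] sq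
    by (auto intro: set_lebesgue_integral_eq_integral(1) simp: sq_integrable_def)
  have "\<alpha> * integral {0..L} (\<lambda>t. (h t)\<^sup>2) = integral {0..L} (\<lambda>t. \<alpha> * (h t)\<^sup>2)"
    by simp
  also have "\<dots> \<le> integral {0..L} (\<lambda>t. p (u t) * h t + h t * g t + c * h t)"
  proof (rule integral_le)
    show "(\<lambda>t. \<alpha> * (h t)\<^sup>2) integrable_on {0..L}"
      by (intro integrable_on_mult_right int)
    show "(\<lambda>t. p (u t) * h t + h t * g t + c * h t) integrable_on {0..L}"
      by (intro integrable_add int)
    fix t assume "t \<in> {0..L}"
    have A: "\<alpha> * A t \<le> 1" using A_upper[of t] \<alpha>_pos by (simp add: field_simps)
    define q where "q = p (u t) + g t + c"
    \<comment> \<open>As \<open>h = A q\<close>, the product \<open>h q\<close> equals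
      \<open>A q^2\<close>, and \<open>\<alpha> * A t \<le> 1\<close> compares it with
      \<open>\<alpha> * h^2\<close>.\<close>
    have "\<alpha> * (h t)\<^sup>2 = (\<alpha> * A t) * (A t * q\<^sup>2)"
      by (simp add: h_def slope_def q_def power2_eq_square)
    also have "\<dots> \<le> 1 * (A t * q\<^sup>2)"
      using A A_pos[of t] by (intro mult_right_mono) auto
    also have "\<dots> = p (u t) * h t + h t * g t + c * h t"
      by (simp add: h_def slope_def q_def power2_eq_square algebra_simps)
    finally show "\<alpha> * (h t)\<^sup>2 \<le> p (u t) * h t + h t * g t + c * h t" .
  qed
  also have "\<dots> = integral {0..L} (\<lambda>t. p (u t) * h t) + integral {0..L} (\<lambda>t. h t * g t)
      + integral {0..L} (\<lambda>t. c * h t)"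
    using int by (simp add: integral_add integrable_add)
  also have "integral {0..L} (\<lambda>t. p (u t) * h t) = 0"
    unfolding h_def by (rule sol_energy_p[OF u])
  also have "integral {0..L} (\<lambda>t. c * h t) = 0"
    using primitive_onD(3)[OF solD(5)[OF u], of 0 L] L_pos solD(2,3)[OF u] by (simp add: h_def)
  \<comment> \<open>Young with weight \<open>\<alpha>\<close>: half of the left-hand side absorbs
    the term in \<open>h\<close>, which leaves the factor \<open>1 / \<alpha>^2\<close> of
    \<open>energy_bound\<close>.\<close>
  also have "0 + integral {0..L} (\<lambda>t. h t * g t) + 0 \<le>
      (\<alpha> * integral {0..L} (\<lambda>t. (h t)\<^sup>2) + integral {0..L} (\<lambda>t. (g t)\<^sup>2) / \<alpha>) / 2"
    using integral_abs_mult_le[OF sq g_sq \<alpha>_pos] by simp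
  finally have "\<alpha> * integral {0..L} (\<lambda>t. (h t)\<^sup>2) \<le> integral {0..L} (\<lambda>t. (g t)\<^sup>2) / \<alpha>"
    by (simp add: field_simps)
  then show ?thesis
    using \<alpha>_pos by (simp add: energy_bound_def h_def field_simps power2_eq_square)
qed

text \<open>Young applied to the product of the slope with 1 on \<open>[x,y]\<close>: a modulus of
  continuity that does not involve \<open>c\<close>.\<close>

lemma sol_increment_ge:
  assumes u: "sol c u" and xy: "0 \<le> x" "x \<le> y" "y \<le> L" and e: "e > 0"
  shows "- (e * energy_bound + (y - x) / e) / 2 \<le> u y - u x"
proof -
  have sq: "sq_integrable 0 L (slope c u)"
    by (rule sq_integrable_slope[OF solD(4)[OF u]])
  have sq': "sq_integrable x y (slope c u)"
    by (rule sq_integrable_subinterval[OF sq]) (use xy in auto)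
  have "u y - u x = integral {x..y} (\<lambda>t. slope c u t * 1)"
    using primitive_onD(3)[OF solD(5)[OF u]] xy by simp
  moreover have "\<bar>integral {x..y} (\<lambda>t. slope c u t * 1)\<bar> \<le>
     (e * integral {x..y} (\<lambda>t. (slope c u t)\<^sup>2) + integral {x..y} (\<lambda>t. 1\<^sup>2) / e) / 2"
    by (rule integral_abs_mult_le[OF sq' sq_integrable_const e])
  moreover have "integral {x..y} (\<lambda>t. (slope c u t)\<^sup>2) \<le> integral {0..L} (\<lambda>t. (slope c u t)\<^sup>2)"
    using sq sq' xy unfolding sq_integrable_def by (intro integral_subset_le) auto
  then have "e * integral {x..y} (\<lambda>t. (slope c u t)\<^sup>2) \<le> e * energy_bound"
    using sol_energy_bound[OF u] e by (intro mult_left_mono) auto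
  ultimately show ?thesis
    using xy by simp
qed

text \<open>If \<open>u x \<ge> eps\<close>, the energy bound keeps \<open>u \<ge> eps/2\<close> on an interval to the right of \<open>x\<close> whose length
  does not depend on \<open>c\<close>; there \<open>p (u)\<close> is bounded, so for very negative \<open>c\<close> the
  solution would decrease by more than the energy bound permits.\<close>

lemma sol_uniformly_small:
  assumes "eps > 0"
  shows "\<exists>C. \<forall>c u. c \<le> C \<longrightarrow> sol c u \<longrightarrow> (\<forall>x\<in>{0..L}. u x < eps)"
proof -
  \<comment> \<open>These values make both \<open>e * energy_bound\<close> and \<open>r / e\<close>
    at most \<open>eps / 2\<close>, so \<open>u\<close> loses at most \<open>eps / 2\<close> within
    distance \<open>r\<close>. The summand 1 in \<open>E\<close> only guarantees positivity.\<close>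
  define E where "E = energy_bound + 1"
  define e where "e = eps / (2 * E)"
  define r where "r = e * (eps / 2)"
  have "E > 0" "e > 0" using energy_bound_nonneg \<open>eps > 0\<close> by (auto simp: E_def e_def)
  then have "r > 0" using \<open>eps > 0\<close> by (simp add: r_def)
  have small: "e * energy_bound \<le> eps / 2"
  proof -
    have "e * energy_bound \<le> e * E"
      using \<open>e > 0\<close> by (intro mult_left_mono) (auto simp: E_def)
    then show ?thesis using \<open>E > 0\<close> by (simp add: e_def)
  qed
  define G where "G = (\<bar>p (eps/2)\<bar> * L + integral {0..L} (\<lambda>t. \<bar>g t\<bar>)) / \<alpha>"
  \<comment> \<open>Chosen so that \<open>G + C / \<beta> * r = - eps\<close>: over a length
    \<open>r\<close> the solution would fall by \<open>eps\<close>, while the energy bound permits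
    only \<open>eps / 2\<close>.\<close>
  define C where "C = - \<beta> / r * (G + eps)"
  have gint: "(\<lambda>t. \<bar>g t\<bar>) integrable_on {0..L}"
    using sq_integrable_abs_integrable[OF g_sq] unfolding absolutely_integrable_on_def by simp
  have "G \<ge> 0"
    unfolding G_def using L_pos \<alpha>_pos gint by (intro divide_nonneg_pos add_nonneg_nonneg integral_nonneg) auto
  have "C < 0"
  proof -
    have "0 < \<beta> / r * (G + eps)"
      using \<open>G \<ge> 0\<close> \<open>eps > 0\<close> \<open>r > 0\<close> \<beta>_pos by (intro mult_pos_pos divide_pos_pos) auto
    then show ?thesis by (simp add: C_def)
  qed
  have "u x < eps" if c: "c \<le> C" and u: "sol c u" and x: "x \<in> {0..L}" for c u x
  proof (rule ccontr)
    assume "\<not> u x < eps"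
    have "0 \<le> x" using x by simp
    have low: "u x - eps / 2 \<le> u y" if "x \<le> y" "y \<le> L" "y \<le> x + r" for y
    proof -
      have "(y - x) / e \<le> r / e" using that \<open>e > 0\<close> by (intro divide_right_mono) auto
      also have "\<dots> = eps / 2" using \<open>e > 0\<close> by (simp add: r_def)
      finally have "(y - x) / e \<le> eps / 2" .
      with small have "e * energy_bound + (y - x) / e \<le> eps / 2 + eps / 2"
        by (rule add_mono)
      then have "e * energy_bound + (y - x) / e \<le> eps"
        by (simp only: field_sum_of_halves)
      then have "- eps / 2 \<le> - (e * energy_bound + (y - x) / e) / 2"
        by (intro divide_right_mono) (simp_all only: neg_le_iff_le zero_le_numeral)
      also have "\<dots> \<le> u y - u x"
        by (rule sol_increment_ge[OF u \<open>0 \<le> x\<close> that(1,2) \<open>e > 0\<close>])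
      finally show ?thesis by simp
    qed
    \<comment> \<open>Otherwise \<open>L\<close> lies in the controlled range and
      \<open>u L \<ge> eps / 2\<close>, contradicting \<open>u L = 0\<close>.\<close>
    have "x + r \<le> L"
      using low[of L] \<open>\<not> u x < eps\<close> \<open>eps > 0\<close> solD(3)[OF u] x by (cases "x + r \<le> L") auto
    define y where "y = x + r"
    have y: "x \<le> y" "y \<le> L" "0 \<le> x" using \<open>x + r \<le> L\<close> \<open>r > 0\<close> x by (auto simp: y_def)
    have int: "(\<lambda>t. (\<bar>p (eps/2)\<bar> + \<bar>g t\<bar>) / \<alpha> + c / \<beta>) integrable_on {x..y}"
      using y by (intro integrable_add integrable_on_divide integrable_on_subinterval[OF gint]) auto
    have "u y - u x = integral {x..y} (slope c u)"
      using primitive_onD(3)[OF solD(5)[OF u]] y by simp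
    also have "\<dots> \<le> integral {x..y} (\<lambda>t. (\<bar>p (eps/2)\<bar> + \<bar>g t\<bar>) / \<alpha> + c / \<beta>)"
    proof (rule integral_le[OF _ int])
      show "slope c u integrable_on {x..y}"
        using y by (intro integrable_on_subinterval[OF primitive_onD(2)[OF solD(5)[OF u]]]) auto
      fix t assume t: "t \<in> {x..y}"
      have "eps / 2 \<le> u t"
        using low[of t] t y \<open>\<not> u x < eps\<close> by (simp add: y_def)
      then have "p (u t) \<le> p (eps/2)" using \<open>eps > 0\<close> by (intro p_antimono) auto
      then have "(p (u t) + g t) * A t \<le> (\<bar>p (eps/2)\<bar> + \<bar>g t\<bar>) * A t"
        using A_pos[of t] by (intro mult_right_mono) auto
      also have "\<dots> \<le> (\<bar>p (eps/2)\<bar> + \<bar>g t\<bar>) / \<alpha>" by (intro mult_A_le) simp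
      finally have "(p (u t) + g t) * A t \<le> (\<bar>p (eps/2)\<bar> + \<bar>g t\<bar>) / \<alpha>" .
      moreover have "c * A t \<le> c / \<beta>"
        using le_mult_A[of "-c" t] c \<open>C < 0\<close> by simp
      ultimately show "slope c u t \<le> (\<bar>p (eps/2)\<bar> + \<bar>g t\<bar>) / \<alpha> + c / \<beta>"
        unfolding slope_def distrib_right by linarith
    qed
    also have "\<dots> = integral {x..y} (\<lambda>t. (\<bar>p (eps/2)\<bar> + \<bar>g t\<bar>) / \<alpha>) + c / \<beta> * r"
      using y gint \<open>r > 0\<close>
      by (subst integral_add) (auto simp: y_def intro!: integrable_add integrable_on_divide intro: integrable_on_subinterval)
    also have "integral {x..y} (\<lambda>t. (\<bar>p (eps/2)\<bar> + \<bar>g t\<bar>) / \<alpha>) \<le> integral {0..L} (\<lambda>t. (\<bar>p (eps/2)\<bar> + \<bar>g t\<bar>) / \<alpha>)"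
      using y gint \<alpha>_pos
      by (intro integral_subset_le)
        (auto intro!: integrable_add integrable_on_divide divide_nonneg_pos intro: integrable_on_subinterval)
    also have "\<dots> = integral {0..L} (\<lambda>t. \<bar>p (eps/2)\<bar> + \<bar>g t\<bar>) / \<alpha>"
      by (rule integral_divide)
    also have "integral {0..L} (\<lambda>t. \<bar>p (eps/2)\<bar> + \<bar>g t\<bar>) =
        integral {0..L} (\<lambda>t. \<bar>p (eps/2)\<bar>) + integral {0..L} (\<lambda>t. \<bar>g t\<bar>)"
      by (rule integral_add[OF _ gint]) auto
    also have "integral {0..L} (\<lambda>t. \<bar>p (eps/2)\<bar>) = \<bar>p (eps/2)\<bar> * L"
      using L_pos by simp
    finally have "u y - u x \<le> G + c / \<beta> * r"
      unfolding G_def by simp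
    moreover have "u x - eps / 2 \<le> u y"
      using low[of y] y by (simp add: y_def)
    moreover have "c / \<beta> * r \<le> C / \<beta> * r"
      using c \<beta>_pos \<open>r > 0\<close> by (simp add: divide_right_mono)
    moreover have "C / \<beta> * r = - (G + eps)"
      using \<beta>_pos \<open>r > 0\<close> by (simp add: C_def)
    ultimately show False using \<open>eps > 0\<close> by simp
  qed
  then show ?thesis by blast
qed

section \<open>Upper bound on the solvable parameters\<close>

lemma integral_abs_g_le: "integral {0..L} (\<lambda>x. \<bar>g x\<bar>) \<le> sqrt L * sqrt (integral {0..L} (\<lambda>x. (g x)\<^sup>2))"
proof -
  define I J where "I = integral {0..L} (\<lambda>x. \<bar>g x\<bar>)" and "J = integral {0..L} (\<lambda>x. (g x)\<^sup>2)"
  have gint: "(\<lambda>t. \<bar>g t\<bar>) integrable_on {0..L}" "(\<lambda>t. (g t)\<^sup>2) integrable_on {0..L}"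
    using sq_integrable_abs_integrable[OF g_sq] g_sq
    unfolding absolutely_integrable_on_def sq_integrable_def by auto
  \<comment> \<open>Cauchy-Schwarz against the constant 1, obtained from the nonnegative variance of
    \<open>\<bar>g\<bar>\<close> around its mean \<open>I / L\<close>.\<close>
  have "0 \<le> integral {0..L} (\<lambda>x. (\<bar>g x\<bar> - I / L)\<^sup>2)"
  proof (rule integral_nonneg)
    have "(\<lambda>x. (g x)\<^sup>2 - (2 * (I / L)) * \<bar>g x\<bar> + (I / L)\<^sup>2) integrable_on {0..L}"
      by (intro integrable_add integrable_diff integrable_on_mult_right gint) auto
    then show "(\<lambda>x. (\<bar>g x\<bar> - I / L)\<^sup>2) integrable_on {0..L}"
      by (simp add: power2_diff algebra_simps)
  qed simp
  also have "(\<lambda>x. (\<bar>g x\<bar> - I / L)\<^sup>2) = (\<lambda>x. (g x)\<^sup>2 - (2 * (I / L)) * \<bar>g x\<bar> + (I / L)\<^sup>2)"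
    by (simp add: power2_diff algebra_simps)
  also have "integral {0..L} \<dots> = integral {0..L} (\<lambda>x. (g x)\<^sup>2 - (2 * (I / L)) * \<bar>g x\<bar>) + integral {0..L} (\<lambda>x. (I / L)\<^sup>2)"
    by (intro integral_add integrable_diff integrable_on_mult_right gint) auto
  also have "integral {0..L} (\<lambda>x. (g x)\<^sup>2 - (2 * (I / L)) * \<bar>g x\<bar>) = J - integral {0..L} (\<lambda>x. (2 * (I / L)) * \<bar>g x\<bar>)"
    unfolding J_def by (intro integral_diff integrable_on_mult_right gint)
  also have "integral {0..L} (\<lambda>x. (2 * (I / L)) * \<bar>g x\<bar>) = (2 * (I / L)) * I"
    unfolding I_def by (rule integral_mult_right)
  also have "integral {0..L} (\<lambda>x. (I / L)\<^sup>2) = L * (I / L)\<^sup>2"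
    using L_pos by simp
  also have "J - 2 * (I / L) * I + L * (I / L)\<^sup>2 = J - I\<^sup>2 / L"
    using L_pos by (simp add: power2_eq_square field_simps)
  finally have "I\<^sup>2 \<le> L * J" using L_pos by (simp add: field_simps)
  then have "sqrt (I\<^sup>2) \<le> sqrt (L * J)" by (rule real_sqrt_le_mono)
  then show ?thesis by (simp add: I_def J_def real_sqrt_mult)
qed

text \<open>The slope integrates to 0 over \<open>[0,L]\<close> and is at least
  \<open>(\<mu> + c) / \<beta> - \<bar>g\<bar> / \<alpha>\<close> when \<open>\<mu> + c > 0\<close>;
  the sign is what allows the lower bound on \<open>A\<close>. For \<open>\<mu> + c \<le> 0\<close>
  the right-hand side is nonnegative anyway.\<close>

lemma sol_parameter_bound:
  assumes u: "sol c u" and \<mu>: "\<And>s. 0 < s \<Longrightarrow> \<mu> \<le> p s"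
  shows "\<mu> + c \<le> (1 / sqrt L) * (\<beta> / \<alpha>) * sqrt (integral {0..L} (\<lambda>x. (g x)\<^sup>2))"
proof (cases "\<mu> + c \<le> 0")
  case True
  moreover have "0 \<le> (1 / sqrt L) * (\<beta> / \<alpha>) * sqrt (integral {0..L} (\<lambda>x. (g x)\<^sup>2))"
    using L_pos \<beta>_pos \<alpha>_pos g_sq unfolding sq_integrable_def
    by (intro mult_nonneg_nonneg divide_nonneg_nonneg real_sqrt_ge_zero integral_nonneg) auto
  ultimately show ?thesis by linarith
next
  case False
  define J where "J = sqrt (integral {0..L} (\<lambda>x. (g x)\<^sup>2))"
  have gint: "(\<lambda>t. \<bar>g t\<bar>) integrable_on {0..L}"
    using sq_integrable_abs_integrable[OF g_sq] unfolding absolutely_integrable_on_def by simp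
  have "integral {0..L} (\<lambda>t. (\<mu> + c) / \<beta> - \<bar>g t\<bar> / \<alpha>) \<le> integral {0..L} (slope c u)"
  proof (rule integral_mono_except_negligible[OF _ primitive_onD(2)[OF solD(5)[OF u]] negligible_endpoints])
    show "(\<lambda>t. (\<mu> + c) / \<beta> - \<bar>g t\<bar> / \<alpha>) integrable_on {0..L}"
      by (intro integrable_diff integrable_on_divide gint) auto
    fix t assume "t \<in> {0..L} - {0, L}"
    then have "(\<mu> + c) * A t \<le> (p (u t) + c) * A t"
      using A_pos[of t] solD(1)[OF u, of t] \<mu>[of "u t"] by (intro mult_right_mono) auto
    moreover have "(\<mu> + c) / \<beta> \<le> (\<mu> + c) * A t" using False by (intro le_mult_A) simp
    moreover have "- (\<bar>g t\<bar> / \<alpha>) \<le> g t * A t"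
    proof -
      have "- g t * A t \<le> \<bar>g t\<bar> * A t" using A_pos[of t] by (intro mult_right_mono) auto
      then show ?thesis using mult_A_le[of "\<bar>g t\<bar>" t] by simp
    qed
    ultimately show "(\<mu> + c) / \<beta> - \<bar>g t\<bar> / \<alpha> \<le> slope c u t"
      unfolding slope_def distrib_right by linarith
  qed
  also have "integral {0..L} (slope c u) = 0"
    using primitive_onD(3)[OF solD(5)[OF u], of 0 L] L_pos solD(2,3)[OF u] by simp
  also have "integral {0..L} (\<lambda>t. (\<mu> + c) / \<beta> - \<bar>g t\<bar> / \<alpha>) = L * ((\<mu> + c) / \<beta>) - integral {0..L} (\<lambda>t. \<bar>g t\<bar>) / \<alpha>"
    using gint L_pos by (subst integral_diff) (auto intro: integrable_on_divide)
  finally have "L * ((\<mu> + c) / \<beta>) \<le> integral {0..L} (\<lambda>t. \<bar>g t\<bar>) / \<alpha>" by simp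
  also have "\<dots> \<le> sqrt L * J / \<alpha>"
    using integral_abs_g_le \<alpha>_pos by (intro divide_right_mono) (auto simp: J_def)
  finally have "sqrt L * (sqrt L * ((\<mu> + c) / \<beta>)) \<le> sqrt L * (J / \<alpha>)"
    using L_pos by (simp flip: mult.assoc)
  then have "sqrt L * ((\<mu> + c) / \<beta>) \<le> J / \<alpha>"
    by (rule mult_left_le_imp_le) (use L_pos in simp)
  then show ?thesis
    using L_pos \<beta>_pos \<alpha>_pos by (simp add: J_def field_simps)
qed

end

section \<open>Lipschitz approximation and Picard iteration\<close>

text \<open>The complete metric space at hand consists of bounded continuous functions on the whole
  line; clamping the argument embeds continuous functions on \<open>[0,L]\<close> into it.\<close>

lemma clamp_in_bcontfun:
  fixes F :: "real \<Rightarrow> real"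
  assumes "continuous_on {0..L} F" "0 < L"
  shows "(\<lambda>x. F (max 0 (min L x))) \<in> bcontfun"
proof -
  have "continuous_on UNIV (\<lambda>x. F (max 0 (min L x)))"
    by (rule continuous_on_compose2[OF assms(1)]) (use assms(2) in \<open>auto intro!: continuous_intros\<close>)
  moreover have "bounded (F ` {0..L})"
    by (intro compact_imp_bounded compact_continuous_image assms) simp
  then have "bounded (range (\<lambda>x. F (max 0 (min L x))))"
    by (rule bounded_subset) (use assms(2) in auto)
  ultimately show ?thesis by (simp add: bcontfun_def)
qed

text \<open>The Picard operator is a contraction after conjugation by the weight \<open>exp (r t)\<close>.\<close>

lemma Lipschitz_Caratheodory_ode:
  fixes q A G :: "real \<Rightarrow> real"
  assumes L: "0 < L" and K: "0 < K" and B: "0 < B"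
    and q: "\<And>s t. \<bar>q s - q t\<bar> \<le> K * \<bar>s - t\<bar>"
    and A: "A \<in> borel_measurable (lebesgue_on {0..L})" "\<And>x. \<bar>A x\<bar> \<le> B"
    and G: "G absolutely_integrable_on {0..L}"
  obtains v where "primitive_on 0 L v (\<lambda>t. q (v t) * A t + G t)" "v 0 = 0"
proof -
  \<comment> \<open>The weight gains \<open>1 / r\<close> from integrating
    \<open>exp (r * t)\<close> against the Lipschitz constant \<open>K * B\<close>, so this
    \<open>r\<close> gives the contraction factor \<open>1 / 2\<close>.\<close>
  define r where "r = 2 * K * B"
  have "r > 0" using K B by (simp add: r_def)
  have Aint: "A absolutely_integrable_on {0..L}"
    by (rule measurable_bounded_by_integrable_imp_absolutely_integrable[OF A(1), where g = "\<lambda>_. B"])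
      (use A(2) in auto)
  have contq: "continuous_on S q" for S
  proof (rule continuous_onI)
    fix x and e :: real assume "e > 0"
    show "\<exists>d>0. \<forall>x'\<in>S. dist x' x < d \<longrightarrow> dist (q x') (q x) \<le> e"
    proof (intro exI[of _ "e / K"] conjI ballI impI)
      fix y assume "dist y x < e / K"
      then have "K * \<bar>y - x\<bar> \<le> e" using K by (simp add: dist_real_def field_simps)
      with q[of y x] show "dist (q y) (q x) \<le> e" by (simp add: dist_real_def)
    qed (use \<open>e > 0\<close> K in simp)
  qed
  define rhs where "rhs = (\<lambda>w t. q (exp (r * t) * w t) * A t + G t)"
  have int: "rhs w absolutely_integrable_on {0..L}" if "continuous_on {0..L} w" for w
    unfolding rhs_def
    by (intro set_integral_add G absolutely_integrable_continuous_mult[OF _ Aint]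
        continuous_on_compose2[OF contq[of UNIV]] continuous_intros that) auto
  then have int': "rhs w integrable_on {0..L}" if "continuous_on {0..L} w" for w
    using that absolutely_integrable_on_def by blast
  define F where "F = (\<lambda>w y. exp (- r * y) * integral {0..y} (rhs w))"
  have contF: "continuous_on {0..L} (F w)" if "continuous_on {0..L} w" for w
    unfolding F_def by (intro continuous_intros indefinite_integral_continuous_1 int' that)
  define T :: "(real \<Rightarrow>\<^sub>C real) \<Rightarrow> (real \<Rightarrow>\<^sub>C real)"
    where "T = (\<lambda>w. Bcontfun (\<lambda>x. F (apply_bcontfun w) (max 0 (min L x))))"
  have T: "apply_bcontfun (T w) x = F (apply_bcontfun w) (max 0 (min L x))" for w x
    unfolding T_def by (subst Bcontfun_inverse) (auto intro!: clamp_in_bcontfun contF L)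
  have expint: "primitive_on 0 L (\<lambda>t. exp (r * t) / r) (\<lambda>t. exp (r * t))"
    by (rule primitive_on_C1) (use \<open>r > 0\<close> in \<open>auto intro!: derivative_eq_intros continuous_intros\<close>)
  have contr: "dist (T w1) (T w2) \<le> 1 / 2 * dist w1 w2" for w1 w2
  proof (rule dist_bound)
    fix x
    define y where "y = max 0 (min L x)"
    have y: "0 \<le> y" "y \<le> L" using L by (auto simp: y_def)
    define D where "D = dist w1 w2"
    have "D \<ge> 0" by (simp add: D_def)
    have sub: "rhs (apply_bcontfun w) integrable_on {0..y}" for w
      by (rule integrable_on_subinterval[OF int']) (use y in auto)
    have "\<bar>integral {0..y} (rhs w1) - integral {0..y} (rhs w2)\<bar> =
        \<bar>integral {0..y} (\<lambda>t. rhs w1 t - rhs w2 t)\<bar>"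
      by (subst integral_diff) (auto intro: sub)
    also have "\<dots> \<le> integral {0..y} (\<lambda>t. K * B * D * exp (r * t))"
    proof (rule integral_norm_bound_integral[where 'a = real, unfolded real_norm_def])
      show "(\<lambda>t. rhs w1 t - rhs w2 t) integrable_on {0..y}" by (intro integrable_diff sub)
      show "(\<lambda>t. K * B * D * exp (r * t)) integrable_on {0..y}"
        by (intro integrable_continuous_real continuous_intros)
      fix t
      have "\<bar>q (exp (r * t) * w1 t) - q (exp (r * t) * w2 t)\<bar> \<le> K * \<bar>exp (r * t) * w1 t - exp (r * t) * w2 t\<bar>"
        by (rule q)
      also have "\<dots> = K * (exp (r * t) * dist (w1 t) (w2 t))"
        by (simp add: dist_real_def abs_mult flip: right_diff_distrib)
      also have "\<dots> \<le> K * (exp (r * t) * D)"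
        unfolding D_def using K by (intro mult_left_mono dist_bounded) auto
      finally have *: "\<bar>q (exp (r * t) * w1 t) - q (exp (r * t) * w2 t)\<bar> \<le> K * (exp (r * t) * D)" .
      have "\<bar>rhs w1 t - rhs w2 t\<bar> = \<bar>q (exp (r * t) * w1 t) - q (exp (r * t) * w2 t)\<bar> * \<bar>A t\<bar>"
        by (simp add: rhs_def flip: abs_mult left_diff_distrib)
      also have "\<dots> \<le> (K * (exp (r * t) * D)) * B"
        by (intro mult_mono * A(2)) (use K \<open>D \<ge> 0\<close> in auto)
      also have "\<dots> = K * B * D * exp (r * t)" by simp
      finally show "\<bar>rhs w1 t - rhs w2 t\<bar> \<le> K * B * D * exp (r * t)" .
    qed
    also have "\<dots> = K * B * D * integral {0..y} (\<lambda>t. exp (r * t))"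
      by (rule integral_mult_right)
    also have "integral {0..y} (\<lambda>t. exp (r * t)) = exp (r * y) / r - 1 / r"
      using primitive_onD(3)[OF expint, of 0 y] y by simp
    also have "K * B * D * (exp (r * y) / r - 1 / r) \<le> K * B * D * (exp (r * y) / r)"
      using K B \<open>D \<ge> 0\<close> \<open>r > 0\<close> by (intro mult_left_mono) auto
    also have "\<dots> = D / 2 * exp (r * y)"
      using K B by (simp add: r_def field_simps)
    finally have *: "\<bar>integral {0..y} (rhs w1) - integral {0..y} (rhs w2)\<bar> \<le> D / 2 * exp (r * y)" .
    have "dist (T w1 x) (T w2 x) = exp (- r * y) * \<bar>integral {0..y} (rhs w1) - integral {0..y} (rhs w2)\<bar>"
      by (simp add: T F_def dist_real_def y_def abs_mult flip: right_diff_distrib)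
    also have "\<dots> \<le> exp (- r * y) * (D / 2 * exp (r * y))"
      by (intro mult_left_mono *) simp
    also have "\<dots> = 1 / 2 * D" by (simp add: exp_minus field_simps)
    finally show "dist (T w1 x) (T w2 x) \<le> 1 / 2 * dist w1 w2" by (simp add: D_def)
  qed
  obtain w where w: "T w = w"
    using banach_fix_type[of "1/2" T] contr by auto
  define v where "v = (\<lambda>t. exp (r * t) * w t)"
  have v: "v y = integral {0..y} (rhs w)" if "y \<in> {0..L}" for y
  proof -
    have "w y = F w y" using T[of w y] that w by (simp add: min_absorb2 max_absorb2)
    then show ?thesis by (simp add: v_def F_def exp_minus field_simps)
  qed
  have "rhs (apply_bcontfun w) = (\<lambda>t. q (v t) * A t + G t)"
    by (simp add: rhs_def v_def)
  moreover have "primitive_on 0 L v (rhs w)"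
  proof (rule primitive_onI[OF int])
    show "v x = v 0 + integral {0..x} (rhs w)" if "x \<in> {0..L}" for x
      using v[OF that] v[of 0] L by simp
  qed simp
  moreover have "v 0 = 0" using v[of 0] L by simp
  ultimately show ?thesis using that by simp
qed

text \<open>Pasch-Hausdorff envelope: for \<open>f\<close> bounded below on
  \<open>(0,\<infinity>)\<close>, the largest \<open>n\<close>-Lipschitz function on the line that
  lies below \<open>f\<close> on \<open>(0,\<infinity>)\<close>. It is defined at nonpositive
  \<open>s\<close> too, so the regularized equations make sense before any sign is known.\<close>

definition inf_convolution :: "(real \<Rightarrow> real) \<Rightarrow> nat \<Rightarrow> real \<Rightarrow> real" where
  "inf_convolution f n s = (INF t\<in>{0<..}. f t + real n * \<bar>s - t\<bar>)"

context
  fixes f :: "real \<Rightarrow> real" and m :: real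
  assumes lower: "\<And>t. 0 < t \<Longrightarrow> m \<le> f t"
begin

lemma inf_convolution_bdd: "bdd_below ((\<lambda>t. f t + real n * \<bar>s - t\<bar>) ` {0<..})"
  by (rule bdd_belowI2[where m = m]) (use lower in \<open>auto intro: add_increasing2\<close>)

lemma inf_convolution_le: "0 < t \<Longrightarrow> inf_convolution f n s \<le> f t + real n * \<bar>s - t\<bar>"
  unfolding inf_convolution_def by (intro cINF_lower inf_convolution_bdd) auto

lemma inf_convolution_ge:
  "(\<And>t. 0 < t \<Longrightarrow> x \<le> f t + real n * \<bar>s - t\<bar>) \<Longrightarrow> x \<le> inf_convolution f n s"
  unfolding inf_convolution_def by (intro cINF_greatest) (auto intro: exI[of _ 1])

lemma inf_convolution_le_self: "0 < s \<Longrightarrow> inf_convolution f n s \<le> f s"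
  using inf_convolution_le[of s n s] by simp

lemma inf_convolution_lower: "m \<le> inf_convolution f n s"
  using lower by (intro inf_convolution_ge) (auto intro: add_increasing2)

lemma inf_convolution_mono:
  assumes "n \<le> k"
  shows "inf_convolution f n s \<le> inf_convolution f k s"
proof (rule inf_convolution_ge)
  fix t :: real assume "0 < t"
  have "real n * \<bar>s - t\<bar> \<le> real k * \<bar>s - t\<bar>"
    using assms by (intro mult_right_mono) auto
  with inf_convolution_le[OF \<open>0 < t\<close>, of n s]
  show "inf_convolution f n s \<le> f t + real k * \<bar>s - t\<bar>" by linarith
qed

lemma inf_convolution_Lipschitz: "\<bar>inf_convolution f n s - inf_convolution f n s'\<bar> \<le> real n * \<bar>s - s'\<bar>"
proof -
  have "inf_convolution f n s - real n * \<bar>s - s'\<bar> \<le> inf_convolution f n s'" for s s'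
  proof (rule inf_convolution_ge)
    fix t :: real assume "0 < t"
    have "real n * \<bar>s - t\<bar> \<le> real n * (\<bar>s - s'\<bar> + \<bar>s' - t\<bar>)"
      by (intro mult_left_mono) auto
    with inf_convolution_le[OF \<open>0 < t\<close>, of n s]
    show "inf_convolution f n s - real n * \<bar>s - s'\<bar> \<le> f t + real n * \<bar>s' - t\<bar>"
      by (simp add: distrib_left)
  qed
  from this[of s s'] this[of s' s] show ?thesis by (simp add: abs_minus_commute abs_le_iff)
qed

text \<open>Shifting a competitor \<open>t\<close> for \<open>s\<close> by \<open>s' - s\<close>
  gives a competitor for \<open>s'\<close> with the same penalty and no larger value of
  \<open>f\<close>.\<close>

lemma inf_convolution_antimono:
  assumes anti: "\<And>s t. 0 < s \<Longrightarrow> s \<le> t \<Longrightarrow> f t \<le> f s" and "s \<le> s'"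
  shows "inf_convolution f n s' \<le> inf_convolution f n s"
proof (rule inf_convolution_ge)
  fix t :: real assume "0 < t"
  then show "inf_convolution f n s' \<le> f t + real n * \<bar>s - t\<bar>"
    using inf_convolution_le[of "t + (s' - s)" n s'] anti[of t "t + (s' - s)"] \<open>s \<le> s'\<close>
    by (simp add: algebra_simps)
qed

text \<open>Competitors near \<open>s\<close> have values close to \<open>f s\<close> by continuity;
  those farther than \<open>d\<close> pay a penalty of at least \<open>n * d\<close>, which
  eventually exceeds \<open>f s - m\<close>.\<close>

lemma inf_convolution_tendsto:
  assumes cont: "isCont f s" and "0 < s"
  shows "(\<lambda>n. inf_convolution f n s) \<longlonglongrightarrow> f s"
proof (rule tendstoI)
  fix e :: real assume "e > 0"
  obtain d where d: "d > 0" "\<And>t. dist t s < d \<Longrightarrow> dist (f t) (f s) < e / 2"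
    using cont \<open>e > 0\<close> unfolding continuous_at_eps_delta dist_real_def by (metis half_gt_zero)
  obtain N :: nat where N: "(f s - m) / d < real N"
    using reals_Archimedean2 by blast
  have "dist (inf_convolution f n s) (f s) < e" if "N \<le> n" for n
  proof -
    have "f s - e / 2 \<le> inf_convolution f n s"
    proof (rule inf_convolution_ge)
      fix t :: real assume "0 < t"
      show "f s - e / 2 \<le> f t + real n * \<bar>s - t\<bar>"
      proof (cases "dist t s < d")
        case True
        with d(2)[OF True] have "f s - e / 2 \<le> f t" by (simp add: dist_real_def abs_if split: if_splits)
        then show ?thesis by (simp add: add_increasing2)
      next
        case False
        have "f s - m \<le> real N * d" using N d(1) by (simp add: field_simps)
        also have "\<dots> \<le> real n * \<bar>s - t\<bar>"
          using False that d(1) by (intro mult_mono) (auto simp: dist_real_def abs_minus_commute)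
        finally show ?thesis using lower[OF \<open>0 < t\<close>] \<open>e > 0\<close> by simp
      qed
    qed
    with inf_convolution_le_self[OF \<open>0 < s\<close>, of n] \<open>e > 0\<close> show ?thesis
      by (simp add: dist_real_def)
  qed
  then show "\<forall>\<^sub>F n in sequentially. dist (inf_convolution f n s) (f s) < e"
    unfolding eventually_sequentially by blast
qed

end

section \<open>Existence below a solvable parameter\<close>

context singular_problem
begin


lemma p_isCont: "0 < s \<Longrightarrow> isCont p s"
  using p_cont by (simp add: continuous_on_eq_continuous_at)

lemma p_borel: "p \<in> borel_measurable borel"
proof -
  have "p = (\<lambda>s. if s \<in> {0<..} then p s else m)"
    by (auto simp: fun_eq_iff intro: p_nonpos)
  also have "\<dots> \<in> borel_measurable borel"
    by (intro borel_measurable_continuous_on_if p_cont continuous_intros) auto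
  finally show ?thesis .
qed

lemma p_comp_measurable:
  fixes u :: "real \<Rightarrow> real"
  assumes "continuous_on {a..b} u"
  shows "(\<lambda>x. p (u x)) \<in> borel_measurable (lebesgue_on {a..b})"
  using measurable_comp[OF continuous_imp_borel_measurable_Icc[OF assms] p_borel]
  by (simp add: comp_def)

text \<open>By scaling. A function above \<open>kap * t\<close> has \<open>p\<close> of it below
  \<open>p (kap * t)\<close>, so this is the majorant for passing to the limit near the singular
  starting point.\<close>

lemma p_linear_integrable:
  assumes "0 < kap"
  shows "(\<lambda>t. \<bar>p (kap * t)\<bar>) integrable_on {0..X}"
proof -
  have "(\<lambda>s. \<bar>p s\<bar>) integrable_on {0..kap * X}"
    using p_absolutely_integrable[of "kap * X"] unfolding absolutely_integrable_on_def by simp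
  then have "(\<lambda>t. \<bar>p (kap * t)\<bar>) integrable_on ((\<lambda>x. x / kap) ` {0..kap * X})"
    by (rule integrable_stretch_real) (use assms in simp)
  moreover have "(\<lambda>x. x / kap) ` {0..kap * X} = {0..X}"
  proof
    show "{0..X} \<subseteq> (\<lambda>x. x / kap) ` {0..kap * X}"
      using assms by (auto intro!: image_eqI[where x = "kap * _"])
  qed (use assms in \<open>auto simp: field_simps\<close>)
  ultimately show ?thesis by simp
qed

definition source :: "real \<Rightarrow> real \<Rightarrow> real" where
  "source c t = (g t + c) * A t"

lemma sq_integrable_source: "sq_integrable 0 L (source c)"
proof -
  have "sq_integrable 0 L (\<lambda>t. A t * (g t + c))"
    by (intro sq_integrable_bounded_mult[OF A_meas_on abs_A_le] sq_integrable_add g_sq sq_integrable_const)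
  then show ?thesis by (simp add: source_def[abs_def] mult.commute)
qed

lemma slope_eq_source: "slope c u t = p (u t) * A t + source c t"
  by (simp add: slope_def source_def algebra_simps)

lemma m_lower: "0 < t \<Longrightarrow> m \<le> p t"
  by (rule p_lower)

text \<open>The shift to \<open>Suc n\<close> keeps the Lipschitz constant positive, as
  \<open>Lipschitz_Caratheodory_ode\<close> requires.\<close>

abbreviation q :: "nat \<Rightarrow> real \<Rightarrow> real" where
  "q n \<equiv> inf_convolution p (Suc n)"

definition approx_sol :: "real \<Rightarrow> nat \<Rightarrow> (real \<Rightarrow> real) \<Rightarrow> bool" where
  "approx_sol c n v \<longleftrightarrow> primitive_on 0 L v (\<lambda>t. q n (v t) * A t + source c t) \<and> v 0 = 0"

section \<open>Regularized initial value problems\<close>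

lemma approx_sol_exists: "\<exists>v. approx_sol c n v"
proof -
  have "0 < 1 / \<alpha>" using \<alpha>_pos by simp
  moreover have "0 < real (Suc n)" by simp
  ultimately obtain v where "primitive_on 0 L v (\<lambda>t. q n (v t) * A t + source c t)" "v 0 = 0"
    using Lipschitz_Caratheodory_ode[OF L_pos _ _ inf_convolution_Lipschitz[of m p "Suc n", OF m_lower] A_meas_on abs_A_le
        sq_integrable_abs_integrable[OF sq_integrable_source]] by blast
  then show ?thesis unfolding approx_sol_def by blast
qed

lemma q_antimono: "s \<le> s' \<Longrightarrow> q n s' \<le> q n s"
  by (rule inf_convolution_antimono[of m p, OF m_lower p_antimono])

lemma approx_sol_mono:
  assumes v: "approx_sol c n v" and w: "approx_sol c k w" and "n \<le> k" and x: "x \<in> {0..L}"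
  shows "v x \<le> w x"
proof -
  have "v x - w x \<le> 0"
  proof (rule primitive_on_nonpos[OF _ _ zero_less_one negligible_empty _ x])
    show "primitive_on 0 L (\<lambda>x. v x - w x)
       (\<lambda>t. (q n (v t) * A t + source c t) - (q k (w t) * A t + source c t))"
      using v w unfolding approx_sol_def by (intro primitive_on_diff) auto
    show "v 0 - w 0 \<le> 0" using v w by (simp add: approx_sol_def)
    fix t assume "0 < v t - w t"
    then have "q n (v t) \<le> q n (w t)" by (intro q_antimono) simp
    also have "\<dots> \<le> q k (w t)"
      by (rule inf_convolution_mono[of m p, OF m_lower]) (use \<open>n \<le> k\<close> in auto)
    finally show "(q n (v t) * A t + source c t) - (q k (w t) * A t + source c t) \<le> 0"
      using A_pos[of t] by (simp add: mult_right_mono)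
  qed
  then show ?thesis by simp
qed

text \<open>\<open>u\<close> is a supersolution, since \<open>q n \<le> p\<close> on
  \<open>(0,\<infinity>)\<close> and \<open>c \<le> c0\<close>. This barrier bounds the increasing
  sequence of approximations and later pins its limit at \<open>L\<close>.\<close>

lemma approx_sol_le_sol:
  assumes v: "approx_sol c n v" and u: "sol c0 u" and "c \<le> c0" and x: "x \<in> {0..L}"
  shows "v x \<le> u x"
proof -
  have "v x - u x \<le> 0"
  proof (rule primitive_on_nonpos[OF _ _ zero_less_one negligible_endpoints _ x])
    show "primitive_on 0 L (\<lambda>x. v x - u x)
       (\<lambda>t. (q n (v t) * A t + source c t) - slope c0 u t)"
      using v solD(5)[OF u] unfolding approx_sol_def by (intro primitive_on_diff) auto
    show "v 0 - u 0 \<le> 0" using v solD(2)[OF u] by (simp add: approx_sol_def)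
    fix t assume t: "t \<in> {0..L} - {0, L}" "0 < v t - u t"
    then have "q n (v t) \<le> q n (u t)" by (intro q_antimono) simp
    also have "\<dots> \<le> p (u t)"
      by (rule inf_convolution_le_self[of m p, OF m_lower]) (use t solD(1)[OF u, of t] in auto)
    finally have "(q n (v t) + g t + c) * A t \<le> (p (u t) + g t + c0) * A t"
      using A_pos[of t] \<open>c \<le> c0\<close> by (intro mult_right_mono) auto
    then show "(q n (v t) * A t + source c t) - slope c0 u t \<le> 0"
      by (simp add: slope_def source_def algebra_simps)
  qed
  then show ?thesis by simp
qed

text \<open>Once \<open>q n s0\<close> is large, antimonotonicity makes \<open>q n\<close> large on
  all of \<open>(-\<infinity>,s0]\<close>, so below the level \<open>s0\<close> the slope is at
  least \<open>A\<close>. A single \<open>kap\<close> serves all large \<open>n\<close>.\<close>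

lemma approx_sol_linear_lower_bound:
  assumes "0 < x0" "x0 < L"
  obtains kap N where "0 < kap"
    "\<And>n v x. N \<le> n \<Longrightarrow> approx_sol c n v \<Longrightarrow> x \<in> {0..x0} \<Longrightarrow> kap * x \<le> v x"
proof -
  have "\<exists>M N. negligible N \<and> (\<forall>t\<in>{0..x0} - N. - M \<le> g t)"
    using g_lower[of "L - x0"] assms by simp
  then obtain M N0 where N0: "negligible N0" "\<And>t. t \<in> {0..x0} - N0 \<Longrightarrow> - M \<le> g t"
    by blast
  \<comment> \<open>One unit of the 2 is spent on passing from \<open>p s0\<close> to
    \<open>q n s0\<close>; the other leaves \<open>q + g + c \<ge> 1\<close>.\<close>
  obtain s0 where s0: "s0 > 0" "M - c + 2 \<le> p s0"
    using p_unbounded by blast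
  have "(\<lambda>n. q n s0) \<longlonglongrightarrow> p s0"
    by (rule LIMSEQ_Suc, rule inf_convolution_tendsto[of m p, OF m_lower p_isCont]) (use s0 in auto)
  then have "\<forall>\<^sub>F n in sequentially. M - c + 1 < q n s0"
    using s0(2) by (intro order_tendstoD(1)[where y = "p s0"]) auto
  then obtain N where N: "\<And>n. N \<le> n \<Longrightarrow> M - c + 1 < q n s0"
    unfolding eventually_sequentially by blast
  \<comment> \<open>The bound \<open>1 / \<beta>\<close> puts \<open>kap\<close> below the slope
    \<open>A\<close>; the bound \<open>s0 / L\<close> keeps the line \<open>kap * t\<close> below
    the level \<open>s0\<close>.\<close>
  define kap where "kap = min (1 / \<beta>) (s0 / L)"
  have "0 < kap" using \<beta>_pos L_pos s0(1) by (simp add: kap_def)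
  show ?thesis
  proof (rule that[OF \<open>0 < kap\<close>])
    fix n v x assume n: "N \<le> n" and v: "approx_sol c n v" and x: "x \<in> {0..x0}"
    have prim: "primitive_on 0 x0 v (\<lambda>t. q n (v t) * A t + source c t)"
      by (rule primitive_on_subset[of 0 L]) (use v assms in \<open>auto simp: approx_sol_def\<close>)
    show "kap * x \<le> v x"
    proof (rule linear_lower_bound[OF prim _ zero_less_one N0(1) _ _ x])
      fix t assume t: "t \<in> {0..x0} - N0" "v t < kap * t"
      have "kap * t \<le> s0 / L * L"
        using t(1) assms s0(1) L_pos by (intro mult_mono) (auto simp: kap_def)
      then have "v t \<le> s0" using t(2) L_pos by simp
      then have "q n s0 \<le> q n (v t)" by (rule q_antimono)
      then have "1 * A t \<le> (q n (v t) + g t + c) * A t"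
        using N[OF n] N0(2)[OF t(1)] A_pos[of t] by (intro mult_right_mono) auto
      then have "A t \<le> q n (v t) * A t + source c t"
        by (simp add: source_def algebra_simps)
      moreover have "kap \<le> A t" using A_lower[of t] by (simp add: kap_def)
      ultimately show "kap \<le> q n (v t) * A t + source c t" by simp
    qed (use v \<open>0 < kap\<close> in \<open>auto simp: approx_sol_def\<close>)
  qed
qed

lemma approx_sol_limit:
  assumes v: "\<And>n. approx_sol c n (vs n)"
    and lim: "\<And>x. 0 \<le> x \<Longrightarrow> x < L \<Longrightarrow> (\<lambda>n. vs n x) \<longlonglongrightarrow> v x"
    and x0: "0 < x0" "x0 < L"
  shows "primitive_on 0 x0 v (slope c v)" and "\<And>x. 0 < x \<Longrightarrow> x \<le> x0 \<Longrightarrow> 0 < v x"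
proof -
  obtain kap N where kap: "0 < kap"
    and low: "\<And>n v x. N \<le> n \<Longrightarrow> approx_sol c n v \<Longrightarrow> x \<in> {0..x0} \<Longrightarrow> kap * x \<le> v x"
    using approx_sol_linear_lower_bound[OF x0] by metis
  have le_lim: "vs n x \<le> v x" if "x \<in> {0..x0}" for n x
  proof (rule incseq_le[OF _ lim])
    show "incseq (\<lambda>n. vs n x)"
      using that x0 by (intro incseq_SucI approx_sol_mono[OF v v]) auto
  qed (use that x0 in auto)
  show pos: "0 < v x" if "0 < x" "x \<le> x0" for x
  proof -
    have "kap * x \<le> vs N x" using low[OF order_refl v] that by simp
    also have "\<dots> \<le> v x" using le_lim that by simp
    finally show ?thesis using mult_pos_pos[OF kap, of x] that by simp
  qed
  \<comment> \<open>Function and argument vary together, so the values are squeezed: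
    \<open>q n (v x) \<le> q n (vs n x) \<le> p (vs n x)\<close>, by antimonotonicity on the left
    and by the envelope property on the right.\<close>
  have conv: "(\<lambda>n. q n (vs n x)) \<longlonglongrightarrow> p (v x)" if x: "0 < x" "x \<le> x0" for x
  proof (rule tendsto_sandwich)
    show "(\<lambda>n. q n (v x)) \<longlonglongrightarrow> p (v x)"
      by (rule LIMSEQ_Suc, rule inf_convolution_tendsto[of m p, OF m_lower p_isCont]) (use pos[OF x] in auto)
    show "(\<lambda>n. p (vs n x)) \<longlonglongrightarrow> p (v x)"
      by (rule isCont_tendsto_compose[OF p_isCont[OF pos[OF x]] lim]) (use x x0 in auto)
    show "\<forall>\<^sub>F n in sequentially. q n (v x) \<le> q n (vs n x)"
      using le_lim[of x] x by (intro always_eventually allI q_antimono) auto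
    have "q n (vs n x) \<le> p (vs n x)" if "N \<le> n" for n
      by (rule inf_convolution_le_self[of m p, OF m_lower])
        (use low[OF that v, of x] x mult_pos_pos[OF kap, of x] in auto)
    then show "\<forall>\<^sub>F n in sequentially. q n (vs n x) \<le> p (vs n x)"
      unfolding eventually_sequentially by blast
  qed
  define b where "b = (\<lambda>t. (\<bar>m\<bar> + \<bar>p (kap * t)\<bar>) / \<alpha> + \<bar>source c t\<bar>)"
  have absint: "(\<lambda>t. \<bar>source c t\<bar>) integrable_on {0..L}"
    using sq_integrable_abs_integrable[OF sq_integrable_source] unfolding absolutely_integrable_on_def by simp
  have bint: "b integrable_on {0..x0}"
    unfolding b_def using x0
    by (intro integrable_add integrable_on_divide p_linear_integrable[OF kap] integrable_on_subinterval[OF absint]) auto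
  have bound: "\<bar>q n (vs n t) * A t + source c t\<bar> \<le> b t" if "N \<le> n" "0 < t" "t \<le> x0" for n t
  proof -
    have "q n (vs n t) \<le> p (vs n t)"
      by (rule inf_convolution_le_self[of m p, OF m_lower])
        (use low[OF that(1) v, of t] that mult_pos_pos[OF kap, of t] in auto)
    also have "\<dots> \<le> p (kap * t)"
      using low[OF that(1) v, of t] that kap by (intro p_antimono) auto
    finally have "q n (vs n t) \<le> p (kap * t)" .
    moreover have "m \<le> q n (vs n t)"
      by (rule inf_convolution_lower[OF m_lower])
    ultimately have "\<bar>q n (vs n t)\<bar> \<le> \<bar>m\<bar> + \<bar>p (kap * t)\<bar>" by simp
    then have "\<bar>q n (vs n t)\<bar> * A t \<le> (\<bar>m\<bar> + \<bar>p (kap * t)\<bar>) * A t"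
      using A_pos[of t] by (intro mult_right_mono) auto
    also have "\<dots> \<le> (\<bar>m\<bar> + \<bar>p (kap * t)\<bar>) / \<alpha>" by (intro mult_A_le) auto
    finally have "\<bar>q n (vs n t) * A t\<bar> \<le> (\<bar>m\<bar> + \<bar>p (kap * t)\<bar>) / \<alpha>"
      using A_pos[of t] by (simp add: abs_mult)
    then show ?thesis unfolding b_def by linarith
  qed
  have prim: "primitive_on 0 L (vs n) (\<lambda>t. q n (vs n t) * A t + source c t)" for n
    using v by (simp add: approx_sol_def)
  \<comment> \<open>Open intervals, because convergence and bound are known only for
    \<open>t > 0\<close>; at 0 the value of \<open>p\<close> is a default. The index is shifted by
    \<open>N\<close> so that the bound holds for every term.\<close>
  have limits: "slope c v integrable_on {0<..<x}"
    "(\<lambda>n. integral {0<..<x} (\<lambda>t. q (n + N) (vs (n + N) t) * A t + source c t)) \<longlonglongrightarrow> integral {0<..<x} (slope c v)"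
    if x: "x \<le> x0" for x
  proof -
    have 1: "(\<lambda>t. q (n + N) (vs (n + N) t) * A t + source c t) integrable_on {0<..<x}" for n
      unfolding integrable_on_open_interval_real
      by (rule integrable_on_subinterval[OF primitive_onD(2)[OF prim]]) (use x x0 in auto)
    have 2: "b integrable_on {0<..<x}"
      unfolding integrable_on_open_interval_real
      by (rule integrable_on_subinterval[OF bint]) (use x in auto)
    have 3: "norm (q (n + N) (vs (n + N) t) * A t + source c t) \<le> b t" if "t \<in> {0<..<x}" for n t
      using bound[of "n + N" t] that x by simp
    have 4: "(\<lambda>n. q (n + N) (vs (n + N) t) * A t + source c t) \<longlonglongrightarrow> slope c v t" if "t \<in> {0<..<x}" for t
      unfolding slope_eq_source using that x
      by (intro tendsto_intros LIMSEQ_ignore_initial_segment conv) auto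
    show "slope c v integrable_on {0<..<x}"
      by (rule dominated_convergence(1)[OF 1 2 3 4])
    show "(\<lambda>n. integral {0<..<x} (\<lambda>t. q (n + N) (vs (n + N) t) * A t + source c t)) \<longlonglongrightarrow> integral {0<..<x} (slope c v)"
      by (rule dominated_convergence(2)[OF 1 2 3 4])
  qed
  have eq: "v x = integral {0..x} (slope c v)" if x: "x \<in> {0..x0}" for x
  proof (rule LIMSEQ_unique)
    show "(\<lambda>n. vs (n + N) x) \<longlonglongrightarrow> v x"
      using lim[of x] x x0 by (intro LIMSEQ_ignore_initial_segment) auto
    have "vs n x = integral {0<..<x} (\<lambda>t. q n (vs n t) * A t + source c t)" for n
      using primitive_onD(3)[OF prim, of 0 x n] x x0 v[of n]
      by (simp add: approx_sol_def integral_open_interval_real)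
    then show "(\<lambda>n. vs (n + N) x) \<longlonglongrightarrow> integral {0..x} (slope c v)"
      using limits(2)[of x] x by (simp add: integral_open_interval_real)
  qed
  have "slope c v absolutely_integrable_on {0<..<x0}"
  proof (rule absolutely_integrable_integrable_bound)
    show "norm (slope c v t) \<le> b t" if t: "t \<in> {0<..<x0}" for t
    proof -
      have "(\<lambda>n. \<bar>q n (vs n t) * A t + source c t\<bar>) \<longlonglongrightarrow> \<bar>slope c v t\<bar>"
        unfolding slope_eq_source using t by (intro tendsto_intros conv) auto
      then show ?thesis
        using bound[of _ t] t unfolding real_norm_def
        by (intro LIMSEQ_le_const2) (auto intro!: exI[of _ N])
    qed
    show "slope c v integrable_on {0<..<x0}" by (rule limits(1)) simp
    show "b integrable_on {0<..<x0}" using bint by (simp add: integrable_on_open_interval_real)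
  qed
  then have "slope c v absolutely_integrable_on {0..x0}"
    by (simp only: absolutely_integrable_on_Icc_iff_Ioo)
  then show "primitive_on 0 x0 v (slope c v)"
    using eq[of 0] x0 by (intro primitive_onI) (auto intro: eq)
qed

text \<open>Monotone convergence along an exhaustion of \<open>(0,L)\<close> by compact intervals.
  It handles both ends at once, where only uniform bounds on interior integrals are
  available.\<close>

lemma sq_integrable_from_interior:
  fixes f :: "real \<Rightarrow> real"
  assumes meas: "f \<in> borel_measurable (lebesgue_on {0..L})"
    and int: "\<And>x y. 0 < x \<Longrightarrow> x < y \<Longrightarrow> y < L \<Longrightarrow> (\<lambda>t. (f t)\<^sup>2) integrable_on {x..y}"
    and bd: "\<And>x y. 0 < x \<Longrightarrow> x < y \<Longrightarrow> y < L \<Longrightarrow> integral {x..y} (\<lambda>t. (f t)\<^sup>2) \<le> C"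
  shows "sq_integrable 0 L f"
proof -
  \<comment> \<open>The offset 3 ensures \<open>x n < L - x n\<close> already for
    \<open>n = 0\<close>.\<close>
  define x where "x = (\<lambda>n::nat. L / (real n + 3))"
  define S where "S = (\<lambda>n. {x n..L - x n})"
  have x: "0 < x n" "x n < L - x n" "x (Suc n) \<le> x n" for n
    using L_pos by (auto simp: x_def field_simps intro!: add_pos_nonneg)
  define F where "F = (\<lambda>n t. if t \<in> S n then (f t)\<^sup>2 else 0)"
  have sub: "S n \<subseteq> {0<..<L}" for n
    using x[of n] by (auto simp: S_def)
  then have Int: "S n \<inter> {0<..<L} = S n" "{0<..<L} \<inter> S n = S n" for n
    by blast+
  have "(\<lambda>t. (f t)\<^sup>2) integrable_on {0<..<L}"
  proof (rule monotone_convergence_increasing(1)[where f = F, THEN conjunct1])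
    have Sint: "(\<lambda>t. (f t)\<^sup>2) integrable_on S n" for n
      unfolding S_def by (rule int) (use x[of n] in auto)
    show "F n integrable_on {0<..<L}" for n
      using Sint[of n] unfolding F_def by (subst integrable_restrict_Int) (simp add: Int[of n])
    show "F n t \<le> F (Suc n) t" for n t
      using x(3)[of n] by (auto simp: F_def S_def)
    show "(\<lambda>n. F n t) \<longlonglongrightarrow> (f t)\<^sup>2" if t: "t \<in> {0<..<L}" for t
    proof (rule tendsto_eventually)
      have "(\<lambda>n. L * inverse (real (Suc (n + 2)))) \<longlonglongrightarrow> 0"
        by (intro tendsto_mult_right_zero LIMSEQ_ignore_initial_segment LIMSEQ_inverse_real_of_nat)
      then have "(\<lambda>n. L / (real n + 3)) \<longlonglongrightarrow> 0" by (simp add: divide_inverse add.commute)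
      then have "\<forall>\<^sub>F n in sequentially. x n < min t (L - t)"
        using t unfolding x_def by (intro order_tendstoD(2)[where y = 0]) auto
      then show "\<forall>\<^sub>F n in sequentially. F n t = (f t)\<^sup>2"
        by eventually_elim (auto simp: F_def S_def)
    qed
    have "integral {0<..<L} (F n) = integral (S n) (\<lambda>t. (f t)\<^sup>2)" for n
      unfolding F_def by (subst integral_restrict_Int) (simp add: Int[of n])
    moreover have "0 \<le> integral (S n) (\<lambda>t. (f t)\<^sup>2)" for n
      by (rule integral_nonneg[OF Sint]) simp
    moreover have "integral (S n) (\<lambda>t. (f t)\<^sup>2) \<le> C" for n
      unfolding S_def by (rule bd) (use x[of n] in auto)
    ultimately show "bounded (range (\<lambda>n. integral {0<..<L} (F n)))"
      by (auto simp: bounded_iff intro!: exI[of _ C])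
  qed
  then show ?thesis
    using meas by (simp add: sq_integrable_def integrable_on_open_interval_real)
qed

text \<open>With \<open>P = p (v t)\<close> and \<open>Q = g t + c\<close>, use
  \<open>P^2 \<le> P^2 + (P + Q)^2 = 2 P (P + Q) + Q^2\<close>. After weighting by
  \<open>\<beta> * A\<close>, which is at least 1, the mixed term is \<open>p (v) * slope\<close>
  and integrates to a difference of potentials, bounded uniformly in \<open>x\<close> and
  \<open>y\<close> once \<open>v\<close> is.\<close>

lemma primitive_p_sq_bound:
  assumes prim: "primitive_on x y v (slope c v)" and xy: "0 < x" "x < y" "y < L"
    and pos: "\<And>t. t \<in> {x..y} \<Longrightarrow> 0 < v t"
  shows "integral {x..y} (\<lambda>t. (p (v t))\<^sup>2) \<le>
     2 * \<beta> * (potential (v y) - potential (v x)) + \<beta> / \<alpha> * integral {0..L} (\<lambda>t. (g t + c)\<^sup>2)"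
    and "(\<lambda>t. (p (v t))\<^sup>2) integrable_on {x..y}"
proof -
  have cont: "continuous_on {x..y} (\<lambda>t. p (v t))"
    by (rule continuous_on_compose2[OF p_cont primitive_on_continuous[OF prim]]) (use pos in auto)
  show int: "(\<lambda>t. (p (v t))\<^sup>2) integrable_on {x..y}"
    by (intro integrable_continuous_real continuous_intros cont)
  have "sq_integrable 0 L (\<lambda>t. g t + c)"
    by (intro sq_integrable_add g_sq sq_integrable_const)
  then have gint: "(\<lambda>t. (g t + c)\<^sup>2) integrable_on {0..L}"
    by (simp add: sq_integrable_def)
  have gint': "(\<lambda>t. (g t + c)\<^sup>2) integrable_on {x..y}"
    by (rule integrable_on_subinterval[OF gint]) (use xy in auto)
  have "integral {x..y} (\<lambda>t. (p (v t))\<^sup>2) \<le>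
      integral {x..y} (\<lambda>t. 2 * \<beta> * (p (v t) * slope c v t) + \<beta> / \<alpha> * (g t + c)\<^sup>2)"
  proof (rule integral_le[OF int])
    show "(\<lambda>t. 2 * \<beta> * (p (v t) * slope c v t) + \<beta> / \<alpha> * (g t + c)\<^sup>2) integrable_on {x..y}"
      by (intro integrable_add integrable_on_mult_right gint' energy_interval(2)[OF prim pos]) (use xy in auto)
    fix t
    define P Q where "P = p (v t)" and "Q = g t + c"
    have 1: "1 \<le> \<beta> * A t" using A_lower[of t] \<beta>_pos by (simp add: field_simps)
    have 2: "\<beta> * A t \<le> \<beta> / \<alpha>" using mult_left_mono[OF A_upper[of t], of \<beta>] \<beta>_pos by simp
    have "P\<^sup>2 \<le> \<beta> * A t * P\<^sup>2" using mult_right_mono[OF 1, of "P\<^sup>2"] by simp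
    also have "\<dots> \<le> \<beta> * A t * P\<^sup>2 + \<beta> * A t * (P + Q)\<^sup>2"
      using \<beta>_pos A_pos[of t] by simp
    also have "\<dots> = 2 * \<beta> * (P * ((P + Q) * A t)) + \<beta> * A t * Q\<^sup>2"
      by (simp add: power2_eq_square algebra_simps)
    also have "\<dots> \<le> 2 * \<beta> * (P * ((P + Q) * A t)) + \<beta> / \<alpha> * Q\<^sup>2"
      using mult_right_mono[OF 2, of "Q\<^sup>2"] by simp
    finally show "(p (v t))\<^sup>2 \<le> 2 * \<beta> * (p (v t) * slope c v t) + \<beta> / \<alpha> * (g t + c)\<^sup>2"
      by (simp add: P_def Q_def slope_def add.assoc)
  qed
  also have "\<dots> = 2 * \<beta> * integral {x..y} (\<lambda>t. p (v t) * slope c v t) + \<beta> / \<alpha> * integral {x..y} (\<lambda>t. (g t + c)\<^sup>2)"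
    using xy gint' energy_interval(2)[OF prim pos]
    by (subst integral_add) (auto intro!: integrable_on_mult_right simp only: integral_mult_right)
  also have "integral {x..y} (\<lambda>t. p (v t) * slope c v t) = potential (v y) - potential (v x)"
    by (rule energy_interval(1)[OF prim pos]) (use xy in auto)
  also have "\<beta> / \<alpha> * integral {x..y} (\<lambda>t. (g t + c)\<^sup>2) \<le> \<beta> / \<alpha> * integral {0..L} (\<lambda>t. (g t + c)\<^sup>2)"
    using xy gint gint' \<alpha>_pos \<beta>_pos by (intro mult_left_mono integral_subset_le) auto
  finally show "integral {x..y} (\<lambda>t. (p (v t))\<^sup>2) \<le>
     2 * \<beta> * (potential (v y) - potential (v x)) + \<beta> / \<alpha> * integral {0..L} (\<lambda>t. (g t + c)\<^sup>2)" by simp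
qed

text \<open>The majorant \<open>p (kap * t)\<close> does not reach \<open>L\<close>, because
  \<open>kap\<close> depends on \<open>x0\<close>. Integrability up to \<open>L\<close> comes from
  the energy estimate instead, and \<open>u0\<close> forces the limit to vanish at
  \<open>L\<close>.\<close>

lemma sol_exists_below:
  assumes u0: "sol c0 u0" and c: "c \<le> c0"
  shows "\<exists>u. sol c u"
proof -
  obtain vs where vs: "\<And>n. approx_sol c n (vs n)"
    using approx_sol_exists by metis
  \<comment> \<open>The approximations need not vanish at \<open>L\<close>, so the value there is
    prescribed; continuity at \<open>L\<close> follows from
    \<open>0 \<le> v \<le> u0\<close>.\<close>
  define v where "v = (\<lambda>x. if x < L then lim (\<lambda>n. vs n x) else 0)"
  have lim: "(\<lambda>n. vs n x) \<longlonglongrightarrow> v x" if "0 \<le> x" "x < L" for x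
  proof -
    have "convergent (\<lambda>n. vs n x)"
    proof (rule Bseq_mono_convergent)
      have inc: "vs k x \<le> vs n x" if "k \<le> n" for k n
        using approx_sol_mono[OF vs vs that, of x] \<open>0 \<le> x\<close> \<open>x < L\<close> by simp
      then show "\<forall>k n. k \<le> n \<longrightarrow> vs k x \<le> vs n x" by blast
      have "\<bar>vs n x\<bar> \<le> \<bar>vs 0 x\<bar> + \<bar>u0 x\<bar>" for n
        using inc[of 0 n] approx_sol_le_sol[OF vs u0 c, of x n] that by auto
      then show "Bseq (\<lambda>n. vs n x)" by (intro BseqI') auto
    qed
    then show ?thesis using that by (simp add: v_def convergent_LIMSEQ_iff)
  qed
  have prim: "primitive_on 0 x0 v (slope c v)" if "0 < x0" "x0 < L" for x0
    using approx_sol_limit(1)[of c vs v x0] vs lim that by blast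
  have pos: "0 < v x" if "0 < x" "x < L" for x
    using approx_sol_limit(2)[of c vs v x x] vs lim that by blast
  have v0: "v 0 = 0"
  proof (rule LIMSEQ_unique[OF lim])
    show "(\<lambda>n. vs n 0) \<longlonglongrightarrow> 0" using vs by (simp add: approx_sol_def)
  qed (use L_pos in auto)
  have vL: "v L = 0" by (simp add: v_def)
  have le: "v x \<le> u0 x" if "0 \<le> x" "x \<le> L" for x
  proof (cases "x = L")
    case False
    then show ?thesis
      using approx_sol_le_sol[OF vs u0 c, of x] that by (intro LIMSEQ_le_const2[OF lim]) auto
  qed (use vL solD(3)[OF u0] in simp)
  have cont_int: "continuous (at x within {0..L}) v" if x: "0 \<le> x" "x < L" for x
  proof -
    define x0 where "x0 = (x + L) / 2"
    have x0: "0 < x0" "x0 < L" "x < x0" using x by (auto simp: x0_def)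
    have "continuous (at x within {0..x0}) v"
      using primitive_on_continuous[OF prim[OF x0(1,2)]] x x0
      unfolding continuous_on_eq_continuous_within by simp
    moreover have "at x within {0..L} = at x within {0..x0}"
      by (rule at_within_nhd[of _ "{..<x0}"]) (use x x0 in auto)
    ultimately show ?thesis by simp
  qed
  have cont_L: "continuous (at L within {0..L}) v"
    unfolding continuous_within vL
  proof (rule tendsto_sandwich)
    show "((\<lambda>_. 0) \<longlongrightarrow> 0) (at L within {0..L})" by simp
    show "(u0 \<longlongrightarrow> 0) (at L within {0..L})"
      using solD(6)[OF u0] solD(3)[OF u0] L_pos by (metis atLeastAtMost_iff continuous_on_def less_imp_le order_refl)
    have "0 \<le> v x" if "x \<in> {0..L}" for x
      using pos[of x] v0 vL that by (cases "x = 0 \<or> x = L") auto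
    then show "\<forall>\<^sub>F x in at L within {0..L}. 0 \<le> v x"
      by (simp add: eventually_at_filter)
    show "\<forall>\<^sub>F x in at L within {0..L}. v x \<le> u0 x"
      using le by (simp add: eventually_at_filter)
  qed
  have cont: "continuous_on {0..L} v"
    unfolding continuous_on_eq_continuous_within
    using cont_int cont_L by (metis atLeastAtMost_iff order_le_less)
  obtain B where B: "\<And>x. x \<in> {0..L} \<Longrightarrow> \<bar>potential (v x)\<bar> \<le> B"
  proof -
    obtain M where M: "\<And>x. x \<in> {0..L} \<Longrightarrow> \<bar>v x\<bar> \<le> M"
      using compact_imp_bounded[OF compact_continuous_image[OF cont compact_Icc]] by (force simp: bounded_iff)
    obtain B where "\<And>s. s \<in> {0..M} \<Longrightarrow> \<bar>potential s\<bar> \<le> B"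
      using compact_imp_bounded[OF compact_continuous_image[OF continuous_on_potential compact_Icc]]
      by (force simp: bounded_iff)
    moreover have "v x \<in> {0..M}" if "x \<in> {0..L}" for x
      using M[OF that] pos[of x] v0 vL that by (cases "x = 0 \<or> x = L") auto
    ultimately show ?thesis using that by blast
  qed
  have sq: "sq_integrable 0 L (\<lambda>t. p (v t))"
  proof (rule sq_integrable_from_interior[OF p_comp_measurable[OF cont]])
    fix x y assume xy: "0 < x" "x < y" "y < L"
    have prim': "primitive_on x y v (slope c v)"
      by (rule primitive_on_subset[OF prim[of y]]) (use xy in auto)
    have pos': "0 < v t" if "t \<in> {x..y}" for t using pos[of t] that xy by simp
    show "(\<lambda>t. (p (v t))\<^sup>2) integrable_on {x..y}"
      by (rule primitive_p_sq_bound(2)[OF prim' xy pos'])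
    have "2 * \<beta> * (potential (v y) - potential (v x)) \<le> 2 * \<beta> * (2 * B)"
      using B[of x] B[of y] xy \<beta>_pos by (intro mult_left_mono) auto
    then show "integral {x..y} (\<lambda>t. (p (v t))\<^sup>2) \<le>
       2 * \<beta> * (2 * B) + \<beta> / \<alpha> * integral {0..L} (\<lambda>t. (g t + c)\<^sup>2)"
      using primitive_p_sq_bound(1)[OF prim' xy pos'] by linarith
  qed
  have h: "slope c v absolutely_integrable_on {0..L}"
    by (rule sq_integrable_abs_integrable[OF sq_integrable_slope[OF sq]])
  then have h': "slope c v integrable_on {0..L}"
    using absolutely_integrable_on_def by blast
  \<comment> \<open>The identity is known for \<open>x < L\<close>; both terms are continuous on
    \<open>[0,L]\<close>, so it extends to \<open>L\<close>.\<close>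
  have "v x - integral {0..x} (slope c v) = 0" if "x \<in> {0..L}" for x
  proof (rule continuous_constant_on_closure[where S = "{0<..<L}" and f = "\<lambda>x. v x - integral {0..x} (slope c v)"])
    show "continuous_on (closure {0<..<L}) (\<lambda>x. v x - integral {0..x} (slope c v))"
      using L_pos cont indefinite_integral_continuous_1[OF h'] by (simp add: continuous_on_diff)
    show "v x - integral {0..x} (slope c v) = 0" if "x \<in> {0<..<L}" for x
      using primitive_onD(3)[OF prim[of x], of 0 x] that v0 by simp
    show "x \<in> closure {0<..<L}" using that L_pos by simp
  qed
  then have "primitive_on 0 L v (slope c v)"
    using v0 by (intro primitive_onI h) simp
  then have "sol c v"
    using pos v0 vL sq by (auto simp: sol_def)
  then show ?thesis by blast
qed

end

section \<open>Dense classes of square-integrable functions\<close>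

text \<open>Measurability supplies continuous functions converging almost everywhere; truncating
  them at \<open>K\<close> keeps them continuous and gives a constant majorant.\<close>

lemma continuous_L2_approximation:
  fixes z :: "real \<Rightarrow> real"
  assumes z: "sq_integrable a b z" and zK: "\<And>x. \<bar>z x\<bar> \<le> K" and "eps > 0"
  obtains y where "continuous_on UNIV y" "integral {a..b} (\<lambda>x. (z x - y x)\<^sup>2) < eps"
proof -
  have K: "0 \<le> K" using zK[of 0] by simp
  have "z measurable_on {a..b}"
    using z by (simp add: sq_integrable_def measurable_on_iff_borel_measurable)
  then obtain N g where N: "negligible N" and g: "\<And>n::nat. continuous_on UNIV (g n)"
    and lim: "\<And>x. x \<notin> N \<Longrightarrow> (\<lambda>n. g n x) \<longlonglongrightarrow> (if x \<in> {a..b} then z x else 0)"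
    unfolding measurable_on_def by blast
  define y where "y = (\<lambda>n x. max (- K) (min K (g n x)))"
  have y: "continuous_on UNIV (y n)" for n
    unfolding y_def by (intro continuous_intros g)
  have yK: "\<bar>y n x\<bar> \<le> K" for n x using K by (auto simp: y_def)
  define f where "f = (\<lambda>n x. if x \<in> N then 0 else (z x - y n x)\<^sup>2)"
  have "(\<lambda>n. integral {a..b} (f n)) \<longlonglongrightarrow> integral {a..b} (\<lambda>_. 0)"
  proof (rule dominated_convergence(2))
    fix n
    have "sq_integrable a b (\<lambda>x. z x - y n x)"
      by (intro sq_integrable_diff z sq_integrable_continuous continuous_on_subset[OF y]) auto
    then have "(\<lambda>x. (z x - y n x)\<^sup>2) integrable_on {a..b}" by (simp add: sq_integrable_def)
    then show "f n integrable_on {a..b}"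
      by (rule integrable_spike[OF _ N]) (simp add: f_def)
  next
    show "(\<lambda>_. (2 * K)\<^sup>2) integrable_on {a..b}" by auto
    fix n x
    have "\<bar>z x - y n x\<bar> \<le> \<bar>2 * K\<bar>" using zK[of x] yK[of n x] by linarith
    then have "(z x - y n x)\<^sup>2 \<le> (2 * K)\<^sup>2" by (simp only: abs_le_square_iff)
    then show "norm (f n x) \<le> (2 * K)\<^sup>2" by (simp add: f_def)
  next
    fix x assume x: "x \<in> {a..b}"
    show "(\<lambda>n. f n x) \<longlonglongrightarrow> 0"
    proof (cases "x \<in> N")
      case False
      have "(\<lambda>n. (z x - y n x)\<^sup>2) \<longlonglongrightarrow> (z x - max (- K) (min K (z x)))\<^sup>2"
        unfolding y_def using lim[OF False] x by (intro tendsto_intros) auto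
      then show ?thesis using False zK[of x] by (simp add: f_def abs_le_iff min_absorb2 max_absorb2)
    qed (simp add: f_def)
  qed
  then have "\<forall>\<^sub>F n in sequentially. integral {a..b} (f n) < eps"
    using \<open>eps > 0\<close> by (intro order_tendstoD(2)[where y = 0]) auto
  then obtain n where n: "integral {a..b} (f n) < eps"
    unfolding eventually_sequentially by blast
  have "integral {a..b} (\<lambda>x. (z x - y n x)\<^sup>2) = integral {a..b} (f n)"
    by (rule integral_spike[OF N]) (simp add: f_def)
  with n show ?thesis by (intro that[OF y[of n]]) simp
qed

lemma truncation_L2_approximation:
  fixes z :: "real \<Rightarrow> real"
  assumes z: "sq_integrable a b z" and "eps > 0"
  obtains K :: real where "K \<ge> 0" "integral {a..b} (\<lambda>x. (z x - max (- K) (min K (z x)))\<^sup>2) < eps"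
    "sq_integrable a b (\<lambda>x. max (- K) (min K (z x)))"
proof -
  define y where "y = (\<lambda>(n::nat) x. max (- real n) (min (real n) (z x)))"
  have ysq: "sq_integrable a b (y n)" for n
  proof (rule sq_integrable_bound[OF _ z])
    show "y n \<in> borel_measurable (lebesgue_on {a..b})"
      unfolding y_def using sq_integrable_measurable[OF z]
      by (intro borel_measurable_max borel_measurable_min) auto
  qed (auto simp: y_def)
  have "(\<lambda>n. integral {a..b} (\<lambda>x. (z x - y n x)\<^sup>2)) \<longlonglongrightarrow> integral {a..b} (\<lambda>_. 0)"
  proof (rule dominated_convergence(2))
    show "(\<lambda>x. (z x - y n x)\<^sup>2) integrable_on {a..b}" for n
      using sq_integrable_diff[OF z ysq] by (simp add: sq_integrable_def)
    show "(\<lambda>x. (z x)\<^sup>2) integrable_on {a..b}" using z by (simp add: sq_integrable_def)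
    show "norm ((z x - y n x)\<^sup>2) \<le> (z x)\<^sup>2" for n x
    proof -
      have "\<bar>z x - y n x\<bar> \<le> \<bar>z x\<bar>" by (auto simp: y_def)
      then show ?thesis by (simp add: abs_le_square_iff)
    qed
    fix x
    obtain k :: nat where k: "\<bar>z x\<bar> \<le> real k" using real_arch_simple by blast
    have "(z x - y n x)\<^sup>2 = 0" if "k \<le> n" for n
    proof -
      have "\<bar>z x\<bar> \<le> real n" using k that by simp
      then show ?thesis by (simp add: y_def abs_le_iff min_absorb2 max_absorb2)
    qed
    then show "(\<lambda>n. (z x - y n x)\<^sup>2) \<longlonglongrightarrow> 0"
      by (intro tendsto_eventually) (auto simp: eventually_sequentially intro!: exI[of _ k])
  qed
  then have "\<forall>\<^sub>F n in sequentially. integral {a..b} (\<lambda>x. (z x - y n x)\<^sup>2) < eps"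
    using \<open>eps > 0\<close> by (intro order_tendstoD(2)[where y = 0]) auto
  then obtain n where "integral {a..b} (\<lambda>x. (z x - y n x)\<^sup>2) < eps"
    unfolding eventually_sequentially by blast
  with ysq[of n] show ?thesis by (intro that[of "real n"]) (auto simp: y_def)
qed

lemma C1_L2_approximation:
  fixes z :: "real \<Rightarrow> real"
  assumes z: "sq_integrable a b z" and ab: "a < b" and "eps > 0"
  obtains P P' where "\<And>x. (P has_real_derivative P' x) (at x)" "continuous_on UNIV P'"
    "integral {a..b} (\<lambda>x. (z x - P x)\<^sup>2) < eps"
proof -
  \<comment> \<open>Three errors (truncation, continuous, polynomial) of \<open>eps / 9\<close>
    each; the square of a three-term sum costs a factor 3.\<close>
  have "eps / 9 > 0" using \<open>eps > 0\<close> by simp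
  obtain K where K: "K \<ge> 0" "integral {a..b} (\<lambda>x. (z x - max (- K) (min K (z x)))\<^sup>2) < eps / 9"
    "sq_integrable a b (\<lambda>x. max (- K) (min K (z x)))"
    using truncation_L2_approximation[OF z \<open>eps / 9 > 0\<close>] by blast
  define zK where "zK = (\<lambda>x. max (- K) (min K (z x)))"
  have "\<bar>zK x\<bar> \<le> K" for x using K(1) by (auto simp: zK_def)
  then obtain y where y: "continuous_on UNIV y" "integral {a..b} (\<lambda>x. (zK x - y x)\<^sup>2) < eps / 9"
    using continuous_L2_approximation[of a b zK K "eps / 9"] K(3) \<open>eps / 9 > 0\<close> unfolding zK_def by blast
  \<comment> \<open>The uniform accuracy whose squared \<open>L^2\<close> contribution over
    \<open>[a,b]\<close> is exactly \<open>eps / 9\<close>.\<close>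
  define d where "d = sqrt (eps / 9 / (b - a))"
  have "d > 0" using ab \<open>eps > 0\<close> by (simp add: d_def)
  have d2: "d\<^sup>2 * (b - a) = eps / 9"
  proof -
    have cancel: "eps / 9 / r * r = eps / 9" if "r > 0" for r :: real using that by simp
    have "d\<^sup>2 = eps / 9 / (b - a)" using ab \<open>eps > 0\<close> by (simp add: d_def)
    then show ?thesis using cancel[of "b - a"] ab by simp
  qed
  obtain P where P: "real_polynomial_function P" "\<And>x. x \<in> {a..b} \<Longrightarrow> \<bar>y x - P x\<bar> < d"
    using Stone_Weierstrass_real_polynomial_function[OF compact_Icc continuous_on_subset[OF y(1) subset_UNIV] \<open>d > 0\<close>]
    by blast
  obtain P' where P': "polynomial_function P'" "\<And>x. (P has_real_derivative P' x) (at x)"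
    using has_real_derivative_polynomial_function P(1) real_polynomial_function_eq by blast
  have contP: "continuous_on UNIV P"
    using P'(2) DERIV_isCont continuous_at_imp_continuous_on by blast
  have sq: "sq_integrable a b (\<lambda>x. z x - zK x)" "sq_integrable a b (\<lambda>x. zK x - y x)"
    "sq_integrable a b (\<lambda>x. y x - P x)" "sq_integrable a b (\<lambda>x. z x - P x)"
    unfolding zK_def
    using z K(3) sq_integrable_continuous[OF continuous_on_subset[OF y(1) subset_UNIV], of a b]
      sq_integrable_continuous[OF continuous_on_subset[OF contP subset_UNIV], of a b]
    by (simp_all add: sq_integrable_diff)
  then have int: "(\<lambda>x. (z x - zK x)\<^sup>2) integrable_on {a..b}" "(\<lambda>x. (zK x - y x)\<^sup>2) integrable_on {a..b}"
    "(\<lambda>x. (y x - P x)\<^sup>2) integrable_on {a..b}" "(\<lambda>x. (z x - P x)\<^sup>2) integrable_on {a..b}"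
    by (simp_all add: sq_integrable_def)
  have "integral {a..b} (\<lambda>x. (y x - P x)\<^sup>2) \<le> integral {a..b} (\<lambda>_. d\<^sup>2)"
  proof (rule integral_le[OF int(3)])
    show "(y x - P x)\<^sup>2 \<le> d\<^sup>2" if "x \<in> {a..b}" for x
      using P(2)[OF that] \<open>d > 0\<close> by (simp add: abs_le_square_iff[symmetric])
  qed auto
  also have "\<dots> = eps / 9" using ab d2 by (simp add: mult.commute)
  finally have 3: "integral {a..b} (\<lambda>x. (y x - P x)\<^sup>2) \<le> eps / 9" .
  have three: "(r + s + t)\<^sup>2 \<le> 3 * (r\<^sup>2 + s\<^sup>2 + t\<^sup>2)" for r s t :: real
  proof -
    have "0 \<le> (r - s)\<^sup>2 + (r - t)\<^sup>2 + (s - t)\<^sup>2" by simp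
    then show ?thesis by (simp add: power2_eq_square algebra_simps)
  qed
  have "integral {a..b} (\<lambda>x. (z x - P x)\<^sup>2) \<le>
      integral {a..b} (\<lambda>x. 3 * ((z x - zK x)\<^sup>2 + (zK x - y x)\<^sup>2 + (y x - P x)\<^sup>2))"
  proof (rule integral_le[OF int(4)])
    show "(\<lambda>x. 3 * ((z x - zK x)\<^sup>2 + (zK x - y x)\<^sup>2 + (y x - P x)\<^sup>2)) integrable_on {a..b}"
      by (intro integrable_on_mult_right integrable_add int)
    show "(z x - P x)\<^sup>2 \<le> 3 * ((z x - zK x)\<^sup>2 + (zK x - y x)\<^sup>2 + (y x - P x)\<^sup>2)" for x
      using three[of "z x - zK x" "zK x - y x" "y x - P x"] by simp
  qed
  also have "\<dots> = 3 * integral {a..b} (\<lambda>x. (z x - zK x)\<^sup>2 + (zK x - y x)\<^sup>2 + (y x - P x)\<^sup>2)"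
    by (rule integral_mult_right)
  also have "integral {a..b} (\<lambda>x. (z x - zK x)\<^sup>2 + (zK x - y x)\<^sup>2 + (y x - P x)\<^sup>2) =
     integral {a..b} (\<lambda>x. (z x - zK x)\<^sup>2 + (zK x - y x)\<^sup>2) + integral {a..b} (\<lambda>x. (y x - P x)\<^sup>2)"
    by (intro integral_add integrable_add int)
  also have "integral {a..b} (\<lambda>x. (z x - zK x)\<^sup>2 + (zK x - y x)\<^sup>2) =
     integral {a..b} (\<lambda>x. (z x - zK x)\<^sup>2) + integral {a..b} (\<lambda>x. (zK x - y x)\<^sup>2)"
    by (intro integral_add int)
  finally have "integral {a..b} (\<lambda>x. (z x - P x)\<^sup>2) < eps"
    using K(2) y(2) 3 \<open>eps > 0\<close> by (simp add: zK_def)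
  then show ?thesis
    using P' that continuous_on_polymonial_function by blast
qed

section \<open>Dependence of the solution on the parameter\<close>

context singular_problem
begin


text \<open>Solutions with larger parameter lie above \<open>ul\<close>, hence have smaller
  \<open>p\<close>. Thus a single solution gives a square-integrable majorant for all parameters
  above its own; at the endpoints both sides use the same default value of \<open>p\<close>.\<close>

lemma sol_p_bound:
  assumes ul: "sol cl ul" and u: "sol c u" and c: "cl \<le> c" and x: "x \<in> {0..L}"
  shows "\<bar>p (u x)\<bar> \<le> \<bar>p (ul x)\<bar> + \<bar>m\<bar>"
proof -
  have "p (u x) \<le> p (ul x)"
  proof (cases "x = 0 \<or> x = L")
    case False
    with x show ?thesis
      by (intro p_antimono solD(1)[OF ul] sol_mono[OF ul u c]) auto
  qed (use solD(2,3)[OF u] solD(2,3)[OF ul] in auto)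
  with p_lower[of "u x"] show ?thesis by linarith
qed

lemma slope_bound:
  assumes "sol cl ul" "sol c u" "cl \<le> c" "x \<in> {0..L}" "\<bar>c\<bar> \<le> C"
  shows "\<bar>slope c u x\<bar> \<le> (\<bar>p (ul x)\<bar> + \<bar>m\<bar> + \<bar>g x\<bar> + C) / \<alpha>"
proof -
  have "\<bar>slope c u x\<bar> = \<bar>p (u x) + g x + c\<bar> * A x"
    using A_pos[of x] by (simp add: slope_def abs_mult)
  also have "\<dots> \<le> (\<bar>p (ul x)\<bar> + \<bar>m\<bar> + \<bar>g x\<bar> + C) * A x"
    using sol_p_bound[OF assms(1-4)] assms(5) A_pos[of x] by (intro mult_right_mono) auto
  also have "\<dots> \<le> (\<bar>p (ul x)\<bar> + \<bar>m\<bar> + \<bar>g x\<bar> + C) / \<alpha>"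
    using assms(5) by (intro mult_A_le) auto
  finally show ?thesis .
qed

lemma sq_integrable_slope_bound:
  assumes "sol cl ul"
  shows "sq_integrable 0 L (\<lambda>x. (\<bar>p (ul x)\<bar> + \<bar>m\<bar> + \<bar>g x\<bar> + C) / \<alpha>)"
proof -
  have "sq_integrable 0 L (\<lambda>x. 1 / \<alpha> * (\<bar>p (ul x)\<bar> + \<bar>m\<bar> + \<bar>g x\<bar> + C))"
    by (intro sq_integrable_scale sq_integrable_add sq_integrable_const sq_integrable_abs g_sq
        solD(4)[OF assms])
  then show ?thesis by simp
qed

text \<open>Dominated convergence with the majorant from \<open>ul\<close>. The first claim closes
  the set of solvable parameters at the top, the second gives weak continuity of the
  derivatives.\<close>

lemma sol_limit:
  assumes sols: "\<And>n. sol (cs n) (us n)" and ul: "sol cl ul" and cl: "\<And>n. cl \<le> cs n"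
    and clim: "cs \<longlonglongrightarrow> c" and ulim: "\<And>x. x \<in> {0..L} \<Longrightarrow> (\<lambda>n. us n x) \<longlonglongrightarrow> u x"
    and z: "sq_integrable 0 L z"
  shows "sol c u" and "(\<lambda>n. integral {0..L} (\<lambda>t. slope (cs n) (us n) t * z t)) \<longlonglongrightarrow>
     integral {0..L} (\<lambda>t. slope c u t * z t)"
proof -
  have u0: "u 0 = 0" and uL: "u L = 0"
    using ulim[of 0] ulim[of L] solD(2,3)[OF sols] L_pos by (simp_all add: LIMSEQ_const_iff)
  have lim_ge: "ul x \<le> u x" if "x \<in> {0..L}" for x
    by (rule LIMSEQ_le_const[OF ulim[OF that]]) (use sol_mono[OF ul sols cl that] in auto)
  have pos: "0 < u x" if "0 < x" "x < L" for x
    using lim_ge[of x] solD(1)[OF ul that] that by simp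
  have plim: "(\<lambda>n. p (us n x)) \<longlonglongrightarrow> p (u x)" if "x \<in> {0..L}" for x
  proof (cases "x = 0 \<or> x = L")
    case True
    then have "(\<lambda>n. p (us n x)) = (\<lambda>_. p (u x))"
      using solD(2,3)[OF sols] u0 uL by (auto simp: fun_eq_iff)
    then show ?thesis by simp
  next
    case False
    then show ?thesis
      using that by (intro isCont_tendsto_compose[OF p_isCont ulim] pos) auto
  qed
  have slim: "(\<lambda>n. slope (cs n) (us n) x) \<longlonglongrightarrow> slope c u x" if "x \<in> {0..L}" for x
    unfolding slope_def by (intro tendsto_intros plim that clim)
  obtain C where C: "\<And>n. \<bar>cs n\<bar> \<le> C"
    using convergent_imp_Bseq[OF convergentI[OF clim]] unfolding Bseq_def by auto
  define b where "b = (\<lambda>x. (\<bar>p (ul x)\<bar> + \<bar>m\<bar> + \<bar>g x\<bar> + C) / \<alpha>)"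
  have bsq: "sq_integrable 0 L b"
    unfolding b_def by (rule sq_integrable_slope_bound[OF ul])
  have bound: "\<bar>slope (cs n) (us n) x\<bar> \<le> b x" if "x \<in> {0..L}" for n x
    unfolding b_def by (rule slope_bound[OF ul sols cl that C])
  have bint: "b integrable_on {0..L}"
    using sq_integrable_abs_integrable[OF bsq] absolutely_integrable_on_def by blast
  have eq: "u x = integral {0..x} (slope c u)" "slope c u integrable_on {0..x}" if x: "x \<in> {0..L}" for x
  proof -
    have 1: "slope (cs n) (us n) integrable_on {0..x}" for n
      by (rule integrable_on_subinterval[OF primitive_onD(2)[OF solD(5)[OF sols]]]) (use x in auto)
    have 2: "b integrable_on {0..x}"
      by (rule integrable_on_subinterval[OF bint]) (use x in auto)
    have 3: "norm (slope (cs n) (us n) t) \<le> b t" if "t \<in> {0..x}" for n t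
      using bound[of t n] that x by simp
    have 4: "(\<lambda>n. slope (cs n) (us n) t) \<longlonglongrightarrow> slope c u t" if "t \<in> {0..x}" for t
      using slim[of t] that x by simp
    show "slope c u integrable_on {0..x}"
      by (rule dominated_convergence(1)[OF 1 2 3 4])
    have "us n x = integral {0..x} (slope (cs n) (us n))" for n
      using primitive_onD(3)[OF solD(5)[OF sols], of 0 x n] x solD(2)[OF sols, of n] by simp
    then have "(\<lambda>n. us n x) \<longlonglongrightarrow> integral {0..x} (slope c u)"
      using dominated_convergence(2)[OF 1 2 3 4] by simp
    then show "u x = integral {0..x} (slope c u)"
      using ulim[OF x] LIMSEQ_unique by blast
  qed
  have cont: "continuous_on {0..L} u"
    using indefinite_integral_continuous_1[OF eq(2)[of L]] eq(1) L_pos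
    by (subst continuous_on_cong[OF refl eq(1)]) auto
  have psq: "sq_integrable 0 L (\<lambda>x. p (u x))"
  proof (rule sq_integrable_bound[OF p_comp_measurable[OF cont]])
    show "sq_integrable 0 L (\<lambda>x. \<bar>p (ul x)\<bar> + \<bar>m\<bar>)"
      by (intro sq_integrable_add sq_integrable_abs sq_integrable_const solD(4)[OF ul])
    fix x assume x: "x \<in> {0..L}"
    have "\<bar>p (u x)\<bar> \<le> \<bar>p (ul x)\<bar> + \<bar>m\<bar>"
      by (rule LIMSEQ_le_const2[OF tendsto_rabs[OF plim[OF x]]]) (use sol_p_bound[OF ul sols cl x] in auto)
    then show "\<bar>p (u x)\<bar> \<le> \<bar>\<bar>p (ul x)\<bar> + \<bar>m\<bar>\<bar>" by simp
  qed
  have "primitive_on 0 L u (slope c u)"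
    by (intro primitive_onI sq_integrable_abs_integrable sq_integrable_slope psq) (use eq(1) u0 in auto)
  then show "sol c u"
    using pos u0 uL psq by (auto simp: sol_def)
  show "(\<lambda>n. integral {0..L} (\<lambda>t. slope (cs n) (us n) t * z t)) \<longlonglongrightarrow> integral {0..L} (\<lambda>t. slope c u t * z t)"
  proof (rule dominated_convergence(2))
    show "(\<lambda>t. slope (cs n) (us n) t * z t) integrable_on {0..L}" for n
      by (rule sq_integrable_mult_on[OF sq_integrable_slope[OF solD(4)[OF sols]] z])
    show "(\<lambda>t. b t * \<bar>z t\<bar>) integrable_on {0..L}"
      by (rule sq_integrable_mult_on[OF bsq sq_integrable_abs[OF z]])
    show "norm (slope (cs n) (us n) t * z t) \<le> b t * \<bar>z t\<bar>" if "t \<in> {0..L}" for n t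
      using bound[OF that, of n] by (simp add: abs_mult mult_right_mono)
    show "(\<lambda>n. slope (cs n) (us n) t * z t) \<longlonglongrightarrow> slope c u t * z t" if "t \<in> {0..L}" for t
      by (intro tendsto_intros slim that)
  qed
qed

lemma sol_abs_diff:
  assumes u1: "sol c1 u1" and u2: "sol c2 u2" and x: "x \<in> {0..L}"
  shows "\<bar>u1 x - u2 x\<bar> \<le> \<bar>c1 - c2\<bar> / \<alpha> * L"
proof -
  have *: "\<bar>u1 x - u2 x\<bar> \<le> \<bar>c1 - c2\<bar> / \<alpha> * L"
    if "sol c1 u1" "sol c2 u2" "c1 \<le> c2" for c1 c2 u1 u2
  proof -
    have "(c2 - c1) / \<alpha> * x \<le> (c2 - c1) / \<alpha> * L"
      using that x \<alpha>_pos by (intro mult_left_mono) auto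
    then show ?thesis
      using sol_mono[OF that x] sol_Lipschitz[OF that x] that(3) by simp
  qed
  show ?thesis
    using *[OF u1 u2] *[OF u2 u1] by (cases "c1 \<le> c2") (auto simp: abs_minus_commute)
qed

text \<open>The solvable set is a lower set and bounded above. For parameters increasing to its
  supremum, the Lipschitz dependence makes the solutions a Cauchy sequence at each point, and
  \<open>sol_limit\<close> shows that the supremum is attained.\<close>

lemma sol_parameter_maximum:
  assumes "sol c0 u0"
  obtains cmax where "\<And>c. (\<exists>u. sol c u) \<longleftrightarrow> c \<le> cmax"
proof -
  define S where "S = {c. \<exists>u. sol c u}"
  define cmax where "cmax = Sup S"
  have ne: "c0 \<in> S" using assms by (auto simp: S_def)
  have bdd: "bdd_above S"
    using sol_parameter_bound[of _ _ m] p_lower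
    by (intro bdd_aboveI[of _ "(1 / sqrt L) * (\<beta> / \<alpha>) * sqrt (integral {0..L} (\<lambda>x. (g x)\<^sup>2)) - m"])
      (force simp: S_def)
  have below: "c \<in> S" if c: "c < cmax" for c
  proof -
    obtain c' where "c' \<in> S" "c < c'"
      using c ne bdd less_cSup_iff[of S c] unfolding cmax_def by auto
    then show ?thesis using sol_exists_below[of c' _ c] by (auto simp: S_def)
  qed
  define cs where "cs = (\<lambda>n::nat. cmax - inverse (real (Suc n)))"
  have clim: "cs \<longlonglongrightarrow> cmax"
    using tendsto_diff[OF tendsto_const LIMSEQ_inverse_real_of_nat, of cmax] by (simp add: cs_def)
  have "\<exists>u. sol (cs n) u" for n
    using below[of "cs n"] by (auto simp: cs_def S_def)
  then obtain us where us: "\<And>n. sol (cs n) (us n)" by metis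
  \<comment> \<open>\<open>cs 0\<close> is the lowest parameter of the sequence, so
    \<open>us 0\<close> can serve as \<open>ul\<close> in \<open>sol_limit\<close>.\<close>
  have "cs 0 \<le> cs n" for n
    using inverse_le_1_iff[of "real (Suc n)"] by (simp add: cs_def del: of_nat_Suc)
  note cs0 = this
  have "Cauchy (\<lambda>n. us n x)" if "x \<in> {0..L}" for x
  proof (rule metric_CauchyI)
    fix e :: real assume "e > 0"
    then have "e * \<alpha> / L > 0" using \<alpha>_pos L_pos by simp
    then obtain N where N: "\<And>n k. N \<le> n \<Longrightarrow> N \<le> k \<Longrightarrow> dist (cs n) (cs k) < e * \<alpha> / L"
      using LIMSEQ_imp_Cauchy[OF clim] unfolding Cauchy_def by blast
    have "dist (us n x) (us k x) < e" if "N \<le> n" "N \<le> k" for n k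
    proof -
      have "\<bar>cs n - cs k\<bar> / \<alpha> * L < e"
        using N[OF that] \<alpha>_pos L_pos by (simp add: dist_real_def field_simps)
      then show ?thesis
        using sol_abs_diff[OF us us \<open>x \<in> {0..L}\<close>, of n k] by (simp add: dist_real_def)
    qed
    then show "\<exists>N. \<forall>n\<ge>N. \<forall>k\<ge>N. dist (us n x) (us k x) < e" by blast
  qed
  then have ulim: "(\<lambda>n. us n x) \<longlonglongrightarrow> lim (\<lambda>n. us n x)" if "x \<in> {0..L}" for x
    using that Cauchy_convergent convergent_LIMSEQ_iff by blast
  have "sol cmax (\<lambda>x. lim (\<lambda>n. us n x))"
    by (rule sol_limit(1)[OF us us[of 0] cs0 clim ulim sq_integrable_const])
  then have max: "cmax \<in> S" by (auto simp: S_def)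
  have "(\<exists>u. sol c u) \<longleftrightarrow> c \<le> cmax" for c
    using below[of c] max cSup_upper[OF _ bdd, of c] by (auto simp: S_def cmax_def order_le_less)
  then show ?thesis by (rule that)
qed

text \<open>For \<open>z\<close> the weak derivative of \<open>w\<close>, the expression is the
  inner product of \<open>U c\<close> with \<open>w\<close> in \<open>H^1\<close>, so this is weak
  continuity tested on one vector.\<close>

lemma sol_family_continuous:
  assumes U: "\<And>c. c \<le> cmax \<Longrightarrow> sol c (U c)"
    and w: "sq_integrable 0 L w" and z: "sq_integrable 0 L z"
  shows "continuous_on {..cmax}
     (\<lambda>c. integral {0..L} (\<lambda>t. U c t * w t) + integral {0..L} (\<lambda>t. slope c (U c) t * z t))"
  unfolding continuous_on_sequentially
proof (intro allI ballI impI)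
  fix cs c assume c: "c \<in> {..cmax}" and "(\<forall>n. cs n \<in> {..cmax}) \<and> cs \<longlonglongrightarrow> c"
  then have cs: "\<And>n. cs n \<le> cmax" and clim: "cs \<longlonglongrightarrow> c" by auto
  obtain C where C: "\<And>n. \<bar>cs n\<bar> \<le> C"
    using convergent_imp_Bseq[OF convergentI[OF clim]] unfolding Bseq_def by auto
  \<comment> \<open>A solvable parameter below the whole sequence, which is bounded because it
    converges; \<open>U cl\<close> provides the majorant.\<close>
  define cl where "cl = min cmax (- C)"
  have cl: "cl \<le> cs n" for n using C[of n] by (simp add: cl_def min_le_iff_disj abs_le_iff)
  have ulim: "(\<lambda>n. U (cs n) x) \<longlonglongrightarrow> U c x" if "x \<in> {0..L}" for x
  proof -
    have cc: "c \<le> cmax" using c by simp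
    have bound: "norm (U (cs n) x - U c x) \<le> \<bar>cs n - c\<bar> / \<alpha> * L" for n
      unfolding real_norm_def by (rule sol_abs_diff[OF U[OF cs] U[OF cc] that])
    have "(\<lambda>n. \<bar>cs n - c\<bar> / \<alpha> * L) \<longlonglongrightarrow> \<bar>c - c\<bar> / \<alpha> * L"
      using \<alpha>_pos by (intro tendsto_intros clim) auto
    then have "(\<lambda>n. \<bar>cs n - c\<bar> / \<alpha> * L) \<longlonglongrightarrow> 0" by simp
    then have "(\<lambda>n. U (cs n) x - U c x) \<longlonglongrightarrow> 0"
      by (rule Lim_null_comparison[OF always_eventually[OF allI[OF bound]]])
    then show ?thesis by (simp add: LIM_zero_iff)
  qed
  have 1: "(\<lambda>n. integral {0..L} (\<lambda>t. slope (cs n) (U (cs n)) t * z t)) \<longlonglongrightarrow>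
     integral {0..L} (\<lambda>t. slope c (U c) t * z t)"
    by (rule sol_limit(2)[OF U[OF cs] U[of cl] cl clim ulim z]) (simp_all add: cl_def)
  have intw: "(\<lambda>t. U c t * w t) integrable_on {0..L}" if "c \<le> cmax" for c
    by (rule sq_integrable_mult_on[OF sq_integrable_continuous[OF solD(6)[OF U[OF that]]] w])
  have 2: "(\<lambda>n. integral {0..L} (\<lambda>t. U (cs n) t * w t)) \<longlonglongrightarrow> integral {0..L} (\<lambda>t. U c t * w t)"
  proof (rule dominated_convergence(2))
    show "(\<lambda>t. U (cs n) t * w t) integrable_on {0..L}" for n by (rule intw[OF cs])
    show "(\<lambda>t. \<bar>U cmax t\<bar> * \<bar>w t\<bar>) integrable_on {0..L}"
      by (rule sq_integrable_mult_on[OF sq_integrable_abs[OF sq_integrable_continuous[OF solD(6)[OF U[OF order_refl]]]]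
          sq_integrable_abs[OF w]])
    show "norm (U (cs n) t * w t) \<le> \<bar>U cmax t\<bar> * \<bar>w t\<bar>" if "t \<in> {0..L}" for n t
      using sol_mono[OF U[OF cs] U[OF order_refl] cs that, of n] sol_nonneg[OF U[OF cs] that, of n]
      by (simp add: abs_mult mult_right_mono)
    show "(\<lambda>n. U (cs n) t * w t) \<longlonglongrightarrow> U c t * w t" if "t \<in> {0..L}" for t
      by (intro tendsto_intros ulim that)
  qed
  show "((\<lambda>c. integral {0..L} (\<lambda>t. U c t * w t) + integral {0..L} (\<lambda>t. slope c (U c) t * z t)) \<circ> cs)
     \<longlonglongrightarrow> integral {0..L} (\<lambda>t. U c t * w t) + integral {0..L} (\<lambda>t. slope c (U c) t * z t)"
    unfolding comp_def by (rule tendsto_add[OF 2 1])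
qed

section \<open>Weak decay as the parameter tends to minus infinity\<close>

lemma small_mult_integral:
  assumes u: "sol c u" and small: "\<And>x. x \<in> {0..L} \<Longrightarrow> u x < d" and f: "f absolutely_integrable_on {0..L}"
  shows "\<bar>integral {0..L} (\<lambda>t. u t * f t)\<bar> \<le> d * integral {0..L} (\<lambda>t. \<bar>f t\<bar>)"
proof -
  have "\<bar>integral {0..L} (\<lambda>t. u t * f t)\<bar> \<le> integral {0..L} (\<lambda>t. d * \<bar>f t\<bar>)"
  proof (rule integral_norm_bound_integral[where 'a = real, unfolded real_norm_def])
    show "(\<lambda>t. u t * f t) integrable_on {0..L}"
      using absolutely_integrable_continuous_mult[OF solD(6)[OF u] f] absolutely_integrable_on_def by blast
    show "(\<lambda>t. d * \<bar>f t\<bar>) integrable_on {0..L}"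
      using f unfolding absolutely_integrable_on_def by (intro integrable_on_mult_right) auto
    show "\<bar>u t * f t\<bar> \<le> d * \<bar>f t\<bar>" if "t \<in> {0..L}" for t
      using sol_nonneg[OF u that] small[OF that] by (simp add: abs_mult mult_right_mono)
  qed
  then show ?thesis by simp
qed

lemma sol_integral_null:
  assumes f: "f absolutely_integrable_on {0..L}" and "eps > 0"
  shows "\<exists>C. \<forall>c u. c \<le> C \<longrightarrow> sol c u \<longrightarrow> \<bar>integral {0..L} (\<lambda>t. u t * f t)\<bar> \<le> eps"
proof -
  define I where "I = integral {0..L} (\<lambda>t. \<bar>f t\<bar>) + 1"
  have "I > 0"
    using integral_nonneg[of "\<lambda>t. \<bar>f t\<bar>" "{0..L}"] f unfolding absolutely_integrable_on_def
    by (simp add: I_def)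
  obtain C where C: "\<And>c u. c \<le> C \<Longrightarrow> sol c u \<Longrightarrow> (\<forall>x\<in>{0..L}. u x < eps / I)"
    using sol_uniformly_small[of "eps / I"] \<open>I > 0\<close> \<open>eps > 0\<close> by auto
  have "\<bar>integral {0..L} (\<lambda>t. u t * f t)\<bar> \<le> eps" if "c \<le> C" and u: "sol c u" for c u
  proof -
    have "\<bar>integral {0..L} (\<lambda>t. u t * f t)\<bar> \<le> eps / I * integral {0..L} (\<lambda>t. \<bar>f t\<bar>)"
      using C[OF that] by (intro small_mult_integral[OF u _ f]) auto
    also have "\<dots> \<le> eps / I * I"
      using \<open>I > 0\<close> \<open>eps > 0\<close> by (intro mult_left_mono) (auto simp: I_def)
    finally show ?thesis using \<open>I > 0\<close> by simp
  qed
  then show ?thesis by blast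
qed

text \<open>The derivatives are bounded in \<open>L\<^sup>2\<close> uniformly in \<open>c\<close>, so it suffices to test them against
  the dense class of polynomials, where integration by parts moves the derivative off \<open>u\<close>.\<close>

lemma slope_weakly_null:
  assumes z: "sq_integrable 0 L z" and "eps > 0"
  shows "\<exists>C. \<forall>c u. c \<le> C \<longrightarrow> sol c u \<longrightarrow> \<bar>integral {0..L} (\<lambda>t. slope c u t * z t)\<bar> < eps"
proof -
  define E where "E = energy_bound + 1"
  have "E > 0" using energy_bound_nonneg by (simp add: E_def)
  define e where "e = eps / (2 * E)"
  have "e > 0" using \<open>eps > 0\<close> \<open>E > 0\<close> by (simp add: e_def)
  have eE: "e * energy_bound \<le> eps / 2"
  proof -
    have "e * energy_bound \<le> e * E" using \<open>e > 0\<close> by (intro mult_left_mono) (auto simp: E_def)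
    also have "\<dots> = eps / 2" using \<open>E > 0\<close> by (simp add: e_def)
    finally show ?thesis .
  qed
  \<comment> \<open>The approximation error is divided by \<open>e\<close> in Young's inequality, so
    this tolerance leaves \<open>eps / 2\<close> there; \<open>e\<close> itself was chosen to keep
    the energy term at most \<open>eps / 2\<close>.\<close>
  have "e * eps / 2 > 0" using \<open>e > 0\<close> \<open>eps > 0\<close> by simp
  then obtain P P' where P: "\<And>x. (P has_real_derivative P' x) (at x)" and P': "continuous_on UNIV P'"
    and close: "integral {0..L} (\<lambda>x. (z x - P x)\<^sup>2) < e * eps / 2"
    using C1_L2_approximation[OF z L_pos] by blast
  have contP: "continuous_on S P" for S
    using P DERIV_isCont continuous_at_imp_continuous_on by blast
  have primP: "primitive_on 0 L P P'"
    by (intro primitive_on_C1 has_field_derivative_at_within[OF P] continuous_on_subset[OF P']) auto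
  have Psq: "sq_integrable 0 L P" by (rule sq_integrable_continuous[OF contP])
  have P'abs: "P' absolutely_integrable_on {0..L}" by (rule primitive_onD(1)[OF primP])
  obtain C where C: "\<And>c u. c \<le> C \<Longrightarrow> sol c u \<Longrightarrow> \<bar>integral {0..L} (\<lambda>t. u t * P' t)\<bar> \<le> eps / 2"
    using sol_integral_null[OF P'abs half_gt_zero[OF \<open>eps > 0\<close>]] by blast
  have "\<bar>integral {0..L} (\<lambda>t. slope c u t * z t)\<bar> < eps" if c: "c \<le> C" and u: "sol c u" for c u
  proof -
    define h where "h = slope c u"
    have hsq: "sq_integrable 0 L h"
      unfolding h_def by (rule sq_integrable_slope[OF solD(4)[OF u]])
    have int: "(\<lambda>t. h t * P t) integrable_on {0..L}" "(\<lambda>t. h t * (z t - P t)) integrable_on {0..L}"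
      "(\<lambda>t. u t * P' t) integrable_on {0..L}"
      using sq_integrable_mult[OF hsq Psq] sq_integrable_mult[OF hsq sq_integrable_diff[OF z Psq]]
        absolutely_integrable_continuous_mult[OF solD(6)[OF u] P'abs]
      by (auto intro: set_lebesgue_integral_eq_integral(1))
    have "integral {0..L} (\<lambda>t. h t * P t + u t * P' t) = 0"
      using primitive_onD(3)[OF primitive_on_mult[OF solD(5)[OF u] primP], of 0 L] L_pos solD(2,3)[OF u]
      by (simp add: h_def)
    then have byparts: "integral {0..L} (\<lambda>t. h t * P t) = - integral {0..L} (\<lambda>t. u t * P' t)"
      using int by (simp add: integral_add)
    have 1: "\<bar>integral {0..L} (\<lambda>t. h t * P t)\<bar> \<le> eps / 2"
      using C[OF c u] by (simp add: byparts)
    have "\<bar>integral {0..L} (\<lambda>t. h t * (z t - P t))\<bar> \<le>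
       (e * integral {0..L} (\<lambda>t. (h t)\<^sup>2) + integral {0..L} (\<lambda>t. (z t - P t)\<^sup>2) / e) / 2"
      by (rule integral_abs_mult_le[OF hsq sq_integrable_diff[OF z Psq] \<open>e > 0\<close>])
    moreover have "e * integral {0..L} (\<lambda>t. (h t)\<^sup>2) \<le> eps / 2"
      using sol_energy_bound[OF u] \<open>e > 0\<close> eE mult_left_mono[of _ _ e] unfolding h_def
      by (meson less_imp_le order_trans)
    moreover have "integral {0..L} (\<lambda>t. (z t - P t)\<^sup>2) / e < eps / 2"
      using close \<open>e > 0\<close> by (simp add: field_simps)
    moreover have "r < eps / 2" if "r \<le> (s + t) / 2" "s \<le> eps / 2" "t < eps / 2" for r s t :: real
      using that by (simp add: field_simps)
    ultimately have 2: "\<bar>integral {0..L} (\<lambda>t. h t * (z t - P t))\<bar> < eps / 2" by blast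
    have "integral {0..L} (\<lambda>t. h t * z t) = integral {0..L} (\<lambda>t. h t * P t + h t * (z t - P t))"
      by (simp add: algebra_simps)
    also have "\<dots> = integral {0..L} (\<lambda>t. h t * P t) + integral {0..L} (\<lambda>t. h t * (z t - P t))"
      by (intro integral_add int)
    finally show ?thesis using 1 2 unfolding h_def by linarith
  qed
  then show ?thesis by blast
qed

lemma sol_family_tendsto_0:
  assumes U: "\<And>c. c \<le> cmax \<Longrightarrow> sol c (U c)"
    and w: "sq_integrable 0 L w" and z: "sq_integrable 0 L z"
  shows "((\<lambda>c. integral {0..L} (\<lambda>t. U c t * w t) + integral {0..L} (\<lambda>t. slope c (U c) t * z t))
     \<longlongrightarrow> 0) at_bot"
proof (rule tendstoI)
  fix eps :: real assume "eps > 0"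
  obtain C1 where C1: "\<And>c u. c \<le> C1 \<Longrightarrow> sol c u \<Longrightarrow> \<bar>integral {0..L} (\<lambda>t. u t * w t)\<bar> \<le> eps / 2"
    using sol_integral_null[OF sq_integrable_abs_integrable[OF w] half_gt_zero[OF \<open>eps > 0\<close>]] by blast
  obtain C2 where C2: "\<And>c u. c \<le> C2 \<Longrightarrow> sol c u \<Longrightarrow> \<bar>integral {0..L} (\<lambda>t. slope c u t * z t)\<bar> < eps / 2"
    using slope_weakly_null[OF z, of "eps / 2"] \<open>eps > 0\<close> by auto
  have "dist (integral {0..L} (\<lambda>t. U c t * w t) + integral {0..L} (\<lambda>t. slope c (U c) t * z t)) 0 < eps"
    if "c \<le> min cmax (min C1 C2)" for c
  proof -
    have u: "sol c (U c)" using U that by simp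
    show ?thesis using C1[OF _ u] C2[OF _ u] that by (simp add: dist_real_def)
  qed
  then show "\<forall>\<^sub>F c in at_bot. dist (integral {0..L} (\<lambda>t. U c t * w t) + integral {0..L} (\<lambda>t. slope c (U c) t * z t)) 0 < eps"
    unfolding eventually_at_bot_linorder by blast
qed

end

section \<open>Weak derivatives\<close>

lemma AE_lebesgue_iff_negligible:
  "(AE x in lebesgue. P x) \<longleftrightarrow> (\<exists>N. negligible N \<and> (\<forall>x. x \<notin> N \<longrightarrow> P x))"
  unfolding eventually_ae_filter negligible_iff_null_sets by (auto simp: subset_eq)

lemma L2_iff_sq_integrable: "L2 L f \<longleftrightarrow> sq_integrable 0 L f"
proof -
  have "set_borel_measurable lebesgue {0<..<L} f \<longleftrightarrow> f measurable_on {0<..<L}"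
    by (simp add: set_borel_measurable_def measurable_on_iff_borel_measurable
        borel_measurable_restrict_space_iff)
  also have "\<dots> \<longleftrightarrow> f measurable_on {0..L}"
  proof
    have neg: "negligible ({0..L} - {0<..<L} \<union> ({0<..<L} - {0..L}))"
      by (rule negligible_subset[of "{0, L}"]) auto
    show "f measurable_on {0<..<L}" if "f measurable_on {0..L}"
      using measurable_on_spike_set[OF that neg] .
    show "f measurable_on {0..L}" if "f measurable_on {0<..<L}"
      using measurable_on_spike_set[OF that] neg by (simp add: Un_commute)
  qed
  also have "\<dots> \<longleftrightarrow> f \<in> borel_measurable (lebesgue_on {0..L})"
    by (simp add: measurable_on_iff_borel_measurable)
  finally have 1: "set_borel_measurable lebesgue {0<..<L} f \<longleftrightarrow> f \<in> borel_measurable (lebesgue_on {0..L})" .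
  have "set_integrable lebesgue {0<..<L} (\<lambda>x. (f x)\<^sup>2) \<longleftrightarrow> (\<lambda>x. (f x)\<^sup>2) integrable_on {0..L}"
    by (subst absolutely_integrable_on_iff_nonneg) (auto simp: integrable_on_open_interval_real)
  with 1 show ?thesis by (simp add: L2_def sq_integrable_def)
qed

lemma L2_cong: "(\<And>x. x \<in> {0<..<L} \<Longrightarrow> f x = f' x) \<Longrightarrow> L2 L f \<longleftrightarrow> L2 L f'"
proof -
  assume *: "\<And>x. x \<in> {0<..<L} \<Longrightarrow> f x = f' x"
  then have "(\<lambda>x. indicat_real {0<..<L} x *\<^sub>R f x) = (\<lambda>x. indicat_real {0<..<L} x *\<^sub>R f' x)"
    by (auto simp: fun_eq_iff indicator_def)
  moreover have "set_integrable lebesgue {0<..<L} (\<lambda>x. (f x)\<^sup>2) \<longleftrightarrow> set_integrable lebesgue {0<..<L} (\<lambda>x. (f' x)\<^sup>2)"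
    using * by (intro set_integrable_cong) auto
  ultimately show ?thesis by (simp add: L2_def set_borel_measurable_def)
qed

text \<open>Agreement off a null set is all that can be offered: \<open>H1_deriv\<close> is a chosen
  representative and \<open>a\<close> is controlled only almost everywhere.\<close>

lemma LINT_eq_integral:
  fixes f f' :: "real \<Rightarrow> real"
  assumes f': "f' absolutely_integrable_on {0..L}" and N: "negligible N"
    and eq: "\<And>x. x \<in> {0<..<L} - N \<Longrightarrow> f x = f' x"
  shows "(LINT x:{0<..<L}|lebesgue. f x) = integral {0..L} f'"
proof -
  have "f' absolutely_integrable_on {0<..<L}"
    using f' by (simp only: absolutely_integrable_on_Icc_iff_Ioo)
  then have "f absolutely_integrable_on {0<..<L}"
    by (rule absolutely_integrable_spike[OF _ N eq])
  then have "(LINT x:{0<..<L}|lebesgue. f x) = integral {0<..<L} f"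
    by (rule set_lebesgue_integral_eq_integral(2))
  also have "\<dots> = integral {0<..<L} f'"
    by (rule integral_spike[OF N]) (use eq in auto)
  finally show ?thesis by (simp add: integral_open_interval_real)
qed

lemma LINT_eq_integral':
  fixes f :: "real \<Rightarrow> real"
  shows "f absolutely_integrable_on {0..L} \<Longrightarrow> (LINT x:{0<..<L}|lebesgue. f x) = integral {0..L} f"
  by (rule LINT_eq_integral[OF _ negligible_empty]) auto

lemma test_fnD:
  assumes "test_fn L \<psi>"
  shows "(\<psi> has_real_derivative deriv \<psi> x) (at x)" "continuous_on S \<psi>" "continuous_on S (deriv \<psi>)"
    "x \<notin> {0<..<L} \<Longrightarrow> \<psi> x = 0"
proof -
  have "((deriv ^^ 0) \<psi>) differentiable (at x)" "((deriv ^^ 1) \<psi>) differentiable (at x)" for x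
    using assms unfolding test_fn_def by blast+
  then have d: "\<psi> differentiable (at x)" "deriv \<psi> differentiable (at x)" for x by simp_all
  then show "(\<psi> has_real_derivative deriv \<psi> x) (at x)"
    using DERIV_deriv_iff_real_differentiable by blast
  show "continuous_on S \<psi>" "continuous_on S (deriv \<psi>)"
    using d by (auto intro!: continuous_at_imp_continuous_on differentiable_imp_continuous_within)
  show "x \<notin> {0<..<L} \<Longrightarrow> \<psi> x = 0"
    using assms unfolding test_fn_def by blast
qed

lemma test_fn_sq_integrable:
  assumes "test_fn L \<psi>"
  shows "sq_integrable 0 L \<psi>" "sq_integrable 0 L (deriv \<psi>)"
  using test_fnD(2,3)[OF assms] by (auto intro: sq_integrable_continuous)

lemma test_fn_primitive: "test_fn L \<psi> \<Longrightarrow> primitive_on 0 L \<psi> (deriv \<psi>)"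
  by (rule primitive_on_C1[OF has_field_derivative_at_within[OF test_fnD(1)] test_fnD(3)])

lemma test_fn_integral_deriv:
  assumes "test_fn L \<psi>" "0 < L"
  shows "integral {0..L} (deriv \<psi>) = 0"
  using primitive_onD(3)[OF test_fn_primitive[OF assms(1)], of 0 L] test_fnD(4)[OF assms(1)] assms(2) by simp

lemma weak_deriv_iff:
  assumes "sq_integrable 0 L u" "sq_integrable 0 L v"
  shows "weak_deriv L u v \<longleftrightarrow> (\<forall>\<psi>. test_fn L \<psi> \<longrightarrow>
     integral {0..L} (\<lambda>x. u x * deriv \<psi> x) = - integral {0..L} (\<lambda>x. v x * \<psi> x))"
proof -
  have "(LINT x:{0<..<L}|lebesgue. u x * deriv \<psi> x) = integral {0..L} (\<lambda>x. u x * deriv \<psi> x)"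
    "(LINT x:{0<..<L}|lebesgue. v x * \<psi> x) = integral {0..L} (\<lambda>x. v x * \<psi> x)" if "test_fn L \<psi>" for \<psi>
    using test_fn_sq_integrable[OF that] assms by (auto intro!: LINT_eq_integral' sq_integrable_mult)
  then show ?thesis by (simp add: weak_deriv_def)
qed

lemma primitive_on_weak_deriv:
  assumes u: "primitive_on 0 L u h" and h: "sq_integrable 0 L h" and L: "0 < L"
  shows "weak_deriv L u h"
proof -
  have usq: "sq_integrable 0 L u"
    by (rule sq_integrable_continuous[OF primitive_on_continuous[OF u]])
  show ?thesis
    unfolding weak_deriv_iff[OF usq h]
  proof (intro allI impI)
    fix \<psi> assume \<psi>: "test_fn L \<psi>"
    note sq = test_fn_sq_integrable[OF \<psi>]
    have int: "(\<lambda>x. h x * \<psi> x) integrable_on {0..L}" "(\<lambda>x. u x * deriv \<psi> x) integrable_on {0..L}"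
      using sq_integrable_mult_on[OF h sq(1)] sq_integrable_mult_on[OF usq sq(2)]
      by simp_all
    have "integral {0..L} (\<lambda>x. h x * \<psi> x + u x * deriv \<psi> x) = 0"
      using primitive_onD(3)[OF primitive_on_mult[OF u test_fn_primitive[OF \<psi>]], of 0 L] L
        test_fnD(4)[OF \<psi>] by simp
    then show "integral {0..L} (\<lambda>x. u x * deriv \<psi> x) = - integral {0..L} (\<lambda>x. h x * \<psi> x)"
      by (simp add: integral_add[OF int])
  qed
qed

lemma weak_deriv_unique:
  assumes u: "sq_integrable 0 L u" and v: "sq_integrable 0 L v" "weak_deriv L u v"
    and w: "sq_integrable 0 L w" "weak_deriv L u w"
  obtains N where "negligible N" "\<And>x. x \<in> {0<..<L} - N \<Longrightarrow> v x = w x"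
proof -
  have "integral {0..L} (\<lambda>x. (v x - w x) * \<psi> x) = 0" if \<psi>: "test_fn L \<psi>" for \<psi>
  proof -
    note sq = test_fn_sq_integrable[OF \<psi>]
    have int: "(\<lambda>x. v x * \<psi> x) integrable_on {0..L}" "(\<lambda>x. w x * \<psi> x) integrable_on {0..L}"
      using sq_integrable_mult_on[OF v(1) sq(1)] sq_integrable_mult_on[OF w(1) sq(1)]
      by simp_all
    have "integral {0..L} (\<lambda>x. (v x - w x) * \<psi> x) = integral {0..L} (\<lambda>x. v x * \<psi> x) - integral {0..L} (\<lambda>x. w x * \<psi> x)"
      by (simp add: left_diff_distrib integral_diff[OF int])
    also have "\<dots> = 0"
      using v(2) w(2) \<psi> by (simp add: weak_deriv_iff[OF u v(1)] weak_deriv_iff[OF u w(1)])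
    finally show ?thesis .
  qed
  then obtain N where "negligible N" "\<And>x. x \<in> {0<..<L} - N \<Longrightarrow> v x - w x = 0"
    using fundamental_lemma_variations[OF sq_integrable_abs_integrable[OF sq_integrable_diff[OF v(1) w(1)]]]
    by blast
  then show ?thesis using that by simp
qed

text \<open>The set where \<open>f\<close> differs from \<open>k\<close> inside \<open>(0,L)\<close>
  is open and negligible, hence empty; continuity covers the endpoints.\<close>

lemma continuous_constant_except_negligible:
  fixes f :: "real \<Rightarrow> real"
  assumes f: "continuous_on {0..L} f" and "0 < L" and N: "negligible N" "\<And>x. x \<in> {0<..<L} - N \<Longrightarrow> f x = k"
    and x: "x \<in> {0..L}"
  shows "f x = k"
proof -
  have "open ({0<..<L} \<inter> f -` (- {k}))"
    by (rule continuous_open_preimage[OF continuous_on_subset[OF f]]) auto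
  moreover have "negligible ({0<..<L} \<inter> f -` (- {k}))"
    by (rule negligible_subset[OF N(1)]) (use N(2) in auto)
  ultimately have "{0<..<L} \<inter> f -` (- {k}) = {}"
    using open_not_negligible by blast
  then have "f t = k" if "t \<in> {0<..<L}" for t using that by auto
  then show ?thesis
    by (rule continuous_constant_on_closure[where S = "{0<..<L}", rotated 1])
      (use f \<open>0 < L\<close> x in auto)
qed

section \<open>Elements of \<open>H10\<close> as indefinite integrals\<close>

lemma H1_deriv:
  assumes "H10 L u"
  shows "sq_integrable 0 L (H1_deriv L u)" "weak_deriv L u (H1_deriv L u)"
  using assms someI_ex[of "\<lambda>v. L2 L v \<and> weak_deriv L u v"]
  unfolding H10_def H1_deriv_def L2_iff_sq_integrable by blast+

text \<open>\<open>u\<close> and the indefinite integral \<open>V\<close> of its weak derivative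
  share that derivative, so by du Bois-Reymond they differ by a constant almost everywhere, by
  continuity everywhere, and the value at 0 makes it vanish.\<close>

lemma H10_primitive:
  assumes u: "H10 L u" and L: "0 < L"
  shows "primitive_on 0 L u (H1_deriv L u)"
proof -
  define v where "v = H1_deriv L u"
  have vsq: "sq_integrable 0 L v" and weak: "weak_deriv L u v"
    using H1_deriv[OF u] by (simp_all add: v_def)
  have vint: "v absolutely_integrable_on {0..L}"
    by (rule sq_integrable_abs_integrable[OF vsq])
  have cont: "continuous_on {0..L} u" "u 0 = 0" using u by (simp_all add: H10_def)
  have usq: "sq_integrable 0 L u" by (rule sq_integrable_continuous[OF cont(1)])
  define V where "V = (\<lambda>x. integral {0..x} v)"
  have V: "primitive_on 0 L V v"
    by (rule primitive_onI[OF vint]) (simp add: V_def)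
  have contV: "continuous_on {0..L} V" by (rule primitive_on_continuous[OF V])
  have Vsq: "sq_integrable 0 L V" by (rule sq_integrable_continuous[OF contV])
  have weakV: "weak_deriv L V v" by (rule primitive_on_weak_deriv[OF V vsq L])
  have "integral {0..L} (\<lambda>x. (u x - V x) * deriv \<psi> x) = 0" if \<psi>: "test_fn L \<psi>" for \<psi>
  proof -
    note sq = test_fn_sq_integrable[OF \<psi>]
    have int: "(\<lambda>x. u x * deriv \<psi> x) integrable_on {0..L}" "(\<lambda>x. V x * deriv \<psi> x) integrable_on {0..L}"
      using sq_integrable_mult_on[OF usq sq(2)] sq_integrable_mult_on[OF Vsq sq(2)]
      by simp_all
    have "integral {0..L} (\<lambda>x. (u x - V x) * deriv \<psi> x) =
      integral {0..L} (\<lambda>x. u x * deriv \<psi> x) - integral {0..L} (\<lambda>x. V x * deriv \<psi> x)"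
      by (simp add: left_diff_distrib integral_diff[OF int])
    also have "\<dots> = 0"
      using weak weakV \<psi> by (simp add: weak_deriv_iff[OF usq vsq] weak_deriv_iff[OF Vsq vsq])
    finally show ?thesis .
  qed
  then obtain N k where N: "negligible N" "\<And>x. x \<in> {0<..<L} - N \<Longrightarrow> u x - V x = k"
    using du_Bois_Reymond[OF sq_integrable_abs_integrable[OF sq_integrable_diff[OF usq Vsq]] L] by blast
  have const: "u x - V x = k" if "x \<in> {0..L}" for x
    by (rule continuous_constant_except_negligible[OF continuous_on_diff[OF cont(1) contV] L N that])
  have "k = 0" using const[of 0] L cont(2) by (simp add: V_def)
  then have "u x = u 0 + integral {0..x} v" if "x \<in> {0..L}" for x
    using const[OF that] cont(2) by (simp add: V_def)
  then show ?thesis unfolding v_def[symmetric] by (rule primitive_onI[OF vint])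
qed

lemma primitive_on_H10:
  assumes u: "primitive_on 0 L u h" and h: "sq_integrable 0 L h" and "0 < L" "u 0 = 0" "u L = 0"
  shows "H10 L u"
  unfolding H10_def L2_iff_sq_integrable
  using primitive_on_continuous[OF u] sq_integrable_continuous[OF primitive_on_continuous[OF u]]
    primitive_on_weak_deriv[OF u h] assms by blast

lemma H1_deriv_primitive:
  assumes u: "primitive_on 0 L u h" and h: "sq_integrable 0 L h" and "0 < L" "u 0 = 0" "u L = 0"
  obtains N where "negligible N" "\<And>x. x \<in> {0<..<L} - N \<Longrightarrow> H1_deriv L u x = h x"
  using weak_deriv_unique[OF sq_integrable_continuous[OF primitive_on_continuous[OF u]]
      H1_deriv[OF primitive_on_H10[OF assms]] h primitive_on_weak_deriv[OF u h \<open>0 < L\<close>]] by blast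

section \<open>The singular elliptic problem\<close>

locale elliptic_problem =
  fixes L \<alpha> \<beta> :: real and a g :: "real \<Rightarrow> real" and \<phi> :: "real \<Rightarrow> ereal"
  assumes L_pos: "0 < L"
    and a_meas: "set_borel_measurable lebesgue {0<..<L} a"
    and \<alpha>_pos: "0 < \<alpha>" and \<alpha>_less_\<beta>: "\<alpha> < \<beta>"
    and a_bounds: "AE x in lebesgue. x \<in> {0<..<L} \<longrightarrow> \<alpha> \<le> a x \<and> a x \<le> \<beta>"
    and g_L2: "L2 L g"
    and \<phi>_cont: "continuous_on UNIV \<phi>"
    and \<phi>_fin: "s \<noteq> 0 \<Longrightarrow> \<phi> s < \<infinity>"
    and \<phi>_real: "\<phi> s \<noteq> -\<infinity>"
    and \<phi>_0: "\<phi> 0 = \<infinity>"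
    and \<phi>_int: "0 < \<delta> \<Longrightarrow> \<delta> < 1 \<Longrightarrow> set_integrable lebesgue {0<..<\<delta>} (phr \<phi>)"
    and \<phi>_bdd: "0 < \<delta> \<Longrightarrow> \<exists>B::real. \<forall>s. \<bar>s\<bar> \<ge> \<delta> \<longrightarrow> \<bar>\<phi> s\<bar> \<le> ereal B"
    and \<phi>_antimono: "0 \<le> s \<Longrightarrow> s \<le> t \<Longrightarrow> \<phi> t \<le> \<phi> s"
    and g_below: "0 < \<eta> \<Longrightarrow> \<eta> < L \<Longrightarrow> \<exists>M>0. AE x in lebesgue. x \<in> {0..L-\<eta>} \<longrightarrow> g x \<ge> - M"
begin

lemma \<phi>_eq_phr: "s \<noteq> 0 \<Longrightarrow> \<phi> s = ereal (phr \<phi> s)"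
  using \<phi>_fin[of s] \<phi>_real[of s] unfolding phr_def by (cases "\<phi> s") auto

text \<open>Any lower bound would do; a choice fixes one so that it can instantiate the parameter
  \<open>m\<close> of \<open>singular_problem\<close>.\<close>

definition phr_lower :: real where
  "phr_lower = (SOME b. \<forall>s>0. b \<le> phr \<phi> s)"

text \<open>On \<open>[1,\<infinity>)\<close> by boundedness away from 0; on \<open>(0,1)\<close>
  the values are at least \<open>\<phi> 1\<close> by monotonicity.\<close>

lemma phr_lower: "0 < s \<Longrightarrow> phr_lower \<le> phr \<phi> s"
proof -
  obtain B where B: "\<And>s. \<bar>s\<bar> \<ge> 1 \<Longrightarrow> \<bar>\<phi> s\<bar> \<le> ereal B"
    using \<phi>_bdd[of 1] by auto
  have "- B \<le> phr \<phi> s" if "0 < s" for s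
  proof -
    have 1: "- B \<le> phr \<phi> s" if "1 \<le> s" for s
      using B[of s] \<phi>_eq_phr[of s] that by auto
    show ?thesis
    proof (cases "1 \<le> s")
      case False
      then have "\<phi> 1 \<le> \<phi> s" using that by (intro \<phi>_antimono) auto
      then have "phr \<phi> 1 \<le> phr \<phi> s" using \<phi>_eq_phr[of s] \<phi>_eq_phr[of 1] that by simp
      then show ?thesis using 1[of 1] by simp
    qed (rule 1)
  qed
  then have "\<forall>s>0. phr_lower \<le> phr \<phi> s"
    unfolding phr_lower_def by (intro someI[of "\<lambda>b. \<forall>s>0. b \<le> phr \<phi> s" "- B"]) auto
  then show "0 < s \<Longrightarrow> phr_lower \<le> phr \<phi> s" by blast
qed

definition p :: "real \<Rightarrow> real" where
  "p s = (if 0 < s then phr \<phi> s else phr_lower)"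

text \<open>A version of \<open>a\<close>, equal to it almost everywhere on \<open>(0,L)\<close>,
  for which the bounds hold at every real.\<close>

definition a0 :: "real \<Rightarrow> real" where
  "a0 x = (if x \<in> {0<..<L} \<and> \<alpha> \<le> a x \<and> a x \<le> \<beta> then a x else \<alpha>)"

lemma a0_bounds: "\<alpha> \<le> a0 x" "a0 x \<le> \<beta>" "0 < a0 x"
  using \<alpha>_pos \<alpha>_less_\<beta> by (auto simp: a0_def)

lemma a0_eq: obtains N where "negligible N" "\<And>x. x \<in> {0<..<L} - N \<Longrightarrow> a x = a0 x"
  using a_bounds unfolding AE_lebesgue_iff_negligible by (auto simp: a0_def)

lemma a0_meas: "a0 \<in> borel_measurable lebesgue"
proof -
  define b where "b = (\<lambda>x. indicat_real {0<..<L} x *\<^sub>R a x)"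
  have b: "b \<in> borel_measurable lebesgue"
    using a_meas by (simp add: b_def set_borel_measurable_def)
  have "a0 = (\<lambda>x. if \<alpha> \<le> b x \<and> b x \<le> \<beta> then b x else \<alpha>)"
    using \<alpha>_pos by (auto simp: a0_def b_def fun_eq_iff indicator_def)
  also have "\<dots> \<in> borel_measurable lebesgue"
    using b by measurable
  finally show ?thesis .
qed

lemma \<phi>_large_near_0:
  obtains s0 where "0 < s0" "\<And>s. \<bar>s\<bar> \<le> s0 \<Longrightarrow> ereal K < \<phi> s"
proof -
  have "open (\<phi> -` {ereal K<..})"
    using \<phi>_cont by (intro open_vimage) auto
  moreover have "0 \<in> \<phi> -` {ereal K<..}" using \<phi>_0 by simp
  ultimately obtain d where "d > 0" "ball 0 d \<subseteq> \<phi> -` {ereal K<..}"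
    using open_contains_ball by blast
  then show ?thesis by (intro that[of "d / 2"]) (auto simp: subset_eq dist_real_def)
qed

lemma phr_cont: "continuous_on {0<..} (phr \<phi>)"
proof -
  have "continuous_on {0<..} (real_of_ereal \<circ> \<phi>)"
    using continuous_on_iff_real[of "{0<..}" \<phi>] \<phi>_eq_phr continuous_on_subset[OF \<phi>_cont] by auto
  then show ?thesis by (simp add: comp_def phr_def[abs_def])
qed

sublocale singular_problem L \<alpha> \<beta> phr_lower "\<lambda>x. 1 / a0 x" g p
proof
  show "0 < L" "0 < \<alpha>" "\<alpha> < \<beta>" by (fact L_pos \<alpha>_pos \<alpha>_less_\<beta>)+
  show "(\<lambda>x. 1 / a0 x) \<in> borel_measurable lebesgue"
    using a0_meas by measurable
  show "1 / \<beta> \<le> 1 / a0 x" "1 / a0 x \<le> 1 / \<alpha>" for x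
    using a0_bounds[of x] \<alpha>_pos by (auto intro!: divide_left_mono)
  show "sq_integrable 0 L g" using g_L2 by (simp add: L2_iff_sq_integrable)
  show "continuous_on {0<..} p"
    using phr_cont by (subst continuous_on_cong[OF refl, where g = "phr \<phi>"]) (auto simp: p_def)
  show "p t \<le> p s" if "0 < s" "s \<le> t" for s t
    using \<phi>_antimono[of s t] \<phi>_eq_phr[of s] \<phi>_eq_phr[of t] that by (simp add: p_def)
  show "phr_lower \<le> p s" for s by (simp add: p_def phr_lower)
  show "p s = phr_lower" if "s \<le> 0" for s using that by (simp add: p_def)
  show "\<exists>s>0. K \<le> p s" for K
  proof -
    obtain s0 where "0 < s0" "\<And>s. \<bar>s\<bar> \<le> s0 \<Longrightarrow> ereal K < \<phi> s" using \<phi>_large_near_0 by blast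
    then have "ereal K < ereal (phr \<phi> s0)" using \<phi>_eq_phr[of s0] by (metis abs_of_pos less_irrefl order_refl)
    then show ?thesis using \<open>0 < s0\<close> by (intro exI[of _ s0]) (simp add: p_def)
  qed
  \<comment> \<open>\<open>1/2\<close> is simply one admissible \<open>\<delta>\<close> below
    1.\<close>
  have "set_integrable lebesgue {0<..<1/2} p \<longleftrightarrow> set_integrable lebesgue {0<..<1/2} (phr \<phi>)"
    by (rule set_integrable_cong) (auto simp: p_def)
  then show "p absolutely_integrable_on {0..1/2}"
    using \<phi>_int[of "1/2"] by (simp add: absolutely_integrable_on_Icc_iff_Ioo)
  show "\<exists>M N. negligible N \<and> (\<forall>x\<in>{0..L-\<eta>} - N. - M \<le> g x)" if \<eta>: "0 < \<eta>" "\<eta> < L" for \<eta>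
  proof -
    obtain M N where "negligible N" "\<forall>x. x \<notin> N \<longrightarrow> x \<in> {0..L-\<eta>} \<longrightarrow> - M \<le> g x"
      using g_below[OF \<eta>] unfolding AE_lebesgue_iff_negligible by blast
    then show ?thesis by (intro exI[of _ M] exI[of _ N]) blast
  qed
qed

section \<open>Translation between parametrized solutions and weak solutions\<close>

lemma a0_slope: "a0 x * slope c u x = p (u x) + g x + c"
  using a0_bounds[of x] by (simp add: slope_def)

lemma sol_p: "sol c u \<Longrightarrow> x \<in> {0<..<L} \<Longrightarrow> p (u x) = phr \<phi> (u x)"
  using solD(1)[of c u x] by (simp add: p_def)

lemma sol_H1_deriv:
  assumes "sol c u"
  obtains N where "negligible N" "\<And>x. x \<in> {0<..<L} - N \<Longrightarrow> H1_deriv L u x = slope c u x"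
    "\<And>x. x \<in> {0<..<L} - N \<Longrightarrow> a x = a0 x"
proof -
  obtain N1 where N1: "negligible N1" "\<And>x. x \<in> {0<..<L} - N1 \<Longrightarrow> H1_deriv L u x = slope c u x"
    using H1_deriv_primitive[OF solD(5)[OF assms] sq_integrable_slope[OF solD(4)[OF assms]] L_pos]
      solD(2,3)[OF assms] by blast
  obtain N2 where N2: "negligible N2" "\<And>x. x \<in> {0<..<L} - N2 \<Longrightarrow> a x = a0 x"
    using a0_eq by blast
  show ?thesis
    by (rule that[of "N1 \<union> N2"]) (use N1 N2 in \<open>auto intro: negligible_Un\<close>)
qed

lemma sol_H10:
  assumes u: "sol c u"
  shows "H10 L u"
  by (rule primitive_on_H10[OF solD(5)[OF u] sq_integrable_slope[OF solD(4)[OF u]] L_pos solD(2,3)[OF u]])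

text \<open>The constant \<open>d\<close> is free so that one statement covers both the first-order
  equation (\<open>d = c\<close>) and the weak formulation (\<open>d = 0\<close>).\<close>

lemma sol_equation:
  assumes u: "sol c u" and \<psi>: "sq_integrable 0 L \<psi>"
  shows "(LINT x:{0<..<L}|lebesgue. a x * H1_deriv L u x * \<psi> x) =
      integral {0..L} (\<lambda>x. (p (u x) + g x + c) * \<psi> x)"
    and "(LINT x:{0<..<L}|lebesgue. (phr \<phi> (u x) + g x + d) * \<psi> x) =
      integral {0..L} (\<lambda>x. (p (u x) + g x + d) * \<psi> x)"
proof -
  have int: "(\<lambda>x. (p (u x) + g x + d) * \<psi> x) absolutely_integrable_on {0..L}" for d
    by (intro sq_integrable_mult sq_integrable_add sq_integrable_const g_sq solD(4)[OF u] \<psi>)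
  obtain N where N: "negligible N" "\<And>x. x \<in> {0<..<L} - N \<Longrightarrow> H1_deriv L u x = slope c u x"
    "\<And>x. x \<in> {0<..<L} - N \<Longrightarrow> a x = a0 x"
    using sol_H1_deriv[OF u] by blast
  show "(LINT x:{0<..<L}|lebesgue. a x * H1_deriv L u x * \<psi> x) =
      integral {0..L} (\<lambda>x. (p (u x) + g x + c) * \<psi> x)"
    by (rule LINT_eq_integral[OF int N(1)]) (simp add: N(2,3) a0_slope)
  show "(LINT x:{0<..<L}|lebesgue. (phr \<phi> (u x) + g x + d) * \<psi> x) =
      integral {0..L} (\<lambda>x. (p (u x) + g x + d) * \<psi> x)"
    by (rule LINT_eq_integral[OF int negligible_empty]) (simp add: sol_p[OF u])
qed

lemma sol_weak_sol:
  assumes u: "sol c u"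
  shows "weak_sol L a g \<phi> u"
  unfolding weak_sol_def
proof (intro conjI allI impI)
  show "H10 L u" by (rule sol_H10[OF u])
  have "\<phi> (u x) \<noteq> \<infinity>" if "x \<in> {0<..<L}" for x
    using \<phi>_fin[of "u x"] solD(1)[OF u, of x] that by auto
  then show "AE x in lebesgue. x \<in> {0<..<L} \<longrightarrow> \<phi> (u x) \<noteq> \<infinity>" by simp
  have "L2 L (\<lambda>x. p (u x))" using solD(4)[OF u] by (simp add: L2_iff_sq_integrable)
  then show "L2 L (\<lambda>x. phr \<phi> (u x))"
    using L2_cong[of L "\<lambda>x. p (u x)" "\<lambda>x. phr \<phi> (u x)"] sol_p[OF u] by blast
  fix \<psi> assume \<psi>: "test_fn L \<psi>"
  note sq = test_fn_sq_integrable(2)[OF \<psi>]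
  have int: "(\<lambda>x. (p (u x) + g x) * deriv \<psi> x) integrable_on {0..L}" "(\<lambda>x. c * deriv \<psi> x) integrable_on {0..L}"
    using sq_integrable_mult_on[OF sq_integrable_add[OF solD(4)[OF u] g_sq] sq]
      sq_integrable_mult_on[OF sq_integrable_const sq]
    by simp_all
  have "integral {0..L} (\<lambda>x. (p (u x) + g x + c) * deriv \<psi> x) =
      integral {0..L} (\<lambda>x. (p (u x) + g x) * deriv \<psi> x + c * deriv \<psi> x)"
    by (simp add: distrib_right)
  also have "\<dots> = integral {0..L} (\<lambda>x. (p (u x) + g x) * deriv \<psi> x) + integral {0..L} (\<lambda>x. c * deriv \<psi> x)"
    by (rule integral_add[OF int])
  \<comment> \<open>The derivative of a test function has integral 0, so the weak formulation does
    not see the parameter.\<close>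
  also have "integral {0..L} (\<lambda>x. c * deriv \<psi> x) = 0"
    using test_fn_integral_deriv[OF \<psi> L_pos] by simp
  finally show "(LINT x:{0<..<L}|lebesgue. a x * H1_deriv L u x * deriv \<psi> x) =
      (LINT x:{0<..<L}|lebesgue. (phr \<phi> (u x) + g x) * deriv \<psi> x)"
    using sol_equation(1)[OF u sq] sol_equation(2)[OF u sq, of 0] by simp
qed

text \<open>Near a zero of \<open>u\<close> in \<open>[0,L)\<close> the singular term dominates, so \<open>u\<close> is increasing there.\<close>

lemma weak_sol_sol:
  assumes u: "weak_sol L a g \<phi> u"
  shows "\<exists>c. sol c u"
proof -
  have H10: "H10 L u" using u by (simp add: weak_sol_def)
  define v where "v = H1_deriv L u"
  have vsq: "sq_integrable 0 L v" unfolding v_def by (rule H1_deriv(1)[OF H10])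
  have prim: "primitive_on 0 L u v" unfolding v_def by (rule H10_primitive[OF H10 L_pos])
  have u0: "u 0 = 0" "u L = 0" and cont: "continuous_on {0..L} u" using H10 by (simp_all add: H10_def)
  define P where "P = (\<lambda>x. phr \<phi> (u x))"
  have Psq: "sq_integrable 0 L P" using u by (simp add: weak_sol_def L2_iff_sq_integrable P_def)
  obtain N1 where N1: "negligible N1" "\<And>x. x \<in> {0<..<L} - N1 \<Longrightarrow> a x = a0 x" using a0_eq by blast
  obtain N2 where N2: "negligible N2" "\<And>x. x \<in> {0<..<L} - N2 \<Longrightarrow> \<phi> (u x) \<noteq> \<infinity>"
    using u unfolding weak_sol_def AE_lebesgue_iff_negligible by blast
  have "\<bar>a0 x\<bar> \<le> \<beta>" for x
    using a0_bounds(2,3)[of x] by simp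
  then have a0v: "sq_integrable 0 L (\<lambda>x. a0 x * v x)"
    by (rule sq_integrable_bounded_mult[OF measurable_restrict_space1[OF a0_meas] _ vsq])
  have Pg: "sq_integrable 0 L (\<lambda>x. P x + g x)" by (intro sq_integrable_add Psq g_sq)
  have "integral {0..L} (\<lambda>x. (a0 x * v x - (P x + g x)) * deriv \<psi> x) = 0" if \<psi>: "test_fn L \<psi>" for \<psi>
  proof -
    note sq = test_fn_sq_integrable(2)[OF \<psi>]
    have "(LINT x:{0<..<L}|lebesgue. a x * v x * deriv \<psi> x) = integral {0..L} (\<lambda>x. a0 x * v x * deriv \<psi> x)"
      by (rule LINT_eq_integral[OF sq_integrable_mult[OF a0v sq] N1(1)]) (simp add: N1(2))
    moreover have "(LINT x:{0<..<L}|lebesgue. (P x + g x) * deriv \<psi> x) = integral {0..L} (\<lambda>x. (P x + g x) * deriv \<psi> x)"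
      by (rule LINT_eq_integral'[OF sq_integrable_mult[OF Pg sq]])
    ultimately have eq: "integral {0..L} (\<lambda>x. a0 x * v x * deriv \<psi> x) = integral {0..L} (\<lambda>x. (P x + g x) * deriv \<psi> x)"
      using u \<psi> by (simp add: weak_sol_def v_def P_def)
    have "integral {0..L} (\<lambda>x. (a0 x * v x - (P x + g x)) * deriv \<psi> x) =
       integral {0..L} (\<lambda>x. a0 x * v x * deriv \<psi> x - (P x + g x) * deriv \<psi> x)"
      by (simp add: left_diff_distrib)
    also have "\<dots> = integral {0..L} (\<lambda>x. a0 x * v x * deriv \<psi> x) - integral {0..L} (\<lambda>x. (P x + g x) * deriv \<psi> x)"
      by (intro integral_diff set_lebesgue_integral_eq_integral(1) sq_integrable_mult[OF a0v sq] sq_integrable_mult[OF Pg sq])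
    finally show ?thesis using eq by simp
  qed
  \<comment> \<open>The parameter arises here, as the constant of integration of the second-order
    equation.\<close>
  then obtain N3 c where N3: "negligible N3" "\<And>x. x \<in> {0<..<L} - N3 \<Longrightarrow> a0 x * v x - (P x + g x) = c"
    using du_Bois_Reymond[OF sq_integrable_abs_integrable[OF sq_integrable_diff[OF a0v Pg]] L_pos] by blast
  have v_eq: "v x = (P x + g x + c) * (1 / a0 x)" if "x \<in> {0<..<L} - N3" for x
    using N3(2)[OF that] a0_bounds(3)[of x] by (simp add: field_simps)
  have pos: "0 < u x0" if x0: "0 < x0" "x0 < L" for x0
  proof -
    have "\<exists>M N. negligible N \<and> (\<forall>x\<in>{0..x0} - N. - M \<le> g x)"
      using g_lower[of "L - x0"] x0 by simp
    then obtain M N4 where N4: "negligible N4" "\<And>x. x \<in> {0..x0} - N4 \<Longrightarrow> - M \<le> g x"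
      by blast
    \<comment> \<open>\<open>u\<close> might be negative here, where \<open>\<phi>\<close> is not
      assumed monotone, so continuity of \<open>\<phi>\<close> at 0 is used on both sides of
      0.\<close>
    obtain s0 where s0: "0 < s0" "\<And>s. \<bar>s\<bar> \<le> s0 \<Longrightarrow> ereal (M - c + 1) < \<phi> s"
      using \<phi>_large_near_0 by blast
    define kap where "kap = min (1 / \<beta>) (s0 / L)"
    have "0 < kap" using \<beta>_pos L_pos s0(1) by (simp add: kap_def)
    define N where "N = N2 \<union> N3 \<union> N4 \<union> {0}"
    have N: "negligible N" using N2(1) N3(1) N4(1) by (simp add: N_def negligible_Un)
    have prim0: "primitive_on 0 x0 u v"
      by (rule primitive_on_subset[OF prim]) (use x0 in auto)
    have "kap * x0 \<le> u x0"
    proof (rule linear_lower_bound[OF prim0 _ s0(1) N])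
      fix t assume t: "t \<in> {0..x0} - N" "- s0 < u t" "u t < kap * t"
      then have tL: "t \<in> {0<..<L} - N2" "t \<in> {0<..<L} - N3" "t \<in> {0..x0} - N4"
        using x0 by (auto simp: N_def)
      have "kap * t \<le> s0 / L * L"
        using t(1) x0 s0(1) L_pos by (intro mult_mono) (auto simp: kap_def)
      then have "\<bar>u t\<bar> \<le> s0" using t(2,3) L_pos by simp
      then have "ereal (M - c + 1) < \<phi> (u t)" by (rule s0(2))
      \<comment> \<open>At a zero of \<open>u\<close>, \<open>phr\<close> would return the default 0
        in place of infinity; finiteness of \<open>\<phi> (u t)\<close> almost everywhere excludes
        such \<open>t\<close>.\<close>
      moreover have "u t \<noteq> 0" using N2(2)[OF tL(1)] \<phi>_0 by metis
      ultimately have "M - c + 1 < P t" using \<phi>_eq_phr[of "u t"] by (simp add: P_def)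
      then have "1 * (1 / a0 t) \<le> (P t + g t + c) * (1 / a0 t)"
        using N4(2)[OF tL(3)] a0_bounds(3)[of t] by (intro mult_right_mono) auto
      then have "1 / a0 t \<le> v t" using v_eq[OF tL(2)] by simp
      moreover have "kap \<le> 1 / a0 t" using A_lower[of t] by (simp add: kap_def)
      ultimately show "kap \<le> v t" by simp
    qed (use u0 x0 \<open>0 < kap\<close> in auto)
    with mult_pos_pos[OF \<open>0 < kap\<close> x0(1)] show ?thesis by simp
  qed
  have Pp: "P x = p (u x)" if "x \<in> {0<..<L}" for x
    using pos[of x] that by (simp add: P_def p_def)
  have "(\<lambda>x. (p (u x))\<^sup>2) integrable_on {0..L}"
  proof (rule integrable_spike[OF _ negligible_endpoints])
    show "(\<lambda>x. (P x)\<^sup>2) integrable_on {0..L}" using Psq by (simp add: sq_integrable_def)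
    show "(p (u x))\<^sup>2 = (P x)\<^sup>2" if "x \<in> {0..L} - {0, L}" for x using Pp[of x] that by simp
  qed
  then have psq: "sq_integrable 0 L (\<lambda>x. p (u x))"
    using p_comp_measurable[OF cont] by (simp add: sq_integrable_def)
  have "negligible (N3 \<union> {0, L})" using N3(1) by (simp add: negligible_Un)
  then have "primitive_on 0 L u (slope c u)"
  proof (rule primitive_on_cong_negligible[OF prim])
    show "slope c u x = v x" if "x \<in> {0..L} - (N3 \<union> {0, L})" for x
      using v_eq[of x] Pp[of x] that by (simp add: slope_def)
  qed
  then have "sol c u" using pos u0 psq by (auto simp: sol_def)
  then show ?thesis by blast
qed

lemma sol_H1_inner:
  assumes u: "sol c u" and w: "H10 L w"
  shows "H1_inner L u w = integral {0..L} (\<lambda>t. u t * w t) + integral {0..L} (\<lambda>t. slope c u t * H1_deriv L w t)"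
proof -
  obtain N where N: "negligible N" "\<And>x. x \<in> {0<..<L} - N \<Longrightarrow> H1_deriv L u x = slope c u x"
    "\<And>x. x \<in> {0<..<L} - N \<Longrightarrow> a x = a0 x"
    using sol_H1_deriv[OF u] by blast
  have wsq: "sq_integrable 0 L w" using w by (simp add: H10_def L2_iff_sq_integrable)
  have "(LINT x:{0<..<L}|lebesgue. u x * w x) = integral {0..L} (\<lambda>t. u t * w t)"
    by (rule LINT_eq_integral'[OF sq_integrable_mult[OF sq_integrable_continuous[OF solD(6)[OF u]] wsq]])
  moreover have "(LINT x:{0<..<L}|lebesgue. H1_deriv L u x * H1_deriv L w x) =
      integral {0..L} (\<lambda>t. slope c u t * H1_deriv L w t)"
    by (rule LINT_eq_integral[OF sq_integrable_mult[OF sq_integrable_slope[OF solD(4)[OF u]] H1_deriv(1)[OF w]] N(1)])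
      (simp add: N(2))
  ultimately show ?thesis by (simp add: H1_inner_def)
qed

text \<open>When the infimum is real, it serves as \<open>\<mu>\<close> in
  \<open>sol_parameter_bound\<close>, and the additional norm term is nonnegative. It cannot be plus
  infinity because \<open>\<phi> 1\<close> is finite, and minus infinity makes the right-hand side
  infinite.\<close>

lemma sol_parameter_le:
  assumes u: "sol c u"
  shows "ereal c \<le> ereal ((1 / sqrt L) * (\<beta> / \<alpha> + 1) * L2_norm L g) - (INF s. \<phi> s)"
proof (cases "INF s. \<phi> s")
  case (real r)
  have r: "r \<le> p s" if "0 < s" for s
  proof -
    have "ereal r \<le> \<phi> s" unfolding real[symmetric] by (rule INF_lower) simp
    then show ?thesis using \<phi>_eq_phr[of s] that by (simp add: p_def)
  qed
  have norm: "L2_norm L g = sqrt (integral {0..L} (\<lambda>x. (g x)\<^sup>2))"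
  proof -
    have "(\<lambda>x. (g x)\<^sup>2) absolutely_integrable_on {0..L}"
      using sq_integrable_mult[OF g_sq g_sq] by (simp add: power2_eq_square)
    then show ?thesis unfolding L2_norm_def by (simp add: LINT_eq_integral')
  qed
  have "0 \<le> (1 / sqrt L) * L2_norm L g"
    using L_pos g_sq unfolding norm sq_integrable_def by (simp add: integral_nonneg)
  then have "r + c \<le> (1 / sqrt L) * (\<beta> / \<alpha> + 1) * L2_norm L g"
    using sol_parameter_bound[OF u r] by (simp add: norm algebra_simps)
  then show ?thesis by (simp add: real)
next
  case PInf
  have "(INF s. \<phi> s) \<le> \<phi> 1" by (rule INF_lower) simp
  then show ?thesis using PInf \<phi>_fin[of 1] by simp
next
  case MInf
  then show ?thesis by simp
qed

end

theorem mainTheorem8: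
  fixes L \<alpha> \<beta> :: real and a g :: "real \<Rightarrow> real" and \<phi> :: "real \<Rightarrow> ereal"
  assumes L_pos: "L > 0"
    and Ha_meas: "set_borel_measurable lebesgue {0<..<L} a"
    and Ha_const: "0 < \<alpha>" "\<alpha> < \<beta>"
    and Ha_bounds: "AE x in lebesgue. x \<in> {0<..<L} \<longrightarrow> \<alpha> \<le> a x \<and> a x \<le> \<beta>"
    and g_L2: "L2 L g"
    and Hphi_cont: "continuous_on UNIV \<phi>"
    and Hphi_fin: "\<And>s. s \<noteq> 0 \<Longrightarrow> \<phi> s < \<infinity>"
    and Hphi_real: "\<And>s. \<phi> s \<noteq> -\<infinity>"
    and phi0: "\<phi> 0 = \<infinity>"
    and Hint: "\<And>\<delta>. 0 < \<delta> \<Longrightarrow> \<delta> < 1 \<Longrightarrow>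
                 set_integrable lebesgue {0<..<\<delta>} (phr \<phi>) \<and>
                 set_integrable lebesgue {-\<delta><..<0} (phr \<phi>)"
    and Hbdd: "\<And>\<delta>. 0 < \<delta> \<Longrightarrow> \<exists>B::real. \<forall>s. \<bar>s\<bar> \<ge> \<delta> \<longrightarrow> \<bar>\<phi> s\<bar> \<le> ereal B"
    and phi_mono: "\<And>s t. 0 \<le> s \<Longrightarrow> s \<le> t \<Longrightarrow> \<phi> t \<le> \<phi> s"
    and g_below: "\<And>\<eta>. 0 < \<eta> \<Longrightarrow> \<eta> < L \<Longrightarrow>
                 \<exists>M>0. AE x in lebesgue. x \<in> {0..L-\<eta>} \<longrightarrow> g x \<ge> - M"
    and exists_sol: "\<exists>u. weak_sol L a g \<phi> u"
  shows "\<exists>(cs::real) (U::real \<Rightarrow> real \<Rightarrow> real).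
     ereal cs \<le> ereal ((1 / sqrt L) * (\<beta> / \<alpha> + 1) * L2_norm L g) - (INF s. \<phi> s)
   \<and> (\<forall>c \<le> cs. H10 L (U c))
   \<and> (\<forall>w. H10 L w \<longrightarrow> continuous_on {..cs} (\<lambda>c. H1_inner L (U c) w))
   \<and> (\<forall>c \<le> cs. weak_sol L a g \<phi> (U c)
        \<and> (\<forall>\<psi>. test_fn L \<psi> \<longrightarrow>
             (LINT x:{0<..<L}|lebesgue. a x * H1_deriv L (U c) x * \<psi> x)
           = (LINT x:{0<..<L}|lebesgue. (phr \<phi> (U c x) + g x + c) * \<psi> x))
        \<and> (\<forall>x \<in> {0..L}. U c x \<ge> 0))
   \<and> (\<forall>c1 c2. c1 < c2 \<longrightarrow> c2 \<le> cs \<longrightarrow> (\<forall>x \<in> {0<..<L}. U c1 x < U c2 x))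
   \<and> (\<forall>w. H10 L w \<longrightarrow> ((\<lambda>c. H1_inner L (U c) w) \<longlongrightarrow> 0) at_bot)
   \<and> (\<forall>\<epsilon>>0. \<exists>C. \<forall>c. c \<le> C \<longrightarrow> c \<le> cs \<longrightarrow> (\<forall>x \<in> {0..L}. \<bar>U c x\<bar> < \<epsilon>))
   \<and> (\<forall>u. weak_sol L a g \<phi> u \<longrightarrow> (\<exists>c \<le> cs. \<forall>x \<in> {0..L}. u x = U c x))"
proof -
  interpret elliptic_problem L \<alpha> \<beta> a g \<phi>
    by unfold_locales
      (use L_pos Ha_meas Ha_const Ha_bounds g_L2 Hphi_cont Hphi_fin Hphi_real phi0 Hint Hbdd phi_mono g_below
        in blast)+
  obtain c0 u0 where "sol c0 u0"
    using exists_sol weak_sol_sol by blast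
  then obtain cs where cs: "\<And>c. (\<exists>u. sol c u) \<longleftrightarrow> c \<le> cs"
    using sol_parameter_maximum by blast
  \<comment> \<open>By \<open>sol_unique\<close> the choice is determined on \<open>[0,L]\<close>,
    which identifies every weak solution with a member of the family.\<close>
  define U where "U = (\<lambda>c. SOME u. sol c u)"
  have U: "sol c (U c)" if "c \<le> cs" for c
    unfolding U_def using cs that by (metis someI_ex)
  have wsq: "sq_integrable 0 L w" if "H10 L w" for w
    using that by (simp add: H10_def L2_iff_sq_integrable)
  show ?thesis
  proof (rule exI[of _ cs], rule exI[of _ U], intro conjI allI impI ballI)
    show "ereal cs \<le> ereal ((1 / sqrt L) * (\<beta> / \<alpha> + 1) * L2_norm L g) - (INF s. \<phi> s)"
      by (rule sol_parameter_le[OF U[OF order_refl]])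
    show "H10 L (U c)" if "c \<le> cs" for c
      by (rule sol_H10[OF U[OF that]])
    show "weak_sol L a g \<phi> (U c)" if "c \<le> cs" for c
      by (rule sol_weak_sol[OF U[OF that]])
    show "(LINT x:{0<..<L}|lebesgue. a x * H1_deriv L (U c) x * \<psi> x) =
        (LINT x:{0<..<L}|lebesgue. (phr \<phi> (U c x) + g x + c) * \<psi> x)"
      if "c \<le> cs" "test_fn L \<psi>" for c \<psi>
      using sol_equation[OF U[OF that(1)] test_fn_sq_integrable(1)[OF that(2)]] by simp
    show "0 \<le> U c x" if "c \<le> cs" "x \<in> {0..L}" for c x
      by (rule sol_nonneg[OF U[OF that(1)] that(2)])
    show "U c1 x < U c2 x" if "c1 < c2" "c2 \<le> cs" "x \<in> {0<..<L}" for c1 c2 x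
      using that by (intro sol_strict_mono[OF U U]) auto
    show "continuous_on {..cs} (\<lambda>c. H1_inner L (U c) w)" if w: "H10 L w" for w
      using sol_family_continuous[where cmax = cs, OF U wsq[OF w] H1_deriv(1)[OF w]]
      by (subst continuous_on_cong[OF refl sol_H1_inner[OF U w]]) auto
    show "((\<lambda>c. H1_inner L (U c) w) \<longlongrightarrow> 0) at_bot" if w: "H10 L w" for w
    proof (rule Lim_transform_eventually[OF sol_family_tendsto_0[where cmax = cs, OF U wsq[OF w] H1_deriv(1)[OF w]]])
      show "\<forall>\<^sub>F c in at_bot. integral {0..L} (\<lambda>t. U c t * w t) +
          integral {0..L} (\<lambda>t. slope c (U c) t * H1_deriv L w t) = H1_inner L (U c) w"
        using eventually_le_at_bot[of cs] by eventually_elim (simp add: sol_H1_inner[OF U w])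
    qed
    show "\<exists>C. \<forall>c. c \<le> C \<longrightarrow> c \<le> cs \<longrightarrow> (\<forall>x\<in>{0..L}. \<bar>U c x\<bar> < \<epsilon>)" if "0 < \<epsilon>" for \<epsilon>
    proof -
      obtain C where C: "\<And>c u. c \<le> C \<Longrightarrow> sol c u \<Longrightarrow> (\<forall>x\<in>{0..L}. u x < \<epsilon>)"
        using sol_uniformly_small[OF \<open>0 < \<epsilon>\<close>] by blast
      have "\<bar>U c x\<bar> < \<epsilon>" if "c \<le> C" "c \<le> cs" "x \<in> {0..L}" for c x
        using C[OF that(1) U[OF that(2)]] sol_nonneg[OF U[OF that(2)] that(3)] that(3) by simp
      then show ?thesis by blast
    qed
    show "\<exists>c\<le>cs. \<forall>x\<in>{0..L}. u x = U c x" if ws: "weak_sol L a g \<phi> u" for u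
    proof -
      obtain c where c: "sol c u" using weak_sol_sol[OF ws] by blast
      then have "c \<le> cs" using cs by blast
      then show ?thesis using sol_unique[OF c U] by blast
    qed
  qed
qed

end
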